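(* Let $\Omega\subset\mathbb R^2$ be a smooth bounded domain, $M_0>0$, $(\varepsilon_n)\subset(0,1]$ a decreasing sequence tending to $0$, and let $u_{\varepsilon_n}:\Omega\to\mathbb R^k$ be solutions of $-\Delta u_{\varepsilon_n}=-\varepsilon_n^{-2}\nabla V(u_{\varepsilon_n})$ in $\Omega$ with $\int_\Omega e_{\varepsilon_n}(u_{\varepsilon_n})\,dx\le M_0$ such that the measures $e_{\varepsilon_n}(u_{\varepsilon_n})\,dx$ converge in the sense of measures on $\Omega$ to a measure $\nu_\star$. Let $\mathcal U\subset\Omega$ be an open subset of $\Omega$ and let $\delta>0$ be given. Set $\mathcal U_\delta=\{x\in\Omega:\operatorname{dist}(x,\mathcal U)\le\delta\}$ and $\mathcal V_\delta=\mathcal U_\delta\setminus\mathcal U$. If $\nu_\star(\mathcal V_\delta)=0$, then $\nu_\star(\overline{\mathcal U})=0$.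
   Context: Let $k\ge 1$ and let $V:\mathbb R^k\to\mathbb R$ be smooth with $\inf V=0$ and satisfying: (1) $\Sigma:=\{y\in\mathbb R^k: V(y)=0\}=\{\sigma_1,\dots,\sigma_q\}$ is finite with $q\ge2$; (2) the Hessian $\nabla^2V(\sigma_i)$ is positive definite for every $i$; (3) there are constants $\alpha_\infty>0$, $R_\infty>0$ such that $y\cdot\nabla V(y)\ge\alpha_\infty|y|^2$ if $|y|>R_\infty$, and $V(y)\to+\infty$ as $|y|\to+\infty$. For $\varepsilon>0$, $e_\varepsilon(u)=\varepsilon\frac{|\nabla u|^2}{2}+\frac1\varepsilon V(u)$.
   Formalization: The closure of U is required to lie in Ω; for U = Ω the set V_δ is empty and the claim fails (e.g. a scalar tanh interface across a disc). *)

theory Defs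
  imports "HOL-Analysis.Analysis"
begin

section \<open>Differential operators on open sets\<close>

text \<open>All derivatives are taken at the filter \<open>at x\<close>, so at a point of an open set \<open>S\<close> they depend
  only on the restriction of the function to \<open>S\<close>.\<close>

definition dirderiv ::
    "('a::real_normed_vector \<Rightarrow> 'b::real_normed_vector) \<Rightarrow> 'a \<Rightarrow> 'a \<Rightarrow> 'b" where
  "dirderiv f v x = frechet_derivative f (at x) v"

definition gradient :: "('a::euclidean_space \<Rightarrow> real) \<Rightarrow> 'a \<Rightarrow> 'a" where
  "gradient f x = (\<Sum>b\<in>Basis. dirderiv f b x *\<^sub>R b)"

lemma GDERIV_gradient:
  assumes "f differentiable (at x)"
  shows "GDERIV f x :> gradient f x"
proof -
  have D: "(f has_derivative frechet_derivative f (at x)) (at x)"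
    using assms frechet_derivative_works by blast
  have "frechet_derivative f (at x) = (\<lambda>h. h \<bullet> gradient f x)"
  proof
    fix h
    have "frechet_derivative f (at x) h = frechet_derivative f (at x) (\<Sum>b\<in>Basis. (h \<bullet> b) *\<^sub>R b)"
      by (simp add: euclidean_representation)
    also have "\<dots> = (\<Sum>b\<in>Basis. (h \<bullet> b) *\<^sub>R frechet_derivative f (at x) b)"
      using has_derivative_linear[OF D] by (simp add: linear_sum linear_scale)
    also have "\<dots> = h \<bullet> gradient f x"
      by (simp add: gradient_def dirderiv_def inner_sum_right mult.commute)
    finally show "frechet_derivative f (at x) h = h \<bullet> gradient f x" .
  qed
  with D show ?thesis
    unfolding gderiv_def by simp
qed

definition hessian :: "(real^'k \<Rightarrow> real) \<Rightarrow> real^'k \<Rightarrow> real^'k^'k" where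
  "hessian f x = (\<chi> i j. dirderiv (dirderiv f (axis j 1)) (axis i 1) x)"

definition laplacian :: "('a::euclidean_space \<Rightarrow> 'b::real_normed_vector) \<Rightarrow> 'a \<Rightarrow> 'b" where
  "laplacian u x = (\<Sum>b\<in>Basis. dirderiv (dirderiv u b) b x)"

text \<open>The square of the Euclidean (Hilbert--Schmidt) norm of the full derivative.\<close>

definition grad_norm_sq :: "('a::euclidean_space \<Rightarrow> 'b::real_normed_vector) \<Rightarrow> 'a \<Rightarrow> real" where
  "grad_norm_sq u x = (\<Sum>b\<in>Basis. (norm (dirderiv u b x))\<^sup>2)"

text \<open>Class \<open>C\<^sup>m\<close> on a set \<open>S\<close>, meant for open \<open>S\<close>.\<close>

primrec Cm_on :: "nat \<Rightarrow> 'a::euclidean_space set \<Rightarrow> ('a \<Rightarrow> 'b::real_normed_vector) \<Rightarrow> bool" where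
  "Cm_on 0 S f \<longleftrightarrow> continuous_on S f"
| "Cm_on (Suc m) S f \<longleftrightarrow>
     (\<forall>x\<in>S. f differentiable (at x)) \<and> (\<forall>b\<in>Basis. Cm_on m S (dirderiv f b))"

definition smooth_on :: "'a::euclidean_space set \<Rightarrow> ('a \<Rightarrow> 'b::real_normed_vector) \<Rightarrow> bool" where
  "smooth_on S f \<longleftrightarrow> (\<forall>m. Cm_on m S f)"


section \<open>Smooth bounded domains\<close>

text \<open>Near each boundary point the domain is the negativity set of a smooth function with
  nonvanishing gradient, so it lies locally on one side of its boundary.\<close>

definition smooth_bounded_domain :: "'a::euclidean_space set \<Rightarrow> bool" where
  "smooth_bounded_domain \<Omega> \<longleftrightarrow>
     open \<Omega> \<and> connected \<Omega> \<and> \<Omega> \<noteq> {} \<and> bounded \<Omega> \<and>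
     (\<forall>x\<in>frontier \<Omega>. \<exists>N (\<rho> :: 'a \<Rightarrow> real).
        open N \<and> x \<in> N \<and> smooth_on N \<rho> \<and> gradient \<rho> x \<noteq> 0 \<and> \<Omega> \<inter> N = {y\<in>N. \<rho> y < 0})"


section \<open>Potential, energy and Allen--Cahn equation\<close>

definition multi_well_potential :: "(real^'k \<Rightarrow> real) \<Rightarrow> bool" where
  "multi_well_potential V \<longleftrightarrow>
     smooth_on UNIV V \<and> bdd_below (range V) \<and> (INF y. V y) = 0 \<and>
     finite {y. V y = 0} \<and> card {y. V y = 0} \<ge> 2 \<and>
     (\<forall>\<sigma>. V \<sigma> = 0 \<longrightarrow> (\<forall>v. v \<noteq> 0 \<longrightarrow> v \<bullet> (hessian V \<sigma> *v v) > 0)) \<and>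
     (\<exists>\<alpha>>0. \<exists>R>0. \<forall>y. norm y > R \<longrightarrow> y \<bullet> gradient V y \<ge> \<alpha> * (norm y)\<^sup>2) \<and>
     filterlim V at_top at_infinity"

definition energy_density ::
    "(real^'k \<Rightarrow> real) \<Rightarrow> real \<Rightarrow> (real^2 \<Rightarrow> real^'k) \<Rightarrow> real^2 \<Rightarrow> real" where
  "energy_density V \<epsilon> u x = \<epsilon> * (grad_norm_sq u x / 2) + (1 / \<epsilon>) * V (u x)"

text \<open>The measure \<open>e\<^sub>\<epsilon>(u) dx\<close> on \<open>\<Omega>\<close>. Wherever \<open>u\<close> is \<open>C\<^sup>1\<close> and \<open>V\<close> is nonnegative and continuous, the
  density is nonnegative and continuous, so that nothing is lost by \<open>ennreal\<close>.\<close>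

definition energy_measure ::
    "(real^'k \<Rightarrow> real) \<Rightarrow> (real^2) set \<Rightarrow> real \<Rightarrow> (real^2 \<Rightarrow> real^'k) \<Rightarrow> (real^2) measure" where
  "energy_measure V \<Omega> \<epsilon> u =
     density (restrict_space lborel \<Omega>) (\<lambda>x. ennreal (energy_density V \<epsilon> u x))"

text \<open>Classical solutions on \<open>\<Omega>\<close>; no boundary condition is imposed and the values of \<open>u\<close> outside \<open>\<Omega>\<close>
  play no role.\<close>

definition AC_solution ::
    "(real^'k \<Rightarrow> real) \<Rightarrow> (real^2) set \<Rightarrow> real \<Rightarrow> (real^2 \<Rightarrow> real^'k) \<Rightarrow> bool" where
  "AC_solution V \<Omega> \<epsilon> u \<longleftrightarrow>
     Cm_on 2 \<Omega> u \<and>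
     (\<forall>x\<in>\<Omega>. - laplacian u x = - ((1 / \<epsilon>\<^sup>2) *\<^sub>R gradient V (u x)))"


section \<open>Convergence in the sense of measures\<close>

definition radon_measure_on :: "'a::euclidean_space set \<Rightarrow> 'a measure \<Rightarrow> bool" where
  "radon_measure_on \<Omega> \<nu> \<longleftrightarrow>
     sets \<nu> = sets (restrict_space borel \<Omega>) \<and>
     (\<forall>K. compact K \<and> K \<subseteq> \<Omega> \<longrightarrow> emeasure \<nu> K < \<infinity>)"

text \<open>The test functions are the continuous functions with compact support in the open set \<open>\<Omega>\<close>,
  extended by zero to the whole space.\<close>

definition converges_as_measures_on ::
    "'a::euclidean_space set \<Rightarrow> (nat \<Rightarrow> 'a measure) \<Rightarrow> 'a measure \<Rightarrow> bool" where
  "converges_as_measures_on \<Omega> \<mu> \<nu> \<longleftrightarrow>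
     (\<forall>\<phi> :: 'a \<Rightarrow> real.
        continuous_on UNIV \<phi> \<and> compact (closure {x. \<phi> x \<noteq> 0}) \<and> closure {x. \<phi> x \<noteq> 0} \<subseteq> \<Omega> \<longrightarrow>
        (\<lambda>n. LINT x|\<mu> n. \<phi> x) \<longlonglongrightarrow> (LINT x|\<nu>. \<phi> x))"


section \<open>Neighbourhoods\<close>

text \<open>For \<open>U = {}\<close> the library convention \<open>infdist x {} = 0\<close> makes both sets equal to \<open>\<Omega>\<close>.\<close>

definition closed_nbhd_in :: "'a::metric_space set \<Rightarrow> real \<Rightarrow> 'a set \<Rightarrow> 'a set" where
  "closed_nbhd_in \<Omega> \<delta> U = {x\<in>\<Omega>. infdist x U \<le> \<delta>}"

definition outer_collar_in :: "'a::metric_space set \<Rightarrow> real \<Rightarrow> 'a set \<Rightarrow> 'a set" where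
  "outer_collar_in \<Omega> \<delta> U = closed_nbhd_in \<Omega> \<delta> U - U"

end

theory Submission
  imports Defs
begin

text \<open>Let \<open>\<eta>\<close> be a \<open>C\<^sup>1\<close> cutoff that equals 1 on the closure of \<open>U\<close> and whose gradient lives in a compact part
  \<open>C\<close> of the collar, where the energy tends to 0. Testing the divergence-free stress-energy tensor with
  \<open>\<eta>(x) x\<close> (Pohozaev) bounds \<open>\<integral> \<eta> V(u)/\<epsilon>\<close> by the energy on \<open>C\<close>, since in two dimensions the gradient
  terms cancel wherever \<open>\<eta>\<close> is constant. Testing the equation with \<open>\<eta> \<nabla>V(u)\<close> then bounds
  \<open>\<epsilon> \<integral> \<eta> D\<^sup>2V(u)(\<nabla>u, \<nabla>u)\<close>. The Hessian is positive definite at the wells, so on bounded sets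
  \<open>D\<^sup>2V(y)(v, v) \<ge> (c - k V(y)) |v|\<^sup>2\<close>, and the bad term \<open>\<epsilon> V(u) |\<nabla>u|\<^sup>2\<close> is at most a constant times
  \<open>V(u)/\<epsilon>\<close> because \<open>|\<nabla>u| \<le> const/\<epsilon>\<close>. Hence \<open>\<integral> \<eta> e\<^sub>\<epsilon>(u) \<rightarrow> 0\<close>.

  The bound on \<open>|u|\<close> comes from rectangles with sides of small energy and the maximum principle, and
  the gradient bound from a comparison function on half cubes of side proportional to \<open>\<epsilon>\<close>.\<close>

section \<open>Directional derivatives along lines\<close>

text \<open>Weak convergence only controls the full energy density on fixed compact sets, so every
  error has to be expressed by the energy on \<open>C\<close>, with constants that do not depend on
  the index. In two dimensions the trace of the stress-energy tensor is, up to sign, 2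
  V(u)/\<epsilon>. The gradient drops out, so Pohozaev controls the potential alone and a second
  identity has to supply the gradient. That identity has no sign away from the wells, where D^2V may
  be indefinite. The defect is affordable by scaling: in the variable x/\<epsilon> the equation
  loses \<epsilon>, so the natural gradient bound is of order 1/\<epsilon>, exactly the power that
  turns \<epsilon> V |grad u|^2 into V/\<epsilon>.

  No boundary values are prescribed, so a bound on |u| cannot be imported from the frontier of
  \<Omega>. Bounded Dirichlet energy gives no pointwise bound in the plane but does on a line.
  Averaging selects lines of bounded energy, and the coercivity of V carries the bound
  inwards.\<close>

lemma has_vector_derivative_along_line:
  fixes f :: "'a::real_normed_vector \<Rightarrow> 'b::real_normed_vector"
  assumes "f differentiable (at (p + s *\<^sub>R b))"
  shows "((\<lambda>t. f (p + t *\<^sub>R b)) has_vector_derivative dirderiv f b (p + s *\<^sub>R b)) (at s)"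
proof -
  have D: "(f has_derivative frechet_derivative f (at (p + s *\<^sub>R b))) (at (p + s *\<^sub>R b))"
    using assms frechet_derivative_works by blast
  have "((\<lambda>t. p + t *\<^sub>R b) has_derivative (\<lambda>t. t *\<^sub>R b)) (at s)"
    by (auto intro!: derivative_eq_intros)
  from has_derivative_compose[OF this D] show ?thesis
    unfolding has_vector_derivative_def dirderiv_def
    using linear_scale[OF has_derivative_linear[OF D]] by simp
qed

lemma has_real_derivative_along_line:
  fixes f :: "'a::real_normed_vector \<Rightarrow> real"
  assumes "f differentiable (at (p + s *\<^sub>R b))"
  shows "((\<lambda>t. f (p + t *\<^sub>R b)) has_real_derivative dirderiv f b (p + s *\<^sub>R b)) (at s)"
  using has_vector_derivative_along_line[OF assms]
  by (simp add: has_real_derivative_iff_has_vector_derivative)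

lemma has_real_derivative_inner_line:
  fixes f :: "'a::real_normed_vector \<Rightarrow> 'b::real_inner"
  assumes "f differentiable (at (p + s *\<^sub>R b))"
  shows "((\<lambda>t. f (p + t *\<^sub>R b) \<bullet> e) has_real_derivative dirderiv f b (p + s *\<^sub>R b) \<bullet> e) (at s)"
  using bounded_linear.has_vector_derivative[OF bounded_linear_inner_left
      has_vector_derivative_along_line[OF assms]]
  by (simp add: has_real_derivative_iff_has_vector_derivative)

text \<open>\<open>g'\<close> is differentiable at 0 only, so no Taylor formula with remainder is
  used: if \<open>D\<close> were positive, \<open>g'\<close> would be positive just to the right of
  its zero at 0, and the mean value theorem would lift \<open>g\<close> above its maximum.\<close>

lemma second_derivative_nonpos_at_max:
  fixes g g' :: "real \<Rightarrow> real"
  assumes d: "d > 0"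
    and g: "\<And>s. \<bar>s\<bar> < d \<Longrightarrow> (g has_real_derivative g' s) (at s)"
    and g': "(g' has_real_derivative D) (at 0)"
    and mx: "\<And>s. \<bar>s\<bar> < d \<Longrightarrow> g s \<le> g 0"
  shows "D \<le> 0"
proof (rule ccontr)
  assume "\<not> D \<le> 0"
  then obtain c where c: "c > 0" "\<And>h. 0 < h \<Longrightarrow> h < c \<Longrightarrow> g' 0 < g' (0 + h)"
    using DERIV_pos_inc_right[OF g'] by auto
  have g0: "g' 0 = 0"
    using DERIV_local_max[OF g[of 0] d] d mx by auto
  define h where "h = min c d / 2"
  have h: "0 < h" "h < c" "h < d"
    using c d by (auto simp: h_def)
  obtain z where z: "0 < z" "z < h" "g h - g 0 = (h - 0) * g' z"
    using MVT2[of 0 h g g'] h g by force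
  have "g' z > 0" using c(2)[of z] z h g0 by auto
  then have "g h - g 0 > 0" using z(3) h by simp
  with mx[of h] h show False by auto
qed

text \<open>Both second derivatives are limits of the second difference quotient over a shrinking
  parallelogram, by two applications of the mean value theorem.\<close>

lemma dirderiv_commute:
  fixes f :: "'a::real_normed_vector \<Rightarrow> 'b::real_inner"
  assumes S: "open S" "x \<in> S"
    and f: "\<And>y. y \<in> S \<Longrightarrow> f differentiable (at y)"
    and fa: "\<And>y. y \<in> S \<Longrightarrow> dirderiv f a differentiable (at y)"
    and fb: "\<And>y. y \<in> S \<Longrightarrow> dirderiv f b differentiable (at y)"
    and cab: "continuous_on S (dirderiv (dirderiv f a) b)"
    and cba: "continuous_on S (dirderiv (dirderiv f b) a)"
  shows "dirderiv (dirderiv f a) b x = dirderiv (dirderiv f b) a x"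
proof -
  \<comment> \<open>Function and directions are quantified anew because the claim is used for both
    orders of differentiation. Pairing with \<open>e\<close> reduces to real values, for which the
    mean value theorem is an equality.\<close>
  have quot: "\<exists>y. norm (y - x) \<le> h * (norm a + norm b) \<and>
      (f (x + h *\<^sub>R a + h *\<^sub>R b) - f (x + h *\<^sub>R a) - f (x + h *\<^sub>R b) + f x) \<bullet> e
        = h\<^sup>2 * (dirderiv (dirderiv f a) b y \<bullet> e)"
    if h: "h > 0" "cball x (h * (norm a + norm b)) \<subseteq> S"
      and f: "\<And>y. y \<in> S \<Longrightarrow> f differentiable (at y)"
      and fa: "\<And>y. y \<in> S \<Longrightarrow> dirderiv f a differentiable (at y)"
    for h e a b and f :: "'a \<Rightarrow> 'b"
  proof -
    have nb: "norm (s *\<^sub>R a + t *\<^sub>R b) \<le> h * (norm a + norm b)"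
      if "0 \<le> s" "s \<le> h" "0 \<le> t" "t \<le> h" for s t
    proof -
      have "norm (s *\<^sub>R a + t *\<^sub>R b) \<le> s * norm a + t * norm b"
        using norm_triangle_ineq[of "s *\<^sub>R a" "t *\<^sub>R b"] that by simp
      also have "\<dots> \<le> h * norm a + h * norm b"
        using that by (intro add_mono mult_right_mono) auto
      finally show ?thesis by (simp add: algebra_simps)
    qed
    have inS: "x + s *\<^sub>R a + t *\<^sub>R b \<in> S"
      if "0 \<le> s" "s \<le> h" "0 \<le> t" "t \<le> h" for s t
    proof -
      have "dist x (x + (s *\<^sub>R a + t *\<^sub>R b)) = norm (s *\<^sub>R a + t *\<^sub>R b)"
        by (metis add_diff_cancel_left' dist_commute dist_norm)
      then have "x + (s *\<^sub>R a + t *\<^sub>R b) \<in> cball x (h * (norm a + norm b))"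
        using nb[OF that] by simp
      then show ?thesis using h(2) by (auto simp: add.assoc)
    qed
    define p where "p s = f ((x + h *\<^sub>R b) + s *\<^sub>R a) \<bullet> e - f (x + s *\<^sub>R a) \<bullet> e" for s
    have "\<exists>s. 0 < s \<and> s < h \<and> p h - p 0 =
        (h - 0) * (dirderiv f a ((x + h *\<^sub>R b) + s *\<^sub>R a) \<bullet> e - dirderiv f a (x + s *\<^sub>R a) \<bullet> e)"
    proof (rule MVT2)
      fix s assume s: "0 \<le> s" "s \<le> h"
      show "(p has_real_derivative
          (dirderiv f a ((x + h *\<^sub>R b) + s *\<^sub>R a) \<bullet> e - dirderiv f a (x + s *\<^sub>R a) \<bullet> e)) (at s)"
        unfolding p_def
        using inS[of s h] inS[of s 0] s h
        by (intro DERIV_diff has_real_derivative_inner_line f) (auto simp: algebra_simps)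
    qed (use h in auto)
    then obtain s where s: "0 < s" "s < h"
      and ps: "p h - p 0 = h * (dirderiv f a ((x + s *\<^sub>R a) + h *\<^sub>R b) \<bullet> e
         - dirderiv f a ((x + s *\<^sub>R a) + 0 *\<^sub>R b) \<bullet> e)"
      by (auto simp: algebra_simps)
    have "\<exists>t. 0 < t \<and> t < h \<and> dirderiv f a ((x + s *\<^sub>R a) + h *\<^sub>R b) \<bullet> e
         - dirderiv f a ((x + s *\<^sub>R a) + 0 *\<^sub>R b) \<bullet> e
       = (h - 0) * (dirderiv (dirderiv f a) b ((x + s *\<^sub>R a) + t *\<^sub>R b) \<bullet> e)"
    proof (rule MVT2)
      fix t assume t: "0 \<le> t" "t \<le> h"
      show "((\<lambda>t. dirderiv f a ((x + s *\<^sub>R a) + t *\<^sub>R b) \<bullet> e) has_real_derivative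
          dirderiv (dirderiv f a) b ((x + s *\<^sub>R a) + t *\<^sub>R b) \<bullet> e) (at t)"
        using inS[of s t] s t by (intro has_real_derivative_inner_line fa) auto
    qed (use h in auto)
    then obtain t where t: "0 < t" "t < h"
      and pt: "dirderiv f a ((x + s *\<^sub>R a) + h *\<^sub>R b) \<bullet> e
         - dirderiv f a ((x + s *\<^sub>R a) + 0 *\<^sub>R b) \<bullet> e
       = h * (dirderiv (dirderiv f a) b ((x + s *\<^sub>R a) + t *\<^sub>R b) \<bullet> e)"
      by auto
    show ?thesis
    proof (intro exI conjI)
      show "norm ((x + s *\<^sub>R a) + t *\<^sub>R b - x) \<le> h * (norm a + norm b)"
        using nb[of s t] s t by (simp add: algebra_simps)
      show "(f (x + h *\<^sub>R a + h *\<^sub>R b) - f (x + h *\<^sub>R a) - f (x + h *\<^sub>R b) + f x) \<bullet> e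
        = h\<^sup>2 * (dirderiv (dirderiv f a) b ((x + s *\<^sub>R a) + t *\<^sub>R b) \<bullet> e)"
        using ps unfolding pt p_def
        by (simp add: algebra_simps power2_eq_square inner_simps)
    qed
  qed
  have "(dirderiv (dirderiv f a) b x - dirderiv (dirderiv f b) a x) \<bullet> e = 0" for e
  proof (rule ccontr)
    define F where "F y = dirderiv (dirderiv f a) b y \<bullet> e" for y
    define G where "G y = dirderiv (dirderiv f b) a y \<bullet> e" for y
    assume "\<not> ?thesis"
    then have pos: "\<bar>F x - G x\<bar> > 0" by (simp add: F_def G_def inner_diff_left)
    have "continuous_on S F" "continuous_on S G"
      unfolding F_def G_def by (intro continuous_on_inner cab cba continuous_on_const)+
    then have "isCont F x" "isCont G x"
      using S by (simp_all add: continuous_on_eq_continuous_at)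
    then have "\<exists>d>0. \<forall>y. dist y x < d \<longrightarrow> \<bar>F y - F x\<bar> < \<bar>F x - G x\<bar> / 2"
      "\<exists>d>0. \<forall>y. dist y x < d \<longrightarrow> \<bar>G y - G x\<bar> < \<bar>F x - G x\<bar> / 2"
      using half_gt_zero[OF pos] unfolding continuous_at_eps_delta dist_real_def by blast+
    then obtain d1 d2 where d1: "d1 > 0" "\<And>y. dist y x < d1 \<Longrightarrow> \<bar>F y - F x\<bar> < \<bar>F x - G x\<bar> / 2"
      and d2: "d2 > 0" "\<And>y. dist y x < d2 \<Longrightarrow> \<bar>G y - G x\<bar> < \<bar>F x - G x\<bar> / 2"
      by blast
    obtain r where r: "r > 0" "cball x r \<subseteq> S"
      using S open_contains_cball by blast
    define m where "m = min r (min d1 d2) / 2"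
    \<comment> \<open>The \<open>+ 1\<close> keeps the denominator positive when \<open>a\<close>
      and \<open>b\<close> both vanish.\<close>
    define h where "h = m / (norm a + norm b + 1)"
    have m: "m > 0" "m < d1" "m < d2" "m \<le> r" using d1 d2 r by (auto simp: m_def)
    have n1: "norm a + norm b + 1 > 0" by (smt (verit) norm_ge_zero)
    then have h: "h > 0" using m by (simp add: h_def)
    have "h * (norm a + norm b + 1) = m" using n1 by (simp add: h_def)
    then have hm: "h * (norm a + norm b) \<le> m" using h by (simp add: algebra_simps)
    have sub: "cball x (h * (norm a + norm b)) \<subseteq> S"
      using hm m r by (meson dual_order.trans subset_cball)
    obtain y where y: "norm (y - x) \<le> h * (norm a + norm b)"
      "(f (x + h *\<^sub>R a + h *\<^sub>R b) - f (x + h *\<^sub>R a) - f (x + h *\<^sub>R b) + f x) \<bullet> e = h\<^sup>2 * F y"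
      using quot[OF h sub f fa, of e] unfolding F_def by auto
    have sub': "cball x (h * (norm b + norm a)) \<subseteq> S" using sub by (simp add: add.commute)
    obtain z where z: "norm (z - x) \<le> h * (norm b + norm a)"
      "(f (x + h *\<^sub>R b + h *\<^sub>R a) - f (x + h *\<^sub>R b) - f (x + h *\<^sub>R a) + f x) \<bullet> e = h\<^sup>2 * G z"
      using quot[OF h sub' f fb, of e] unfolding G_def by auto
    have "h\<^sup>2 * F y = h\<^sup>2 * G z"
      using y(2) z(2) by (simp add: algebra_simps inner_simps)
    then have "F y = G z" using h by simp
    moreover have "dist y x < d1" "dist z x < d2"
      using y(1) z(1) hm m by (auto simp: dist_norm add.commute)
    ultimately show False using d1(2)[of y] d2(2)[of z] by (simp add: abs_if split: if_splits)
  qed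
  then show ?thesis
    by (metis inner_eq_zero_iff right_minus_eq)
qed

section \<open>Interior gradient bound\<close>

text \<open>The odd part of \<open>v\<close> under reflection in the face through \<open>x0\<close> orthogonal to \<open>m\<close> vanishes on that face;
  on the half cube it is dominated by the barrier \<open>\<psi>\<close>, which has Laplacian \<open>- N\<close> (Gilbarg and Trudinger,
  Section 3.4).\<close>

lemma interior_gradient_bound:
  fixes v :: "'a::euclidean_space \<Rightarrow> real" and h M N :: real
  assumes m: "m \<in> Basis" and h: "h > 0"
    and v: "\<And>x. x \<in> cbox (x0 - h *\<^sub>R One) (x0 + h *\<^sub>R One) \<Longrightarrow> v differentiable (at x)"
    and v': "\<And>x b. x \<in> cbox (x0 - h *\<^sub>R One) (x0 + h *\<^sub>R One) \<Longrightarrow> b \<in> Basis \<Longrightarrow>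
              dirderiv v b differentiable (at x)"
    and M: "\<And>x. x \<in> cbox (x0 - h *\<^sub>R One) (x0 + h *\<^sub>R One) \<Longrightarrow> \<bar>v x\<bar> \<le> M"
    and N: "\<And>x. x \<in> cbox (x0 - h *\<^sub>R One) (x0 + h *\<^sub>R One) \<Longrightarrow> \<bar>laplacian v x\<bar> < N"
  shows "\<bar>dirderiv v m x0\<bar> \<le> DIM('a) * M / h + N * h / 2"
proof -
  define n where "n = real DIM('a)"
  define Q where "Q = cbox (x0 - h *\<^sub>R One) (x0 + h *\<^sub>R One)"
  have mm: "m \<bullet> m = 1" using m by simp
  have n1: "n \<ge> 1" using DIM_positive[where 'a='a] unfolding n_def by linarith
  have Q_iff: "x0 + z \<in> Q \<longleftrightarrow> (\<forall>b\<in>Basis. \<bar>z \<bullet> b\<bar> \<le> h)" for z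
    unfolding Q_def mem_box by (auto simp: inner_simps abs_le_iff)
  have x0Q: "x0 \<in> Q" using Q_iff[of 0] h by simp
  have M0: "M \<ge> 0" using M x0Q unfolding Q_def by fastforce
  have N0: "N > 0" using N x0Q unfolding Q_def by fastforce
  define rf where "rf z = z - (2 * (z \<bullet> m)) *\<^sub>R m" for z :: 'a
  define \<eta> where "\<eta> b = (if b = m then -1 else (1::real))" for b :: 'a
  have rfb: "rf z \<bullet> b = \<eta> b * (z \<bullet> b)" if "b \<in> Basis" for z b
    using that m by (simp add: rf_def \<eta>_def inner_simps inner_Basis)
  have rf_line: "rf (p + s *\<^sub>R b) = rf p + (\<eta> b * s) *\<^sub>R b" if "b \<in> Basis" for p s b
    by (rule euclidean_eqI) (auto simp: rfb inner_simps inner_Basis that algebra_simps)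
  have \<eta>sq: "\<eta> b * \<eta> b = 1" "\<bar>\<eta> b\<bar> = 1" for b by (auto simp: \<eta>_def)
  have rfQ: "x0 + rf z \<in> Q" if "x0 + z \<in> Q" for z
    using that by (simp add: Q_iff rfb abs_mult \<eta>sq)
  \<comment> \<open>On each face of the half cube other than the reflecting one, the first bracket
    is at least h^2, which gives \<psi> \<ge> M. Its last two terms compensate the Laplacian 2n of
    |z|^2, and the term with \<open>N\<close> contributes -N.\<close>
  define \<psi> where "\<psi> z = M / h\<^sup>2 * (z \<bullet> z + n * h * (z \<bullet> m) - n * (z \<bullet> m)\<^sup>2)
      + N / 2 * ((z \<bullet> m) * (h - z \<bullet> m))" for z :: 'a
  \<comment> \<open>Taking \<sigma> to be 1 and -1 yields both signs of the derivative from one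
    maximum argument.\<close>
  have main: "\<sigma> * dirderiv v m x0 \<le> n * M / h + N * h / 2" if \<sigma>: "\<bar>\<sigma>\<bar> = 1" for \<sigma>
  proof -
    define w where "w z = \<sigma> / 2 * (v (x0 + z) - v (x0 + rf z)) - \<psi> z" for z
    define D where "D = cbox (- (h *\<^sub>R One) + h *\<^sub>R m) (h *\<^sub>R (One::'a))"
    have D_iff: "z \<in> D \<longleftrightarrow> (\<forall>b\<in>Basis. \<bar>z \<bullet> b\<bar> \<le> h) \<and> 0 \<le> z \<bullet> m" for z
    proof
      assume z: "z \<in> D"
      have "0 \<le> z \<bullet> m" using z m by (auto simp: D_def mem_box inner_simps mm dest: bspec[of _ _ m])
      moreover have "\<bar>z \<bullet> b\<bar> \<le> h" if b: "b \<in> Basis" for b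
      proof -
        have "- h + h * (m \<bullet> b) \<le> z \<bullet> b" "z \<bullet> b \<le> h"
          using z b by (auto simp: D_def mem_box inner_simps)
        moreover have "h * (m \<bullet> b) \<ge> 0" using b m h by (auto simp: inner_Basis)
        ultimately show ?thesis by linarith
      qed
      ultimately show "(\<forall>b\<in>Basis. \<bar>z \<bullet> b\<bar> \<le> h) \<and> 0 \<le> z \<bullet> m" by blast
    next
      assume z: "(\<forall>b\<in>Basis. \<bar>z \<bullet> b\<bar> \<le> h) \<and> 0 \<le> z \<bullet> m"
      show "z \<in> D" unfolding D_def mem_box
      proof (intro ballI conjI)
        fix b :: 'a assume b: "b \<in> Basis"
        then show "z \<bullet> b \<le> h *\<^sub>R One \<bullet> b" using z by (auto simp: inner_simps abs_le_iff)
        show "(- (h *\<^sub>R One) + h *\<^sub>R m) \<bullet> b \<le> z \<bullet> b"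
          using z b m by (cases "b = m") (force simp: inner_simps inner_Basis abs_le_iff)+
      qed
    qed
    have DQ: "x0 + z \<in> Q" if "z \<in> D" for z using that by (simp add: Q_iff D_iff)
    have vQ: "v differentiable (at x)" if "x \<in> Q" for x using v that by (simp add: Q_def)
    have contv: "continuous_on Q v"
      using vQ by (meson continuous_at_imp_continuous_on differentiable_imp_continuous_within)
    have "continuous_on D w"
      unfolding w_def \<psi>_def rf_def
      using DQ rfQ DQ h unfolding rf_def
      by (intro continuous_intros continuous_on_compose2[OF contv]) (auto)
    moreover have "compact D" "D \<noteq> {}"
      using D_iff[of 0] h by (auto simp: D_def)
    ultimately obtain p where p: "p \<in> D" and pmax: "\<And>z. z \<in> D \<Longrightarrow> w z \<le> w p"
      using continuous_attains_sup by metis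
    have pm: "0 \<le> p \<bullet> m" "p \<bullet> m \<le> h" and pb: "\<And>b. b \<in> Basis \<Longrightarrow> \<bar>p \<bullet> b\<bar> \<le> h"
      using p m unfolding D_iff by force+
    have pQ: "x0 + p \<in> Q" "x0 + rf p \<in> Q" using DQ rfQ p by auto
    have sumsq: "z \<bullet> z = (z \<bullet> m)\<^sup>2 + (\<Sum>b\<in>Basis - {m}. (z \<bullet> b)\<^sup>2)" for z :: 'a
      by (subst euclidean_inner) (simp add: sum.remove[OF finite_Basis m] power2_eq_square)
    have half: "\<sigma> / 2 * (v (x0 + p) - v (x0 + rf p)) \<le> M"
    proof -
      have "\<bar>v (x0 + p)\<bar> \<le> M" "\<bar>v (x0 + rf p)\<bar> \<le> M"
        using M pQ unfolding Q_def by auto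
      then have "\<bar>v (x0 + p) - v (x0 + rf p)\<bar> / 2 \<le> M"
        using abs_triangle_ineq4[of "v (x0 + p)" "v (x0 + rf p)"] by simp
      moreover have "\<bar>\<sigma> / 2 * (v (x0 + p) - v (x0 + rf p))\<bar> = \<bar>v (x0 + p) - v (x0 + rf p)\<bar> / 2"
        using \<sigma> by (simp add: abs_mult)
      ultimately show ?thesis by (metis abs_le_D1)
    qed
    have N2: "N / 2 * ((p \<bullet> m) * (h - p \<bullet> m)) \<ge> 0" using N0 pm by simp
    have psi_ge: "\<psi> p \<ge> M" if "p \<bullet> p + n * h * (p \<bullet> m) - n * (p \<bullet> m)\<^sup>2 \<ge> h\<^sup>2"
    proof -
      have "M / h\<^sup>2 * h\<^sup>2 \<le> M / h\<^sup>2 * (p \<bullet> p + n * h * (p \<bullet> m) - n * (p \<bullet> m)\<^sup>2)"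
        using that M0 by (intro mult_left_mono) auto
      then show ?thesis using N2 h unfolding \<psi>_def by simp
    qed
    \<comment> \<open>A positive maximum is impossible on the reflecting face, where the odd part
      vanishes and \<psi> \<ge> 0; on the other faces, where \<psi> \<ge> M; and in the interior,
      where all pure second derivatives would be nonpositive.\<close>
    have wp: "w p \<le> 0"
    proof (rule ccontr)
      assume neg: "\<not> w p \<le> 0"
      have c1: "p \<bullet> m \<noteq> 0"
      proof
        assume "p \<bullet> m = 0"
        then have "w p = - (M / h\<^sup>2 * (p \<bullet> p))" by (simp add: w_def \<psi>_def rf_def)
        also have "\<dots> \<le> 0" using M0 by simp
        finally show False using neg by simp
      qed
      have c2: "\<bar>p \<bullet> b\<bar> \<noteq> h" if b: "b \<in> Basis" for b
      proof
        assume e: "\<bar>p \<bullet> b\<bar> = h"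
        have "p \<bullet> p + n * h * (p \<bullet> m) - n * (p \<bullet> m)\<^sup>2 \<ge> h\<^sup>2"
        proof (cases "b = m")
          case True
          then have "p \<bullet> m = h" using e pm by simp
          moreover have "(\<Sum>b\<in>Basis - {m}. (p \<bullet> b)\<^sup>2) \<ge> 0" by (intro sum_nonneg) auto
          ultimately show ?thesis using sumsq[of p] by (simp add: power2_eq_square)
        next
          case False
          have "(p \<bullet> b)\<^sup>2 \<le> (\<Sum>b\<in>Basis - {m}. (p \<bullet> b)\<^sup>2)"
            using False b by (intro member_le_sum) auto
          moreover have "(p \<bullet> b)\<^sup>2 = h\<^sup>2" using e by (metis power2_abs)
          moreover have "n * (p \<bullet> m) * (h - p \<bullet> m) \<ge> 0" using pm n1 by simp
          ultimately show ?thesis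
            using sumsq[of p] by (simp add: algebra_simps power2_eq_square) (smt (verit) zero_le_square)
        qed
        then show False using psi_ge half neg unfolding w_def by linarith
      qed
      have pin: "p \<in> box (- (h *\<^sub>R One) + h *\<^sub>R m) (h *\<^sub>R (One::'a))"
        unfolding mem_box
      proof (intro ballI conjI)
        fix b :: 'a assume b: "b \<in> Basis"
        show "p \<bullet> b < h *\<^sub>R One \<bullet> b" using c2[OF b] pb[OF b] b by (auto simp: inner_simps)
        show "(- (h *\<^sub>R One) + h *\<^sub>R m) \<bullet> b < p \<bullet> b"
          using c1 pm c2[OF b] pb[OF b] b m by (cases "b = m") (auto simp: inner_simps inner_Basis)
      qed
      then obtain d where d: "d > 0" "ball p d \<subseteq> D"
        unfolding D_def by (meson open_box openE box_subset_cbox subset_trans)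
      have line: "p + s *\<^sub>R b \<in> D" if "b \<in> Basis" "\<bar>s\<bar> < d" for s b
        using that d by (auto simp: subset_iff dist_norm)
      define \<delta> where "\<delta> b = b \<bullet> m" for b
      define g' where "g' b s = \<sigma> / 2 * (dirderiv v b ((x0 + p) + s *\<^sub>R b)
            - \<eta> b * dirderiv v b ((x0 + rf p) + (\<eta> b * s) *\<^sub>R b))
          - (M / h\<^sup>2 * (2 * (p \<bullet> b) + 2 * s + n * h * \<delta> b - 2 * n * \<delta> b * (p \<bullet> m + s * \<delta> b))
            + N / 2 * (\<delta> b * (h - 2 * (p \<bullet> m + s * \<delta> b))))" for b s
      define D2 where "D2 b = \<sigma> / 2 * (dirderiv (dirderiv v b) b (x0 + p)
            - dirderiv (dirderiv v b) b (x0 + rf p))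
          - (M / h\<^sup>2 * (2 - 2 * n * \<delta> b) - N * \<delta> b)" for b
      have \<delta>01: "\<delta> b * \<delta> b = \<delta> b" if "b \<in> Basis" for b
        using that m by (auto simp: \<delta>_def inner_Basis)
      have \<delta>\<delta>: "\<delta> b * (\<delta> b * y) = \<delta> b * y" if "b \<in> Basis" for b y
        using \<delta>01[OF that] by (simp flip: mult.assoc)
      have \<eta>\<eta>: "\<eta> b * (\<eta> b * y) = y" for b y
        using \<eta>sq(1)[of b] by (simp flip: mult.assoc)
      have "D2 b \<le> 0" if b: "b \<in> Basis" for b
      proof (rule second_derivative_nonpos_at_max[OF d(1)])
        fix s :: real assume s: "\<bar>s\<bar> < d"
        show "w (p + s *\<^sub>R b) \<le> w (p + 0 *\<^sub>R b)" using pmax line[OF b s] by simp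
        have q1: "(x0 + p) + s *\<^sub>R b \<in> Q"
          using DQ[OF line[OF b s]] by (simp add: add.assoc)
        have q2: "(x0 + rf p) + (\<eta> b * s) *\<^sub>R b \<in> Q"
          using rfQ[OF DQ[OF line[OF b s]]] by (simp add: rf_line[OF b] add.assoc)
        have e1: "((\<lambda>s. v ((x0 + p) + s *\<^sub>R b)) has_real_derivative dirderiv v b ((x0 + p) + s *\<^sub>R b)) (at s)"
          by (intro has_real_derivative_along_line vQ q1)
        have e2: "((\<lambda>s. v ((x0 + rf p) + (\<eta> b * s) *\<^sub>R b)) has_real_derivative
            dirderiv v b ((x0 + rf p) + (\<eta> b * s) *\<^sub>R b) * \<eta> b) (at s)"
          by (rule DERIV_chain2[where g="\<lambda>s. \<eta> b * s", OF has_real_derivative_along_line[OF vQ[OF q2]]])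
            (auto intro!: derivative_eq_intros)
        have weq: "(\<lambda>s. w (p + s *\<^sub>R b)) = (\<lambda>s. \<sigma> / 2 * (v ((x0 + p) + s *\<^sub>R b) - v ((x0 + rf p) + (\<eta> b * s) *\<^sub>R b))
            - (M / h\<^sup>2 * (p \<bullet> p + 2 * s * (p \<bullet> b) + s\<^sup>2 + n * h * (p \<bullet> m + s * \<delta> b) - n * (p \<bullet> m + s * \<delta> b)\<^sup>2)
             + N / 2 * ((p \<bullet> m + s * \<delta> b) * (h - (p \<bullet> m + s * \<delta> b)))))"
          using b by (auto simp: fun_eq_iff w_def \<psi>_def rf_line[OF b] \<delta>_def inner_simps add.assoc
              power2_eq_square inner_commute[of b p] algebra_simps)
        show "((\<lambda>s. w (p + s *\<^sub>R b)) has_real_derivative g' b s) (at s)"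
          unfolding weq g'_def
          by (rule derivative_eq_intros e1 e2 refl | simp add: algebra_simps)+
      next
        have q: "v' \<in> Q \<Longrightarrow> dirderiv v b differentiable at v'" for v'
          using v'[OF _ b] by (simp add: Q_def)
        have e1: "((\<lambda>s. dirderiv v b ((x0 + p) + s *\<^sub>R b)) has_real_derivative
             dirderiv (dirderiv v b) b ((x0 + p) + 0 *\<^sub>R b)) (at 0)"
          by (intro has_real_derivative_along_line q) (use pQ in auto)
        have e2: "((\<lambda>s. dirderiv v b ((x0 + rf p) + (\<eta> b * s) *\<^sub>R b)) has_real_derivative
            dirderiv (dirderiv v b) b ((x0 + rf p) + (\<eta> b * 0) *\<^sub>R b) * \<eta> b) (at 0)"
          by (rule DERIV_chain2[where g="\<lambda>s. \<eta> b * s", OF has_real_derivative_along_line[OF q]])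
            (use pQ in \<open>auto intro!: derivative_eq_intros\<close>)
        show "(g' b has_real_derivative D2 b) (at 0)"
          unfolding g'_def[abs_def] D2_def
          by (rule derivative_eq_intros e1 e2 refl | simp add: algebra_simps \<eta>\<eta> \<delta>\<delta>[OF b])+
      qed
      then have "(\<Sum>b\<in>Basis. D2 b) \<le> 0" by (intro sum_nonpos)
      \<comment> \<open>The multiples of \<open>M\<close> cancel because 2 - 2n \<delta>(b) sums to
        0 over the basis. The reflection preserves the Laplacian, since each \<eta>(b) has square 1.
        The strict bound by \<open>N\<close> then makes the sum positive.\<close>
      moreover have "(\<Sum>b\<in>Basis. D2 b) = \<sigma> / 2 * (laplacian v (x0 + p) - laplacian v (x0 + rf p)) + N"
      proof -
        have "(\<Sum>b\<in>Basis. \<delta> b) = 1"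
          unfolding \<delta>_def using m by (simp add: sum.remove[OF finite_Basis m] inner_Basis)
        moreover have "D2 b = \<sigma> / 2 * dirderiv (dirderiv v b) b (x0 + p)
            - \<sigma> / 2 * dirderiv (dirderiv v b) b (x0 + rf p) - 2 * (M / h\<^sup>2)
            + (2 * n * (M / h\<^sup>2) + N) * \<delta> b" for b
          by (simp add: D2_def algebra_simps add_divide_distrib diff_divide_distrib)
        ultimately have "(\<Sum>b\<in>Basis. D2 b) = \<sigma> / 2 * laplacian v (x0 + p)
            - \<sigma> / 2 * laplacian v (x0 + rf p) - n * (2 * (M / h\<^sup>2)) + (2 * n * (M / h\<^sup>2) + N) * 1"
          by (simp only: laplacian_def sum_subtractf sum.distrib sum_distrib_left[symmetric]
              sum_constant n_def)
        then show ?thesis by (simp add: algebra_simps)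
      qed
      moreover have "\<bar>\<sigma> / 2 * (laplacian v (x0 + p) - laplacian v (x0 + rf p))\<bar> < N"
      proof -
        have "\<bar>laplacian v (x0 + p)\<bar> < N" "\<bar>laplacian v (x0 + rf p)\<bar> < N"
          using N pQ unfolding Q_def by auto
        then show ?thesis using \<sigma> by (simp add: abs_mult)
      qed
      ultimately show False by linarith
    qed
    define C where "C = n * M / h + N * h / 2"
    \<comment> \<open>\<open>C\<close> is the derivative of \<psi> at 0 in direction
      \<open>m\<close>. As \<open>L\<close> vanishes at 0 and is nonnegative for small positive t,
      its derivative at 0, which is \<open>C\<close> minus the signed derivative of
      \<open>v\<close>, cannot be negative.\<close>
    define L where "L t = t * C - \<sigma> / 2 * (v (x0 + t *\<^sub>R m) - v (x0 + (- t) *\<^sub>R m))" for t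
    have L: "L t \<ge> 0" if t: "0 < t" "t < h" for t
    proof -
      have "t *\<^sub>R m \<in> D" using t m by (auto simp: D_iff inner_Basis)
      then have "w (t *\<^sub>R m) \<le> 0" using pmax wp by fastforce
      moreover have "rf (t *\<^sub>R m) = (- t) *\<^sub>R m"
        by (simp add: rf_def mm algebra_simps flip: scaleR_left.diff)
      ultimately have "\<sigma> / 2 * (v (x0 + t *\<^sub>R m) - v (x0 + (- t) *\<^sub>R m)) \<le> \<psi> (t *\<^sub>R m)"
        by (simp add: w_def)
      also have "\<psi> (t *\<^sub>R m) = t * C - (M / h\<^sup>2 * ((n - 1) * t\<^sup>2) + N / 2 * t\<^sup>2)"
        using h by (simp add: \<psi>_def C_def mm field_simps power2_eq_square)
      also have "\<dots> \<le> t * C"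
      proof -
        have "M / h\<^sup>2 * ((n - 1) * t\<^sup>2) \<ge> 0" "N / 2 * t\<^sup>2 \<ge> 0"
          using n1 M0 N0 by (intro mult_nonneg_nonneg divide_nonneg_nonneg; simp)+
        then show ?thesis by simp
      qed
      finally show ?thesis by (simp add: L_def)
    qed
    have L': "(L has_real_derivative C - \<sigma> * dirderiv v m x0) (at 0)"
    proof -
      have vx: "v differentiable (at x0)" using vQ x0Q by simp
      have e1: "((\<lambda>t. v (x0 + t *\<^sub>R m)) has_real_derivative dirderiv v m (x0 + 0 *\<^sub>R m)) (at 0)"
        by (intro has_real_derivative_along_line) (use vx in simp)
      have e2: "((\<lambda>t. v (x0 + (- t) *\<^sub>R m)) has_real_derivative dirderiv v m (x0 + (- 0) *\<^sub>R m) * - 1) (at 0)"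
        by (rule DERIV_chain2[where g="\<lambda>t. - t", OF has_real_derivative_along_line])
          (use vx in \<open>auto intro!: derivative_eq_intros\<close>)
      show ?thesis
        unfolding L_def[abs_def]
        by (rule derivative_eq_intros e1 e2 refl | simp add: algebra_simps)+
    qed
    show ?thesis
    proof (rule ccontr)
      assume "\<not> \<sigma> * dirderiv v m x0 \<le> n * M / h + N * h / 2"
      then have "C - \<sigma> * dirderiv v m x0 < 0" by (simp add: C_def)
      then obtain d where d: "d > 0" "\<And>t. 0 < t \<Longrightarrow> t < d \<Longrightarrow> L (0 + t) < L 0"
        using DERIV_neg_dec_right[OF L'] by auto
      have "L (min d h / 2) < 0" using d h d(2)[of "min d h / 2"] by (auto simp: L_def)
      moreover have "L (min d h / 2) \<ge> 0" using L[of "min d h / 2"] d h by auto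
      ultimately show False by simp
    qed
  qed
  from main[of 1] main[of "-1"] show ?thesis by (simp add: n_def)
qed

section \<open>Integration of derivatives of compactly supported functions\<close>

lemma integrable_continuous_compact_support:
  fixes f :: "'a::euclidean_space \<Rightarrow> real"
  assumes K: "compact K" and f: "continuous_on UNIV f" and f0: "\<And>x. x \<notin> K \<Longrightarrow> f x = 0"
  shows "integrable lborel f"
proof -
  have "integrable lborel (\<lambda>x. indicator K x *\<^sub>R f x)"
    using borel_integrable_compact[OF K] f continuous_on_subset by blast
  moreover have "(\<lambda>x. indicator K x *\<^sub>R f x) = f"
    using f0 by (auto simp: indicator_def fun_eq_iff)
  ultimately show ?thesis by simp
qed

text \<open>The difference quotients integrate to zero by translation invariance of Lebesgue measure.\<close>

lemma integral_derivative_compact_support: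
  fixes f g :: "'a::euclidean_space \<Rightarrow> real"
  assumes K: "compact K" and f0: "\<And>x. x \<notin> K \<Longrightarrow> f x = 0" and g0: "\<And>x. x \<notin> K \<Longrightarrow> g x = 0"
    and contf: "continuous_on UNIV f" and contg: "continuous_on UNIV g"
    and deriv: "\<And>x. ((\<lambda>s. f (x + s *\<^sub>R b)) has_real_derivative g x) (at 0)"
  shows "integral\<^sup>L lborel g = 0"
proof -
  have int_f: "integrable lborel f"
    by (rule integrable_continuous_compact_support[OF K contf f0])
  obtain B where B: "\<And>x. \<bar>g x\<bar> \<le> B" "B \<ge> 0"
  proof -
    have "bounded (g ` K)"
      using K contg by (meson compact_continuous_image compact_imp_bounded continuous_on_subset subset_UNIV)
    then obtain B where "\<And>x. x \<in> K \<Longrightarrow> \<bar>g x\<bar> \<le> B"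
      unfolding bounded_iff by auto
    then have "\<bar>g x\<bar> \<le> max B 0" for x
      using g0[of x] by (cases "x \<in> K") (auto simp: le_max_iff_disj)
    then show ?thesis using that[of "max B 0"] by auto
  qed
  obtain R where R: "\<And>x. x \<in> K \<Longrightarrow> norm x \<le> R"
    using compact_imp_bounded[OF K] unfolding bounded_iff by blast
  have dline: "((\<lambda>s. f (x + s *\<^sub>R b)) has_real_derivative g (x + s *\<^sub>R b)) (at s)" for x s
  proof -
    have "((\<lambda>t. f ((x + s *\<^sub>R b) + t *\<^sub>R b)) has_real_derivative g (x + s *\<^sub>R b)) (at 0)"
      by (rule deriv)
    moreover have "(\<lambda>t. f ((x + s *\<^sub>R b) + t *\<^sub>R b)) = (\<lambda>t. (\<lambda>r. f (x + r *\<^sub>R b)) (t + s))"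
      by (simp add: algebra_simps)
    ultimately show ?thesis
      using DERIV_shift[of "\<lambda>r. f (x + r *\<^sub>R b)" "g (x + s *\<^sub>R b)" 0 s] by simp
  qed
  define h where "h n = inverse (real (Suc n))" for n
  have h: "h n > 0" "h n \<le> 1" for n by (auto simp: h_def field_simps)
  define q where "q n x = (f (x + h n *\<^sub>R b) - f x) / h n" for n x
  \<comment> \<open>The steps are at most 1, so a point outside the enlarged ball has neither itself
    nor its translate in \<open>K\<close>. Inside, the mean value theorem bounds the quotient by the
    supremum of |g|.\<close>
  have q_bound: "norm (q n x) \<le> B * indicator (cball 0 (R + norm b)) x" for n x
  proof (cases "x \<in> cball 0 (R + norm b)")
    case True
    obtain z where "f (x + h n *\<^sub>R b) - f (x + 0 *\<^sub>R b) = (h n - 0) * g (x + z *\<^sub>R b)"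
      using MVT2[of 0 "h n" "\<lambda>s. f (x + s *\<^sub>R b)" "\<lambda>s. g (x + s *\<^sub>R b)"] dline h(1) by blast
    then have "q n x = g (x + z *\<^sub>R b)"
      using h(1)[of n] by (simp add: q_def)
    then show ?thesis using B True by simp
  next
    case False
    have "norm (h n *\<^sub>R b) \<le> norm b"
      using h[of n] mult_right_mono[of "h n" 1 "norm b"] by simp
    then have "x \<notin> K" "x + h n *\<^sub>R b \<notin> K"
      using False R[of x] R[of "x + h n *\<^sub>R b"] norm_triangle_ineq4[of "x + h n *\<^sub>R b" "h n *\<^sub>R b"]
      by (auto simp: not_le) (smt (verit) norm_ge_zero)
    then show ?thesis using f0 False by (simp add: q_def)
  qed
  have q_int: "integral\<^sup>L lborel (q n) = 0" for n
  proof -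
    have dist: "distr lborel borel ((+) (h n *\<^sub>R b)) = (lborel :: 'a measure)"
      by (rule lborel_distr_plus)
    have m: "f \<in> borel_measurable borel" using int_f by auto
    have "integral\<^sup>L lborel (\<lambda>x. f (h n *\<^sub>R b + x)) = integral\<^sup>L (distr lborel borel ((+) (h n *\<^sub>R b))) f"
      by (rule integral_distr[symmetric]) (use m in auto)
    then have e: "integral\<^sup>L lborel (\<lambda>x. f (x + h n *\<^sub>R b)) = integral\<^sup>L lborel f"
      by (simp add: dist add.commute)
    have "integrable lborel (\<lambda>x. f (h n *\<^sub>R b + x))"
      by (rule integrable_distr[where M'=borel and T="(+) (h n *\<^sub>R b)"]) (use int_f dist in auto)
    then have i: "integrable lborel (\<lambda>x. f (x + h n *\<^sub>R b))" by (simp add: add.commute)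
    show ?thesis unfolding q_def using e i int_f by simp
  qed
  have "(\<lambda>n. integral\<^sup>L lborel (q n)) \<longlonglongrightarrow> integral\<^sup>L lborel g"
  proof (rule integral_dominated_convergence[where w="\<lambda>x. B * indicator (cball 0 (R + norm b)) x"])
    show "g \<in> borel_measurable lborel" using contg by (simp add: borel_measurable_continuous_onI)
    have m: "f \<in> borel_measurable borel" using int_f by auto
    show "q n \<in> borel_measurable lborel" for n
      unfolding q_def by (intro borel_measurable_divide borel_measurable_diff measurable_compose[OF _ m]) auto
    show "integrable lborel (\<lambda>x. B * indicator (cball (0::'a) (R + norm b)) x)"
      using emeasure_lborel_cball_finite[of "0::'a" "R + norm b"]
      by (intro integrable_mult_right integrable_real_indicator) auto
    show "AE x in lborel. (\<lambda>n. q n x) \<longlonglongrightarrow> g x"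
    proof (rule AE_I2)
      fix x
      have "((\<lambda>s. (f (x + s *\<^sub>R b) - f x) / s) \<longlongrightarrow> g x) (at 0)"
        using deriv[of x] by (simp add: has_field_derivative_iff)
      moreover have "filterlim h (at 0) sequentially"
        unfolding filterlim_at h_def using LIMSEQ_inverse_real_of_nat by auto
      ultimately show "(\<lambda>n. q n x) \<longlonglongrightarrow> g x"
        unfolding q_def by (rule filterlim_compose)
    qed
    show "AE x in lborel. norm (q n x) \<le> B * indicator (cball 0 (R + norm b)) x" for n
      using q_bound by simp
  qed
  then show ?thesis using q_int by (simp add: LIMSEQ_const_iff)
qed

text \<open>The open sets \<open>S\<close> and \<open>- K\<close> cover the space, and
  \<open>f\<close> is continuous on each of them.\<close>

lemma continuous_on_UNIV_extend_zero:
  fixes f :: "'a::euclidean_space \<Rightarrow> 'b::real_normed_vector"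
  assumes "open S" "compact K" "K \<subseteq> S" "continuous_on S f" "\<And>x. x \<notin> K \<Longrightarrow> f x = 0"
  shows "continuous_on UNIV f"
proof -
  have "continuous_on (- K) f"
    using assms(5) by (subst continuous_on_cong[where g="\<lambda>_. 0"]) auto
  then have "continuous_on (S \<union> - K) f"
    using assms by (intro continuous_on_open_Un) (auto simp: compact_imp_closed)
  moreover have "S \<union> - K = UNIV" using assms(3) by auto
  ultimately show ?thesis by simp
qed

text \<open>Serves integrands such as \<eta> V(u), about which nothing is known outside \<Omega>
  except that the cutoff makes them vanish. At a point outside \<open>S\<close>, short segments
  avoid the closed set \<open>K\<close>, so the derivative there is 0.\<close>

lemma integral_derivative_zero_local:
  fixes f g :: "'a::euclidean_space \<Rightarrow> real"
  assumes S: "open S" and K: "compact K" "K \<subseteq> S"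
    and f0: "\<And>x. x \<notin> K \<Longrightarrow> f x = 0" and g0: "\<And>x. x \<notin> K \<Longrightarrow> g x = 0"
    and contf: "continuous_on S f" and contg: "continuous_on S g"
    and deriv: "\<And>x. x \<in> S \<Longrightarrow> ((\<lambda>s. f (x + s *\<^sub>R b)) has_real_derivative g x) (at 0)"
  shows "integral\<^sup>L lborel g = 0"
proof (rule integral_derivative_compact_support[OF K(1) f0 g0])
  show "continuous_on UNIV f" "continuous_on UNIV g"
    using continuous_on_UNIV_extend_zero[OF S K] contf contg f0 g0 by auto
  show "((\<lambda>s. f (x + s *\<^sub>R b)) has_real_derivative g x) (at 0)" for x
  proof (cases "x \<in> S")
    case False
    then have x: "x \<notin> K" using K by auto
    have "open ((\<lambda>s. x + s *\<^sub>R b) -` (- K))"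
      using K by (intro continuous_open_vimage continuous_intros) (auto simp: compact_imp_closed)
    then have "((\<lambda>s. f (x + s *\<^sub>R b)) has_real_derivative 0) (at 0)"
      using x f0 by (intro has_field_derivative_transform_within_open[OF DERIV_const[of 0]]) auto
    then show ?thesis using x g0 by simp
  qed (rule deriv)
qed

section \<open>Cutoff functions\<close>

text \<open>Squaring removes the kink of the positive part at 0. This profile is the source of the
  C^1 regularity of both the cutoffs and the truncation in
  \<open>energy_bounds_curve\<close>.\<close>

lemma has_real_derivative_pos_part_square:
  "((\<lambda>t. (max 0 t)\<^sup>2) has_real_derivative 2 * max 0 t) (at t)"
proof -
  consider "t < 0" | "t > 0" | "t = 0" by linarith
  then show ?thesis
  proof cases
    case 1
    have "((\<lambda>t. (max 0 t)\<^sup>2) has_real_derivative 0) (at t)"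
      by (rule has_field_derivative_transform_within_open[OF DERIV_const[of 0], of "{..<0}"]) (use 1 in auto)
    then show ?thesis using 1 by simp
  next
    case 2
    have "((\<lambda>t. t\<^sup>2) has_real_derivative 2 * t) (at t)"
      by (auto intro!: derivative_eq_intros)
    then have "((\<lambda>t. (max 0 t)\<^sup>2) has_real_derivative 2 * t) (at t)"
      by (rule has_field_derivative_transform_within_open[of _ _ _ "{0<..}"]) (use 2 in auto)
    then show ?thesis using 2 by simp
  next
    case 3
    have "((\<lambda>h. (max 0 h)\<^sup>2 / h) \<longlongrightarrow> 0) (at (0::real))"
    proof (rule Lim_null_comparison)
      show "\<forall>\<^sub>F h in at 0. norm ((max 0 h)\<^sup>2 / h) \<le> \<bar>h\<bar>"
        by (auto simp: power2_eq_square max_def intro!: always_eventually)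
      show "((\<lambda>h::real. \<bar>h\<bar>) \<longlongrightarrow> 0) (at 0)"
        by (auto intro!: tendsto_eq_intros)
    qed
    then show ?thesis using 3 by (simp add: has_field_derivative_iff)
  qed
qed

text \<open>The bumps (r^2 - |x - c|^2)_+^2, summed over the centres of a finite cover of
  \<open>K\<close> by balls of radius r/2, have a positive lower bound on \<open>K\<close> and
  vanish at distance r from it. The outer profile 1 - (1 - s/m)_+^2 flattens the sum to the constant
  1 where s \<ge> m. One continuous derivative suffices, since each identity below differentiates
  the cutoff once.\<close>

lemma exists_cutoff:
  fixes K :: "'a::euclidean_space set"
  assumes K: "compact K" and r: "r > 0"
  obtains \<eta> :: "'a \<Rightarrow> real" and G :: "'a \<Rightarrow> 'a" where
    "\<And>x. (\<eta> has_derivative (\<lambda>v. G x \<bullet> v)) (at x)" "continuous_on UNIV G"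
    "\<And>x. 0 \<le> \<eta> x" "\<And>x. x \<in> K \<Longrightarrow> \<eta> x = 1"
    "\<And>x. \<eta> x \<noteq> 0 \<Longrightarrow> \<exists>y\<in>K. dist x y < r"
proof -
  have "K \<subseteq> (\<Union>c\<in>K. ball c (r / 2))" using r by auto
  then obtain T where T: "finite T" "T \<subseteq> K" "K \<subseteq> (\<Union>c\<in>T. ball c (r / 2))"
    using compactE_image[OF K, of K "\<lambda>c. ball c (r / 2)"] by (metis open_ball)
  define bb where "bb c x = (max 0 (r\<^sup>2 - (x - c) \<bullet> (x - c)))\<^sup>2" for c x :: 'a
  define s where "s x = (\<Sum>c\<in>T. bb c x)" for x
  \<comment> \<open>Within distance r/2 of a centre, r^2 - |x - c|^2 is at least 3 r^2/4, so a
    single bump already reaches \<open>m\<close>.\<close>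
  define m where "m = (r\<^sup>2 * 3 / 4)\<^sup>2"
  have m: "m > 0" using r by (simp add: m_def)
  define \<eta> where "\<eta> x = 1 - (max 0 (1 - s x / m))\<^sup>2" for x
  define H where "H x = (\<Sum>c\<in>T. (2 * max 0 (r\<^sup>2 - (x - c) \<bullet> (x - c))) *\<^sub>R ((-2) *\<^sub>R (x - c)))" for x
  define G where "G x = (2 * max 0 (1 - s x / m) / m) *\<^sub>R H x" for x
  have bb_nonneg: "bb c x \<ge> 0" for c x by (simp add: bb_def)
  have bb_der: "(bb c has_derivative
      (\<lambda>v. ((2 * max 0 (r\<^sup>2 - (x - c) \<bullet> (x - c))) *\<^sub>R ((-2) *\<^sub>R (x - c))) \<bullet> v)) (at x)" for c x
  proof -
    have "((\<lambda>x. r\<^sup>2 - (x - c) \<bullet> (x - c)) has_derivative (\<lambda>v. ((-2) *\<^sub>R (x - c)) \<bullet> v)) (at x)"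
      by (auto intro!: derivative_eq_intros simp: inner_commute)
    from has_derivative_compose[OF this
        has_real_derivative_pos_part_square[unfolded has_field_derivative_def]]
    show ?thesis unfolding bb_def by (simp add: algebra_simps)
  qed
  have s_der: "(s has_derivative (\<lambda>v. H x \<bullet> v)) (at x)" for x
    unfolding s_def[abs_def] H_def inner_sum_left
    by (intro has_derivative_sum bb_der)
  have \<eta>_der: "(\<eta> has_derivative (\<lambda>v. G x \<bullet> v)) (at x)" for x
  proof -
    have "((\<lambda>x. 1 - s x / m) has_derivative (\<lambda>v. - (H x \<bullet> v) / m)) (at x)"
      using m by (auto intro!: derivative_eq_intros s_der)
    from has_derivative_compose[OF this
        has_real_derivative_pos_part_square[unfolded has_field_derivative_def]]
    have "((\<lambda>x. (max 0 (1 - s x / m))\<^sup>2) has_derivative (\<lambda>v. - (G x \<bullet> v))) (at x)"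
      by (simp add: G_def algebra_simps)
    then have "((\<lambda>x. 1 - (max 0 (1 - s x / m))\<^sup>2) has_derivative (\<lambda>v. 0 - - (G x \<bullet> v))) (at x)"
      by (intro has_derivative_diff has_derivative_const)
    then show ?thesis unfolding \<eta>_def[abs_def] by simp
  qed
  have s_cont: "continuous_on UNIV s"
    by (intro continuous_at_imp_continuous_on ballI has_derivative_continuous[OF s_der])
  have "continuous_on UNIV G"
    unfolding G_def H_def using m by (intro continuous_intros s_cont) auto
  moreover have "0 \<le> \<eta> x" for x
  proof -
    have "0 \<le> s x / m" using m bb_nonneg by (simp add: s_def sum_nonneg)
    then have "(max 0 (1 - s x / m))\<^sup>2 \<le> 1\<^sup>2" by (intro power_mono) auto
    then show ?thesis by (simp add: \<eta>_def)
  qed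
  moreover have "\<eta> x = 1" if "x \<in> K" for x
  proof -
    have "x \<in> (\<Union>c\<in>T. ball c (r / 2))" using T that by blast
    then obtain c where c: "c \<in> T" "dist x c < r / 2" by (auto simp: dist_commute)
    have "(x - c) \<bullet> (x - c) = (dist x c)\<^sup>2"
      by (simp add: dist_norm power2_norm_eq_inner)
    also have "\<dots> \<le> (r / 2)\<^sup>2" using c by (intro power_mono) auto
    finally have "r\<^sup>2 * 3 / 4 \<le> max 0 (r\<^sup>2 - (x - c) \<bullet> (x - c))"
      by (intro max.coboundedI2) (simp add: power_divide)
    then have "m \<le> bb c x" unfolding m_def bb_def by (intro power_mono) auto
    also have "\<dots> \<le> s x" unfolding s_def using T c bb_nonneg by (intro member_le_sum) auto
    finally show ?thesis using m by (simp add: \<eta>_def)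
  qed
  moreover have "\<exists>y\<in>K. dist x y < r" if "\<eta> x \<noteq> 0" for x
  proof (rule ccontr)
    assume far: "\<not> ?thesis"
    have "bb c x = 0" if "c \<in> T" for c
    proof -
      have "r \<le> dist x c" using far T that by force
      then have "r\<^sup>2 \<le> (dist x c)\<^sup>2" using r by (intro power_mono) auto
      then have "r\<^sup>2 \<le> (x - c) \<bullet> (x - c)" by (simp add: dist_norm power2_norm_eq_inner)
      then show ?thesis by (simp add: bb_def)
    qed
    then have "s x = 0" by (simp add: s_def)
    then show False using that by (simp add: \<eta>_def)
  qed
  ultimately show ?thesis using that \<eta>_der by blast
qed

section \<open>Uniform bounds for solutions\<close>

lemma dirderiv_conv_gradient:
  fixes f :: "'a::euclidean_space \<Rightarrow> real"
  assumes "f differentiable (at x)"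
  shows "dirderiv f v x = v \<bullet> gradient f x"
proof -
  have "(f has_derivative (\<lambda>h. h \<bullet> gradient f x)) (at x)"
    using GDERIV_gradient[OF assms] by (simp add: gderiv_def)
  then show ?thesis unfolding dirderiv_def by (simp flip: frechet_derivative_at)
qed

text \<open>Apply the mean value theorem to V on the segment from y/2 to y, which stays outside the
  ball of radius \<open>R\<close>. Coercivity at z y, divided by z, bounds the radial slope below by
  \<alpha> z |y|^2. The length 1/2 and z > 1/2 give the factor 1/4, and V(y/2) \<ge> 0 is
  discarded.\<close>

lemma quadratic_growth:
  fixes V :: "'a::euclidean_space \<Rightarrow> real"
  assumes V: "\<And>y. V differentiable (at y)" and V0: "\<And>y. V y \<ge> 0"
    and \<alpha>: "\<alpha> > 0" and R: "R > 0"
    and coercive: "\<And>y. norm y > R \<Longrightarrow> y \<bullet> gradient V y \<ge> \<alpha> * (norm y)\<^sup>2"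
    and y: "norm y > 2 * R"
  shows "V y \<ge> \<alpha> / 4 * (norm y)\<^sup>2"
proof -
  have d: "((\<lambda>t. V (0 + t *\<^sub>R y)) has_real_derivative y \<bullet> gradient V (t *\<^sub>R y)) (at t)" for t
    using has_real_derivative_along_line[where f=V and p=0 and s=t and b=y, OF V] by (simp add: dirderiv_conv_gradient[OF V])
  obtain z where z: "1/2 < z" "z < 1"
    and eq: "V (0 + 1 *\<^sub>R y) - V (0 + (1/2) *\<^sub>R y) = (1 - 1/2) * (y \<bullet> gradient V (z *\<^sub>R y))"
    using MVT2[of "1/2" 1 "\<lambda>t. V (0 + t *\<^sub>R y)" "\<lambda>t. y \<bullet> gradient V (t *\<^sub>R y)"] d by auto
  have "norm (z *\<^sub>R y) > R"
    using z y R mult_strict_mono[of "1/2" z "2 * R" "norm y"] by simp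
  from coercive[OF this] have "z * (y \<bullet> gradient V (z *\<^sub>R y)) \<ge> z * (\<alpha> * z * (norm y)\<^sup>2)"
    using z by (simp add: power_mult_distrib power2_eq_square algebra_simps)
  then have "y \<bullet> gradient V (z *\<^sub>R y) \<ge> \<alpha> * z * (norm y)\<^sup>2" using z by simp
  moreover have "\<alpha> * z * (norm y)\<^sup>2 \<ge> \<alpha> * (1/2) * (norm y)\<^sup>2"
    using z \<alpha> by (intro mult_right_mono mult_left_mono) auto
  ultimately show ?thesis using eq V0[of "(1/2) *\<^sub>R y"] by simp
qed

text \<open>On the set where \<open>|f|\<close> is large, \<open>|d|f|\<^sup>2/dt| \<le> \<epsilon>|f'|\<^sup>2 + |f|\<^sup>2/\<epsilon>\<close> is controlled by the energy; the
  truncation \<open>\<surd>(1 + (|f|\<^sup>2 - R\<^sup>2)\<^sub>+\<^sup>2)\<close> discards the rest of the interval.\<close>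

lemma energy_bounds_curve:
  fixes f f' :: "real \<Rightarrow> 'a::real_inner" and V :: "'a \<Rightarrow> real" and a b c \<epsilon> A R :: real
  assumes ab: "a < b" and \<epsilon>: "0 < \<epsilon>" "\<epsilon> \<le> 1" and c: "c > 0" and R: "R > 0"
    and f: "\<And>t. t \<in> {a..b} \<Longrightarrow> (f has_vector_derivative f' t) (at t)"
    and f': "continuous_on {a..b} f'"
    and Vf: "continuous_on {a..b} (\<lambda>t. V (f t))"
    and V0: "\<And>y. V y \<ge> 0" and growth: "\<And>y. norm y > R \<Longrightarrow> V y \<ge> c * (norm y)\<^sup>2"
    and A: "integral {a..b} (\<lambda>t. \<epsilon> * ((norm (f' t))\<^sup>2 / 2) + (1 / \<epsilon>) * V (f t)) \<le> A"
    and AR: "A < (b - a) * (c * R\<^sup>2)"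
    and t: "t \<in> {a..b}"
  shows "(norm (f t))\<^sup>2 \<le> R\<^sup>2 + 1 + (2 + 1 / c) * A"
proof -
  define e where "e t = \<epsilon> * ((norm (f' t))\<^sup>2 / 2) + (1 / \<epsilon>) * V (f t)" for t
  have f_cont: "continuous_on {a..b} f"
    using f by (meson continuous_at_imp_continuous_on has_vector_derivative_continuous)
  have e_cont: "continuous_on {a..b} e"
    unfolding e_def by (intro continuous_intros f' Vf) auto
  have e_int: "e integrable_on {x..y}" if "a \<le> x" "y \<le> b" for x y
    using e_cont that by (intro integrable_continuous_real) (auto elim: continuous_on_subset)
  have e0: "e t \<ge> 0" for t using V0 \<epsilon> by (simp add: e_def)
  \<comment> \<open>If |f| exceeded \<open>R\<close> on the whole interval, the potential alone
    would contribute at least (b - a) c R^2, against \<open>AR\<close>. At \<tau> the truncated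
    quantity takes its base value 1.\<close>
  obtain \<tau> where \<tau>: "\<tau> \<in> {a..b}" "norm (f \<tau>) \<le> R"
  proof (rule ccontr)
    assume "\<not> thesis"
    then have far: "norm (f t) > R" if "t \<in> {a..b}" for t using that \<open>\<And>\<tau>. _ \<Longrightarrow> _ \<Longrightarrow> thesis\<close> by force
    have "integral {a..b} (\<lambda>t. c * R\<^sup>2) \<le> integral {a..b} e"
    proof (rule integral_le)
      fix t assume t: "t \<in> {a..b}"
      have "R\<^sup>2 \<le> (norm (f t))\<^sup>2" using far[OF t] R by (intro power_mono) auto
      then have "c * R\<^sup>2 \<le> c * (norm (f t))\<^sup>2" using c by simp
      also have "\<dots> \<le> V (f t)" using growth far[OF t] by simp
      also have "\<dots> \<le> (1 / \<epsilon>) * V (f t)"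
        using \<epsilon> V0[of "f t"] mult_right_mono[of 1 "1 / \<epsilon>" "V (f t)"] by simp
      also have "\<dots> \<le> e t" using \<epsilon> by (simp add: e_def)
      finally show "c * R\<^sup>2 \<le> e t" .
    qed (use e_int[of a b] in auto)
    then have "(b - a) * (c * R\<^sup>2) \<le> integral {a..b} e"
      using ab by (simp add: algebra_simps)
    moreover have "integral {a..b} e \<le> A" using A by (simp only: e_def[abs_def])
    ultimately show False using AR by linarith
  qed
  \<comment> \<open>\<open>h\<close> itself has a kink where |f| = R, but its square is
    differentiable. Hence the detour through \<open>\<Gamma>\<close>, which is differentiable and
    still dominates \<open>h\<close>.\<close>
  define h where "h t = max 0 ((norm (f t))\<^sup>2 - R\<^sup>2)" for t
  define \<Gamma> where "\<Gamma> t = sqrt (1 + (h t)\<^sup>2)" for t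
  define \<Gamma>' where "\<Gamma>' t = h t / sqrt (1 + (h t)\<^sup>2) * (2 * (f t \<bullet> f' t))" for t
  have pos: "1 + (h t)\<^sup>2 > 0" for t by (smt (verit) zero_le_power2)
  have \<Gamma>_der: "(\<Gamma> has_real_derivative \<Gamma>' t) (at t)" if t: "t \<in> {a..b}" for t
  proof -
    have "((\<lambda>t. f t \<bullet> f t) has_vector_derivative (f t \<bullet> f' t + f' t \<bullet> f t)) (at t)"
      by (rule bounded_bilinear.has_vector_derivative[OF bounded_bilinear_inner f[OF t] f[OF t]])
    then have "((\<lambda>t. (norm (f t))\<^sup>2 - R\<^sup>2) has_real_derivative 2 * (f t \<bullet> f' t)) (at t)"
      by (auto simp: has_real_derivative_iff_has_vector_derivative power2_norm_eq_inner inner_commute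
          intro!: derivative_eq_intros)
    from DERIV_chain2[OF has_real_derivative_pos_part_square this]
    have "((\<lambda>t. (h t)\<^sup>2) has_real_derivative 2 * h t * (2 * (f t \<bullet> f' t))) (at t)"
      unfolding h_def .
    then have h2: "((\<lambda>t. 1 + (h t)\<^sup>2) has_real_derivative 2 * h t * (2 * (f t \<bullet> f' t))) (at t)"
      using DERIV_add[OF DERIV_const[of 1], of "\<lambda>t. (h t)\<^sup>2"] by force
    show ?thesis
      unfolding \<Gamma>_def[abs_def] \<Gamma>'_def
      using DERIV_chain2[OF DERIV_real_sqrt[OF pos] h2] by (simp add: field_simps)
  qed
  \<comment> \<open>Where |f| > R, \<epsilon> |f'|^2 is at most 2e, and |f|^2/\<epsilon> is at most
    V(f)/(c \<epsilon>), hence at most e/c. This is the origin of 2 + 1/c.\<close>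
  have \<Gamma>'_bound: "\<bar>\<Gamma>' t\<bar> \<le> (2 + 1 / c) * e t" for t
  proof (cases "norm (f t) > R")
    case False
    then have "(norm (f t))\<^sup>2 \<le> R\<^sup>2" by (intro power_mono) auto
    then have "h t = 0" by (simp add: h_def)
    then show ?thesis using e0[of t] c by (simp add: \<Gamma>'_def)
  next
    case True
    have "\<bar>h t\<bar> \<le> sqrt (1 + (h t)\<^sup>2)" by (rule real_le_rsqrt) simp
    then have "\<bar>h t / sqrt (1 + (h t)\<^sup>2)\<bar> \<le> 1" using pos[of t] by (simp add: divide_le_eq)
    then have "\<bar>\<Gamma>' t\<bar> \<le> 1 * \<bar>2 * (f t \<bullet> f' t)\<bar>"
      unfolding \<Gamma>'_def abs_mult[of "h t / sqrt (1 + (h t)\<^sup>2)"] by (intro mult_right_mono) auto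
    also have "\<dots> \<le> 2 * (norm (f t) * norm (f' t))"
      using Cauchy_Schwarz_ineq2[of "f t" "f' t"] by simp
    also have "\<dots> \<le> \<epsilon> * (norm (f' t))\<^sup>2 + (1 / \<epsilon>) * (norm (f t))\<^sup>2"
    proof -
      have "0 \<le> (\<epsilon> * norm (f' t) - norm (f t))\<^sup>2 / \<epsilon>" using \<epsilon> by simp
      also have "\<dots> = \<epsilon> * (norm (f' t))\<^sup>2 + (1 / \<epsilon>) * (norm (f t))\<^sup>2 - 2 * (norm (f t) * norm (f' t))"
        using \<epsilon> by (simp add: power2_eq_square field_simps)
      finally show ?thesis by simp
    qed
    also have "\<dots> \<le> \<epsilon> * (norm (f' t))\<^sup>2 + (1 / \<epsilon>) * (V (f t) / c)"
      using growth[OF True] c \<epsilon> by (intro add_left_mono mult_left_mono) (auto simp: field_simps)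
    also have "\<dots> \<le> (2 + 1 / c) * e t"
    proof -
      have "(2 + 1 / c) * e t = (\<epsilon> * (norm (f' t))\<^sup>2 + (1 / \<epsilon>) * (V (f t) / c))
         + ((1 / c) * (\<epsilon> * ((norm (f' t))\<^sup>2 / 2)) + 2 * ((1 / \<epsilon>) * V (f t)))"
        by (simp add: e_def algebra_simps)
      moreover have "(1 / c) * (\<epsilon> * ((norm (f' t))\<^sup>2 / 2)) + 2 * ((1 / \<epsilon>) * V (f t)) \<ge> 0"
        using c \<epsilon> V0 by simp
      ultimately show ?thesis by linarith
    qed
    finally show ?thesis .
  qed
  have FTC: "\<bar>\<Gamma> y - \<Gamma> x\<bar> \<le> (2 + 1 / c) * A" if xy: "a \<le> x" "x \<le> y" "y \<le> b" for x y
  proof -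
    have "(\<Gamma>' has_integral (\<Gamma> y - \<Gamma> x)) {x..y}"
      using xy \<Gamma>_der
      by (intro fundamental_theorem_of_calculus)
        (auto simp: has_real_derivative_iff_has_vector_derivative intro: has_vector_derivative_at_within)
    then have eq: "\<Gamma> y - \<Gamma> x = integral {x..y} \<Gamma>'" and int: "\<Gamma>' integrable_on {x..y}"
      by (auto simp: has_integral_iff)
    have "norm (integral {x..y} \<Gamma>') \<le> integral {x..y} (\<lambda>t. (2 + 1 / c) * e t)"
      using \<Gamma>'_bound int integrable_cmul[OF e_int[of x y], of "2 + 1 / c"] xy
      by (intro integral_norm_bound_integral) (simp_all add: real_scaleR_def)
    also have "\<dots> = (2 + 1 / c) * integral {x..y} e" by simp
    also have "\<dots> \<le> (2 + 1 / c) * integral {a..b} e"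
      using xy c e0 e_int by (intro mult_left_mono integral_subset_le) auto
    also have "\<dots> \<le> (2 + 1 / c) * A"
      using A c by (intro mult_left_mono) (auto simp: e_def[abs_def])
    finally show ?thesis using eq by simp
  qed
  have "\<bar>\<Gamma> t - \<Gamma> \<tau>\<bar> \<le> (2 + 1 / c) * A"
    using FTC[of t \<tau>] FTC[of \<tau> t] t \<tau> by (cases "t \<le> \<tau>") (auto simp: abs_minus_commute)
  moreover have "\<Gamma> \<tau> = 1"
  proof -
    have "(norm (f \<tau>))\<^sup>2 \<le> R\<^sup>2" using \<tau> by (intro power_mono) auto
    then show ?thesis by (simp add: \<Gamma>_def h_def)
  qed
  moreover have "(norm (f t))\<^sup>2 - R\<^sup>2 \<le> \<Gamma> t"
  proof -
    have "h t \<le> \<Gamma> t" unfolding \<Gamma>_def by (rule real_le_rsqrt) simp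
    then show ?thesis by (simp add: h_def)
  qed
  ultimately show ?thesis by linarith
qed

section \<open>Integration along coordinate lines of the plane\<close>

lemma lborel_two_lines:
  fixes e1 e2 x0 :: "'a::euclidean_space"
  assumes B: "Basis = {e1, e2}" "e1 \<noteq> e2"
  shows "(lborel :: 'a measure) =
    distr (lborel \<Otimes>\<^sub>M lborel) borel (\<lambda>(s, t). x0 + s *\<^sub>R e1 + t *\<^sub>R e2)"
proof (rule lborel_eqI)
  let ?T = "\<lambda>(s::real, t::real). x0 + s *\<^sub>R e1 + t *\<^sub>R e2"
  have in_B: "e1 \<in> Basis" "e2 \<in> Basis" by (simp_all add: B)
  have ee: "e1 \<bullet> e1 = 1" "e2 \<bullet> e2 = 1" "e1 \<bullet> e2 = 0" "e2 \<bullet> e1 = 0"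
    using in_B B(2) by (simp_all add: inner_Basis)
  have [measurable]: "?T \<in> (lborel \<Otimes>\<^sub>M lborel) \<rightarrow>\<^sub>M borel"
    by (simp add: case_prod_beta)
  fix l u :: 'a assume lu: "\<And>b. b \<in> Basis \<Longrightarrow> l \<bullet> b \<le> u \<bullet> b"
  have "?T -` box l u \<inter> space (lborel \<Otimes>\<^sub>M lborel)
      = {l \<bullet> e1 - x0 \<bullet> e1<..<u \<bullet> e1 - x0 \<bullet> e1} \<times> {l \<bullet> e2 - x0 \<bullet> e2<..<u \<bullet> e2 - x0 \<bullet> e2}"
    using ee by (auto simp: box_def B inner_simps space_pair_measure)
  then have "emeasure (distr (lborel \<Otimes>\<^sub>M lborel) borel ?T) (box l u) =
      emeasure (lborel \<Otimes>\<^sub>M lborel)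
        ({l \<bullet> e1 - x0 \<bullet> e1<..<u \<bullet> e1 - x0 \<bullet> e1} \<times> {l \<bullet> e2 - x0 \<bullet> e2<..<u \<bullet> e2 - x0 \<bullet> e2})"
    by (subst emeasure_distr) auto
  also have "\<dots> = ennreal ((u - l) \<bullet> e1) * ennreal ((u - l) \<bullet> e2)"
    using lu by (subst lborel.emeasure_pair_measure_Times) (auto simp: B inner_simps)
  also have "\<dots> = ennreal (\<Prod>b\<in>Basis. (u - l) \<bullet> b)"
  proof -
    have "(\<Prod>b\<in>Basis. (u - l) \<bullet> b) = ((u - l) \<bullet> e1) * ((u - l) \<bullet> e2)"
      using B(2) by (simp add: B(1))
    moreover have "0 \<le> (u - l) \<bullet> e1" "0 \<le> (u - l) \<bullet> e2"
      using lu in_B by (simp_all add: inner_diff_left)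
    ultimately show ?thesis by (simp add: ennreal_mult)
  qed
  finally show "emeasure (distr (lborel \<Otimes>\<^sub>M lborel) borel ?T) (box l u) = ennreal (\<Prod>b\<in>Basis. (u - l) \<bullet> b)" .
qed simp

text \<open>Leaving the two basis vectors abstract allows them to be exchanged later, so that one
  statement provides good lines in both directions. The origin \<open>x0\<close> centres the
  coordinates at the point to be estimated.\<close>

lemma nn_integral_two_lines:
  fixes e1 e2 x0 :: "'a::euclidean_space"
  assumes B: "Basis = {e1, e2}" "e1 \<noteq> e2" and f[measurable]: "f \<in> borel_measurable borel"
  shows "(\<integral>\<^sup>+x. f x \<partial>lborel) = (\<integral>\<^sup>+s. \<integral>\<^sup>+t. f (x0 + s *\<^sub>R e1 + t *\<^sub>R e2) \<partial>lborel \<partial>lborel)"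
proof -
  have "(\<integral>\<^sup>+x. f x \<partial>lborel) =
      (\<integral>\<^sup>+p. f ((\<lambda>(s, t). x0 + s *\<^sub>R e1 + t *\<^sub>R e2) p) \<partial>(lborel \<Otimes>\<^sub>M lborel))"
    by (subst lborel_two_lines[OF B, of x0], subst nn_integral_distr) (auto simp: case_prod_beta)
  also have "\<dots> = (\<integral>\<^sup>+s. \<integral>\<^sup>+t. f (x0 + s *\<^sub>R e1 + t *\<^sub>R e2) \<partial>lborel \<partial>lborel)"
    by (subst lborel.nn_integral_fst[symmetric]) (auto simp: case_prod_beta)
  finally show ?thesis .
qed

text \<open>An averaging argument by Fubini. The numerator \<open>M + 1\<close> instead of
  \<open>M\<close> supplies the strictness: if every line were bad, the total would be at least M +
  1.\<close>

lemma exists_line_with_small_integral: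
  fixes e1 e2 x0 :: "'a::euclidean_space" and w :: "'a \<Rightarrow> real" and M p q L :: real
  assumes B: "Basis = {e1, e2}" "e1 \<noteq> e2"
    and S: "open S" and w: "continuous_on S w" "\<And>x. x \<in> S \<Longrightarrow> 0 \<le> w x"
    and M: "(\<integral>\<^sup>+x. ennreal (w x) * indicator S x \<partial>lborel) \<le> ennreal M" "M \<ge> 0"
    and sq: "\<And>s t. \<bar>s\<bar> \<le> L \<Longrightarrow> \<bar>t\<bar> \<le> L \<Longrightarrow> x0 + s *\<^sub>R e1 + t *\<^sub>R e2 \<in> S"
    and pq: "- L \<le> p" "p < q" "q \<le> L"
  shows "\<exists>s\<in>{p..q}. integral {-L..L} (\<lambda>t. w (x0 + s *\<^sub>R e1 + t *\<^sub>R e2)) \<le> (M + 1) / (q - p)"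
proof (rule ccontr)
  assume neg: "\<not> ?thesis"
  define J where "J s = integral {-L..L} (\<lambda>t. w (x0 + s *\<^sub>R e1 + t *\<^sub>R e2))" for s
  have J: "J s > (M + 1) / (q - p)" if "s \<in> {p..q}" for s
    using neg that by (auto simp: J_def not_le)
  define F where "F x = ennreal (w x) * indicator S x" for x
  have wm: "(\<lambda>x. indicator S x *\<^sub>R w x) \<in> borel_measurable borel"
    using S w by (intro borel_measurable_continuous_on_indicator) auto
  have Feq: "F = (\<lambda>x. ennreal (indicator S x *\<^sub>R w x))"
    by (auto simp: F_def indicator_def)
  have Fm[measurable]: "F \<in> borel_measurable borel"
    unfolding Feq using wm by measurable
  have inner: "(\<integral>\<^sup>+t. F (x0 + s *\<^sub>R e1 + t *\<^sub>R e2) \<partial>lborel) \<ge> ennreal ((M + 1) / (q - p)) * indicator {p..q} s" for s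
  proof (cases "s \<in> {p..q}")
    case True
    then have sL: "\<bar>s\<bar> \<le> L" using pq by auto
    have cont: "continuous_on {-L..L} (\<lambda>t. w (x0 + s *\<^sub>R e1 + t *\<^sub>R e2))"
      using sq[OF sL] by (intro continuous_on_compose2[OF w(1)] continuous_intros) auto
    have "(\<integral>\<^sup>+t. ennreal (w (x0 + s *\<^sub>R e1 + t *\<^sub>R e2)) * indicator {-L..L} t \<partial>lborel) = ennreal (J s)"
    proof (rule nn_integral_has_integral_lebesgue')
      show "((\<lambda>t. w (x0 + s *\<^sub>R e1 + t *\<^sub>R e2)) has_integral J s) {-L..L}"
        unfolding J_def by (intro integrable_integral integrable_continuous_real cont)
    qed (use sq[OF sL] w in auto)
    moreover have "(\<integral>\<^sup>+t. ennreal (w (x0 + s *\<^sub>R e1 + t *\<^sub>R e2)) * indicator {-L..L} t \<partial>lborel)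
        \<le> (\<integral>\<^sup>+t. F (x0 + s *\<^sub>R e1 + t *\<^sub>R e2) \<partial>lborel)"
      using sq[OF sL] by (intro nn_integral_mono) (auto simp: F_def indicator_def)
    moreover have "ennreal ((M + 1) / (q - p)) \<le> ennreal (J s)"
      using J[OF True] by (intro ennreal_leI) simp
    ultimately show ?thesis using True by simp
  qed auto
  have "ennreal (M + 1) = (\<integral>\<^sup>+s. ennreal ((M + 1) / (q - p)) * indicator {p..q} s \<partial>lborel)"
    using pq M by (simp add: nn_integral_cmult_indicator ennreal_mult[symmetric])
  also have "\<dots> \<le> (\<integral>\<^sup>+s. \<integral>\<^sup>+t. F (x0 + s *\<^sub>R e1 + t *\<^sub>R e2) \<partial>lborel \<partial>lborel)"
    by (intro nn_integral_mono inner)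
  also have "\<dots> = (\<integral>\<^sup>+x. F x \<partial>lborel)"
    by (rule nn_integral_two_lines[OF B Fm, symmetric])
  also have "\<dots> \<le> ennreal M" using M by (simp add: F_def)
  finally show False using M(2) by (simp add: ennreal_le_iff)
qed

section \<open>Calculus of C^2 maps and the maximum principle\<close>

lemma Cm_on_2D:
  assumes "Cm_on 2 S u"
  shows "x \<in> S \<Longrightarrow> u differentiable (at x)"
    and "b \<in> Basis \<Longrightarrow> x \<in> S \<Longrightarrow> dirderiv u b differentiable (at x)"
    and "b \<in> Basis \<Longrightarrow> c \<in> Basis \<Longrightarrow> continuous_on S (dirderiv (dirderiv u b) c)"
    and "continuous_on S u"
    and "b \<in> Basis \<Longrightarrow> continuous_on S (dirderiv u b)"
proof -
  have 1: "\<forall>x\<in>S. u differentiable (at x)"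
    "\<forall>b\<in>Basis. (\<forall>x\<in>S. dirderiv u b differentiable (at x)) \<and>
      (\<forall>c\<in>Basis. continuous_on S (dirderiv (dirderiv u b) c))"
    using assms by (simp_all add: numeral_2_eq_2)
  then show "x \<in> S \<Longrightarrow> u differentiable (at x)"
    "b \<in> Basis \<Longrightarrow> x \<in> S \<Longrightarrow> dirderiv u b differentiable (at x)"
    "b \<in> Basis \<Longrightarrow> c \<in> Basis \<Longrightarrow> continuous_on S (dirderiv (dirderiv u b) c)" by auto
  show "continuous_on S u"
    using 1 by (intro continuous_at_imp_continuous_on ballI differentiable_imp_continuous_within) auto
  show "b \<in> Basis \<Longrightarrow> continuous_on S (dirderiv u b)"
    using 1 by (intro continuous_at_imp_continuous_on ballI differentiable_imp_continuous_within) auto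
qed

lemma Basis_real_2:
  "(Basis :: (real^2) set) = {axis 1 1, axis 2 1}" "(axis 1 1 :: real^2) \<noteq> axis 2 1"
  by (auto simp: Basis_vec_def UNIV_2 axis_eq_axis)

lemma dirderiv_transform_open:
  assumes "open S" "x \<in> S" "\<And>y. y \<in> S \<Longrightarrow> f y = g y" "f differentiable (at x)"
  shows "g differentiable (at x)" "dirderiv g v x = dirderiv f v x"
proof -
  have "(f has_derivative frechet_derivative f (at x)) (at x)"
    using assms(4) frechet_derivative_works by blast
  then have g: "(g has_derivative frechet_derivative f (at x)) (at x)"
    by (rule has_derivative_transform_within_open[OF _ assms(1,2,3)])
  then show "g differentiable (at x)" by (auto simp: differentiable_def)
  show "dirderiv g v x = dirderiv f v x"
    using frechet_derivative_at[OF g] by (simp add: dirderiv_def)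
qed

lemma dirderiv_inner_const:
  fixes f :: "'a::real_normed_vector \<Rightarrow> 'b::real_inner"
  assumes "f differentiable (at x)"
  shows "(\<lambda>y. f y \<bullet> e) differentiable (at x)" "dirderiv (\<lambda>y. f y \<bullet> e) v x = dirderiv f v x \<bullet> e"
proof -
  have "(f has_derivative frechet_derivative f (at x)) (at x)"
    using assms frechet_derivative_works by blast
  then have g: "((\<lambda>y. f y \<bullet> e) has_derivative (\<lambda>v. frechet_derivative f (at x) v \<bullet> e)) (at x)"
    by (rule has_derivative_inner_left)
  then show "(\<lambda>y. f y \<bullet> e) differentiable (at x)" by (auto simp: differentiable_def)
  show "dirderiv (\<lambda>y. f y \<bullet> e) v x = dirderiv f v x \<bullet> e"
    using fun_cong[OF frechet_derivative_at[OF g], of v] by (simp add: dirderiv_def)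
qed

lemma laplacian_inner_at_max:
  fixes u :: "'a::euclidean_space \<Rightarrow> 'b::real_inner"
  assumes S: "open S" "x \<in> S" and u: "Cm_on 2 S u"
    and d: "d > 0" and mx: "\<And>s b. b \<in> Basis \<Longrightarrow> \<bar>s\<bar> < d \<Longrightarrow> norm (u (x + s *\<^sub>R b)) \<le> norm (u x)"
  shows "u x \<bullet> laplacian u x \<le> 0"
proof -
  obtain r where r: "r > 0" "ball x r \<subseteq> S" using S openE by blast
  have "u x \<bullet> dirderiv (dirderiv u b) b x \<le> 0" if b: "b \<in> Basis" for b
  proof -
    define d' where "d' = min d r"
    have d': "d' > 0" using d r by (simp add: d'_def)
    have inS: "x + s *\<^sub>R b \<in> S" if "\<bar>s\<bar> < d'" for s
      using that r b by (auto simp: d'_def subset_iff dist_norm)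
    have "2 * (u x \<bullet> dirderiv (dirderiv u b) b x + dirderiv u b x \<bullet> dirderiv u b x) \<le> 0"
    proof (rule second_derivative_nonpos_at_max[OF d'])
      fix s :: real assume s: "\<bar>s\<bar> < d'"
      have "((\<lambda>s. u (x + s *\<^sub>R b) \<bullet> u (x + s *\<^sub>R b)) has_vector_derivative
          (u (x + s *\<^sub>R b) \<bullet> dirderiv u b (x + s *\<^sub>R b) + dirderiv u b (x + s *\<^sub>R b) \<bullet> u (x + s *\<^sub>R b))) (at s)"
        using Cm_on_2D(1)[OF u inS[OF s]]
        by (intro bounded_bilinear.has_vector_derivative[OF bounded_bilinear_inner]
            has_vector_derivative_along_line)
      then show "((\<lambda>s. u (x + s *\<^sub>R b) \<bullet> u (x + s *\<^sub>R b)) has_real_derivative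
          2 * (u (x + s *\<^sub>R b) \<bullet> dirderiv u b (x + s *\<^sub>R b))) (at s)"
        by (simp add: has_real_derivative_iff_has_vector_derivative inner_commute)
      have "(norm (u (x + s *\<^sub>R b)))\<^sup>2 \<le> (norm (u x))\<^sup>2"
        using mx[OF b, of s] s by (intro power_mono) (auto simp: d'_def)
      then show "u (x + s *\<^sub>R b) \<bullet> u (x + s *\<^sub>R b) \<le> u (x + 0 *\<^sub>R b) \<bullet> u (x + 0 *\<^sub>R b)"
        by (simp add: power2_norm_eq_inner)
    next
      have x0: "x + 0 *\<^sub>R b \<in> S" using S by simp
      have "((\<lambda>s. u (x + s *\<^sub>R b) \<bullet> dirderiv u b (x + s *\<^sub>R b)) has_vector_derivative
          (u (x + 0 *\<^sub>R b) \<bullet> dirderiv (dirderiv u b) b (x + 0 *\<^sub>R b)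
            + dirderiv u b (x + 0 *\<^sub>R b) \<bullet> dirderiv u b (x + 0 *\<^sub>R b))) (at 0)"
        using Cm_on_2D(1)[OF u x0] Cm_on_2D(2)[OF u b x0]
        by (intro bounded_bilinear.has_vector_derivative[OF bounded_bilinear_inner]
            has_vector_derivative_along_line)
      then have "((\<lambda>s. u (x + s *\<^sub>R b) \<bullet> dirderiv u b (x + s *\<^sub>R b)) has_real_derivative
          (u x \<bullet> dirderiv (dirderiv u b) b x + dirderiv u b x \<bullet> dirderiv u b x)) (at 0)"
        by (simp add: has_real_derivative_iff_has_vector_derivative)
      from DERIV_cmult[OF this, of 2]
      show "((\<lambda>s. 2 * (u (x + s *\<^sub>R b) \<bullet> dirderiv u b (x + s *\<^sub>R b))) has_real_derivative
          2 * (u x \<bullet> dirderiv (dirderiv u b) b x + dirderiv u b x \<bullet> dirderiv u b x)) (at 0)" .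
    qed
    moreover have "dirderiv u b x \<bullet> dirderiv u b x \<ge> 0" by simp
    ultimately show ?thesis by (smt (verit))
  qed
  then show ?thesis unfolding laplacian_def inner_sum_right by (intro sum_nonpos)
qed

lemma continuous_on_energy_density:
  assumes u: "Cm_on 2 \<Omega> u" and V: "continuous_on UNIV V"
  shows "continuous_on \<Omega> (energy_density V \<epsilon> u)"
proof -
  have "continuous_on \<Omega> (\<lambda>x. V (u x))"
    using continuous_on_compose2[OF V Cm_on_2D(4)[OF u]] by simp
  then show ?thesis
    unfolding energy_density_def grad_norm_sq_def divide_inverse
    by (intro continuous_intros Cm_on_2D(5)[OF u])
qed

text \<open>On a line of small energy the restriction of u is a curve whose speed is the tangential
  derivative, bounded by the full gradient, so \<open>energy_bounds_curve\<close> applies on an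
  interval of length 2L.\<close>

lemma norm_le_on_good_line:
  fixes V :: "real^'k \<Rightarrow> real" and u :: "real^2 \<Rightarrow> real^'k" and e1 e2 x0 :: "real^2"
  assumes B: "Basis = {e1, e2}" "e1 \<noteq> e2"
    and \<Omega>: "open \<Omega>" and u: "Cm_on 2 \<Omega> u" and \<epsilon>: "0 < \<epsilon>" "\<epsilon> \<le> 1"
    and V: "continuous_on UNIV V" "\<And>y. V y \<ge> 0"
    and c: "c > 0" and R: "R > 0" and growth: "\<And>y. norm y > R \<Longrightarrow> V y \<ge> c * (norm y)\<^sup>2"
    and M: "(\<integral>\<^sup>+x. ennreal (energy_density V \<epsilon> u x) * indicator \<Omega> x \<partial>lborel) \<le> ennreal M" "M \<ge> 0"
    and L: "L > 0"
    and sq: "\<And>s t. \<bar>s\<bar> \<le> L \<Longrightarrow> \<bar>t\<bar> \<le> L \<Longrightarrow> x0 + s *\<^sub>R e1 + t *\<^sub>R e2 \<in> \<Omega>"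
    and pq: "- L \<le> p" "p < q" "q \<le> L"
    and AR: "(M + 1) / (q - p) < 2 * L * (c * R\<^sup>2)"
  shows "\<exists>s\<in>{p..q}. \<forall>t. \<bar>t\<bar> \<le> L \<longrightarrow>
    (norm (u (x0 + s *\<^sub>R e1 + t *\<^sub>R e2)))\<^sup>2 \<le> R\<^sup>2 + 1 + (2 + 1 / c) * ((M + 1) / (q - p))"
proof -
  have e_cont: "continuous_on \<Omega> (energy_density V \<epsilon> u)"
    by (rule continuous_on_energy_density[OF u V(1)])
  have e0: "energy_density V \<epsilon> u x \<ge> 0" for x
    using \<epsilon> V(2) by (simp add: energy_density_def grad_norm_sq_def sum_nonneg)
  obtain s where s: "s \<in> {p..q}"
    and int: "integral {-L..L} (\<lambda>t. energy_density V \<epsilon> u (x0 + s *\<^sub>R e1 + t *\<^sub>R e2)) \<le> (M + 1) / (q - p)"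
    using exists_line_with_small_integral[OF B \<Omega> e_cont e0 M sq pq] by auto
  have sL: "\<bar>s\<bar> \<le> L" using s pq by auto
  define X where "X t = (x0 + s *\<^sub>R e1) + t *\<^sub>R e2" for t
  have X: "X t \<in> \<Omega>" if "t \<in> {-L..L}" for t
    unfolding X_def using sq[OF sL, of t] that by (auto simp: abs_le_iff)
  have X_cont: "continuous_on T X" for T unfolding X_def by (intro continuous_intros)
  have b2: "e2 \<in> Basis" by (simp add: B)
  define e where "e t = \<epsilon> * ((norm (dirderiv u e2 (X t)))\<^sup>2 / 2) + (1 / \<epsilon>) * V (u (X t))" for t
  have Vu: "continuous_on {-L..L} (\<lambda>t. V (u (X t)))"
    using X by (intro continuous_on_compose2[OF V(1)] continuous_on_compose2[OF Cm_on_2D(4)[OF u] X_cont]) auto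
  have du: "continuous_on {-L..L} (\<lambda>t. dirderiv u e2 (X t))"
    using X by (intro continuous_on_compose2[OF Cm_on_2D(5)[OF u b2] X_cont]) auto
  have "integral {-L..L} e \<le> integral {-L..L} (\<lambda>t. energy_density V \<epsilon> u (X t))"
  proof (rule integral_le)
    show "e integrable_on {-L..L}"
      unfolding e_def by (intro integrable_continuous_real continuous_intros du Vu) auto
    show "(\<lambda>t. energy_density V \<epsilon> u (X t)) integrable_on {-L..L}"
      using X by (intro integrable_continuous_real continuous_on_compose2[OF e_cont X_cont]) auto
    show "e t \<le> energy_density V \<epsilon> u (X t)" for t
    proof -
      have "(norm (dirderiv u e2 (X t)))\<^sup>2 \<le> grad_norm_sq u (X t)"
        unfolding grad_norm_sq_def by (intro member_le_sum b2) auto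
      then show ?thesis using \<epsilon> by (simp add: e_def energy_density_def)
    qed
  qed
  also have "\<dots> \<le> (M + 1) / (q - p)" using int by (simp add: X_def)
  finally have A: "integral {-L..L} e \<le> (M + 1) / (q - p)" .
  have "(norm (u (X t)))\<^sup>2 \<le> R\<^sup>2 + 1 + (2 + 1 / c) * ((M + 1) / (q - p))" if "\<bar>t\<bar> \<le> L" for t
  proof (rule energy_bounds_curve[where a="-L" and b=L and V=V and \<epsilon>=\<epsilon> and f'="\<lambda>t. dirderiv u e2 (X t)"])
    show "((\<lambda>t. u (X t)) has_vector_derivative dirderiv u e2 (X t)) (at t)" if "t \<in> {-L..L}" for t
      using X[OF that] unfolding X_def
      by (intro has_vector_derivative_along_line Cm_on_2D(1)[OF u])
  qed (use L \<epsilon> c R du Vu V growth A AR that in \<open>auto simp: e_def[abs_def]\<close>)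
  then show ?thesis using s unfolding X_def by blast
qed

text \<open>Each centre is enclosed in a rectangle whose sides are good lines; outside a fixed ball the
  modulus of a solution has no interior maximum.\<close>

lemma solution_bound_at_centre:
  fixes V :: "real^'k \<Rightarrow> real" and u :: "real^2 \<Rightarrow> real^'k" and x0 :: "real^2"
  assumes \<Omega>: "open \<Omega>" and sol: "AC_solution V \<Omega> \<epsilon> u" and \<epsilon>: "0 < \<epsilon>" "\<epsilon> \<le> 1"
    and V: "continuous_on UNIV V" "\<And>y. V y \<ge> 0"
    and c: "c > 0" and R: "R > 0" and growth: "\<And>y. norm y > R \<Longrightarrow> V y \<ge> c * (norm y)\<^sup>2"
    and coercive: "\<And>y. norm y > R \<Longrightarrow> y \<bullet> gradient V y > 0"
    and M: "(\<integral>\<^sup>+x. ennreal (energy_density V \<epsilon> u x) * indicator \<Omega> x \<partial>lborel) \<le> ennreal M" "M \<ge> 0"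
    and d: "d > 0" and sq: "cball x0 (4 * d) \<subseteq> \<Omega>"
    and AR: "(M + 1) / d < 4 * d * (c * R\<^sup>2)"
  shows "(norm (u x0))\<^sup>2 \<le> R\<^sup>2 + 1 + (2 + 1 / c) * ((M + 1) / d)"
proof -
  define e1 e2 :: "real^2" where "e1 = axis 1 1" and "e2 = axis 2 1"
  have B: "Basis = {e1, e2}" "e1 \<noteq> e2" "Basis = {e2, e1}" "e2 \<noteq> e1"
    using Basis_real_2 by (auto simp: e1_def e2_def)
  have n: "norm e1 = 1" "norm e2 = 1" by (simp_all add: e1_def e2_def)
  have u: "Cm_on 2 \<Omega> u" and eq: "\<And>x. x \<in> \<Omega> \<Longrightarrow> laplacian u x = (1 / \<epsilon>\<^sup>2) *\<^sub>R gradient V (u x)"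
    using sol by (auto simp: AC_solution_def)
  define C where "C = R\<^sup>2 + 1 + (2 + 1 / c) * ((M + 1) / d)"
  define X where "X s t = x0 + s *\<^sub>R e1 + t *\<^sub>R e2" for s t
  \<comment> \<open>The offset has norm at most |s| + |t|, hence the radius 4 d in the hypothesis
    \<open>sq\<close>.\<close>
  have in1: "X s t \<in> \<Omega>" if "\<bar>s\<bar> \<le> 2 * d" "\<bar>t\<bar> \<le> 2 * d" for s t
  proof -
    have "dist x0 (X s t) = norm (s *\<^sub>R e1 + t *\<^sub>R e2)"
      unfolding X_def by (metis add.assoc add_diff_cancel_left' dist_commute dist_norm)
    also have "\<dots> \<le> \<bar>s\<bar> + \<bar>t\<bar>" using norm_triangle_ineq[of "s *\<^sub>R e1" "t *\<^sub>R e2"] n by simp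
    finally have "X s t \<in> cball x0 (4 * d)" using that by simp
    then show ?thesis using sq by blast
  qed
  have X': "X s t = x0 + t *\<^sub>R e2 + s *\<^sub>R e1" for s t by (simp add: X_def algebra_simps)
  have line1: "\<exists>s\<in>{p..q}. \<forall>t. \<bar>t\<bar> \<le> 2 * d \<longrightarrow> (norm (u (X s t)))\<^sup>2 \<le> C"
    and line2: "\<exists>t\<in>{p..q}. \<forall>s. \<bar>s\<bar> \<le> 2 * d \<longrightarrow> (norm (u (X s t)))\<^sup>2 \<le> C"
    if pq: "- (2 * d) \<le> p" "q = p + d" "q \<le> 2 * d" for p q
  proof -
    have pq': "p < q" using pq d by simp
    have qp: "q - p = d" using pq by simp
    have AR': "(M + 1) / (q - p) < 2 * (2 * d) * (c * R\<^sup>2)" using AR qp by simp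
    have d2: "2 * d > 0" using d by simp
    show "\<exists>s\<in>{p..q}. \<forall>t. \<bar>t\<bar> \<le> 2 * d \<longrightarrow> (norm (u (X s t)))\<^sup>2 \<le> C"
      using norm_le_on_good_line[OF B(1,2) \<Omega> u \<epsilon> V c R growth M d2 in1[unfolded X_def] pq(1) pq' pq(3) AR']
      unfolding C_def X_def qp by blast
    show "\<exists>t\<in>{p..q}. \<forall>s. \<bar>s\<bar> \<le> 2 * d \<longrightarrow> (norm (u (X s t)))\<^sup>2 \<le> C"
      using norm_le_on_good_line[OF B(3,4) \<Omega> u \<epsilon> V c R growth M d2 in1[unfolded X'] pq(1) pq' pq(3) AR']
      unfolding C_def X' qp by blast
  qed
  \<comment> \<open>Each side is sought in a strip at distance between d and 2 d from the centre.
    The rectangle therefore surrounds \<open>x0\<close>, and the good segments, of half length 2 d,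
    cover its edges completely.\<close>
  have "\<exists>s\<in>{-(2*d)..-d}. \<forall>t. \<bar>t\<bar> \<le> 2 * d \<longrightarrow> (norm (u (X s t)))\<^sup>2 \<le> C"
    by (rule line1) (use d in auto)
  then obtain s1 where s1: "s1 \<in> {-(2*d)..-d}" "\<And>t. \<bar>t\<bar> \<le> 2 * d \<Longrightarrow> (norm (u (X s1 t)))\<^sup>2 \<le> C"
    by blast
  have "\<exists>s\<in>{d..2*d}. \<forall>t. \<bar>t\<bar> \<le> 2 * d \<longrightarrow> (norm (u (X s t)))\<^sup>2 \<le> C"
    by (rule line1) (use d in auto)
  then obtain s2 where s2: "s2 \<in> {d..2*d}" "\<And>t. \<bar>t\<bar> \<le> 2 * d \<Longrightarrow> (norm (u (X s2 t)))\<^sup>2 \<le> C"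
    by blast
  have "\<exists>t\<in>{-(2*d)..-d}. \<forall>s. \<bar>s\<bar> \<le> 2 * d \<longrightarrow> (norm (u (X s t)))\<^sup>2 \<le> C"
    by (rule line2) (use d in auto)
  then obtain t1 where t1: "t1 \<in> {-(2*d)..-d}" "\<And>s. \<bar>s\<bar> \<le> 2 * d \<Longrightarrow> (norm (u (X s t1)))\<^sup>2 \<le> C"
    by blast
  have "\<exists>t\<in>{d..2*d}. \<forall>s. \<bar>s\<bar> \<le> 2 * d \<longrightarrow> (norm (u (X s t)))\<^sup>2 \<le> C"
    by (rule line2) (use d in auto)
  then obtain t2 where t2: "t2 \<in> {d..2*d}" "\<And>s. \<bar>s\<bar> \<le> 2 * d \<Longrightarrow> (norm (u (X s t2)))\<^sup>2 \<le> C"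
    by blast
  define Q where "Q = {s1..s2} \<times> {t1..t2}"
  have Q_in: "X (fst p) (snd p) \<in> \<Omega>" if "p \<in> Q" for p
    using that s1(1) s2(1) t1(1) t2(1) by (intro in1) (auto simp: Q_def)
  have "continuous_on Q (\<lambda>p. norm (u (X (fst p) (snd p))))"
  proof (intro continuous_on_norm continuous_on_compose2[OF Cm_on_2D(4)[OF u]])
    show "continuous_on Q (\<lambda>p. X (fst p) (snd p))" unfolding X_def by (intro continuous_intros)
  qed (use Q_in in auto)
  moreover have "compact Q" unfolding Q_def by (intro compact_Times compact_Icc)
  moreover have zero: "(0, 0) \<in> Q" using s1(1) s2(1) t1(1) t2(1) d by (auto simp: Q_def)
  then have "Q \<noteq> {}" by blast
  ultimately have "\<exists>p\<in>Q. \<forall>q\<in>Q. norm (u (X (fst q) (snd q))) \<le> norm (u (X (fst p) (snd p)))"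
    using continuous_attains_sup by blast
  then obtain p where p: "p \<in> Q"
    and pmax: "\<And>q. q \<in> Q \<Longrightarrow> norm (u (X (fst q) (snd q))) \<le> norm (u (X (fst p) (snd p)))"
    by blast
  obtain s t where st: "p = (s, t)" by fastforce
  have range: "s1 \<le> s" "s \<le> s2" "t1 \<le> t" "t \<le> t2" using p by (auto simp: Q_def st)
  have abs: "\<bar>s\<bar> \<le> 2 * d" "\<bar>t\<bar> \<le> 2 * d"
    using range s1(1) s2(1) t1(1) t2(1) by auto
  have "(norm (u (X s t)))\<^sup>2 \<le> C"
  proof (cases "s = s1 \<or> s = s2 \<or> t = t1 \<or> t = t2")
    case True
    then show ?thesis using s1(2) s2(2) t1(2) t2(2) abs by blast
  next
    case False
    \<comment> \<open>At an interior maximum u . laplacian u is nonpositive. By the equation it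
      equals u . grad V(u) divided by \<epsilon>^2, which is positive once |u| > R.\<close>
    have "norm (u (X s t)) \<le> R"
    proof (rule ccontr)
      assume big: "\<not> norm (u (X s t)) \<le> R"
      define r where "r = min (min (s - s1) (s2 - s)) (min (t - t1) (t2 - t))"
      have r: "r > 0" using False range by (auto simp: r_def)
      have inO: "X s t \<in> \<Omega>" by (rule in1[OF abs])
      have "u (X s t) \<bullet> laplacian u (X s t) \<le> 0"
      proof (rule laplacian_inner_at_max[OF \<Omega> inO u r])
        fix \<rho> b assume b: "b \<in> (Basis :: (real^2) set)" and \<rho>: "\<bar>\<rho>\<bar> < r"
        have r': "\<bar>\<rho>\<bar> < s - s1" "\<bar>\<rho>\<bar> < s2 - s" "\<bar>\<rho>\<bar> < t - t1" "\<bar>\<rho>\<bar> < t2 - t"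
          using \<rho> by (auto simp: r_def)
        have "X s t + \<rho> *\<^sub>R e1 = X (s + \<rho>) t" "X s t + \<rho> *\<^sub>R e2 = X s (t + \<rho>)"
          by (simp_all add: X_def algebra_simps)
        moreover have "(s + \<rho>, t) \<in> Q" "(s, t + \<rho>) \<in> Q"
          using r' range by (auto simp: Q_def)
        ultimately show "norm (u (X s t + \<rho> *\<^sub>R b)) \<le> norm (u (X s t))"
          using b pmax[of "(s + \<rho>, t)"] pmax[of "(s, t + \<rho>)"] by (auto simp: B(1) st)
      qed
      then have "u (X s t) \<bullet> gradient V (u (X s t)) \<le> 0"
        using eq[OF inO] \<epsilon> by (simp add: divide_le_0_iff)
      then show False using coercive[of "u (X s t)"] big by simp
    qed
    then have "(norm (u (X s t)))\<^sup>2 \<le> R\<^sup>2" by (intro power_mono) auto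
    moreover have "(2 + 1 / c) * ((M + 1) / d) \<ge> 0" using c M(2) d by simp
    ultimately show ?thesis unfolding C_def by linarith
  qed
  moreover have "norm (u x0) \<le> norm (u (X s t))"
    using pmax[OF zero] by (simp add: st X_def)
  ultimately show ?thesis unfolding C_def by (meson norm_ge_zero order_trans power_mono)
qed

section \<open>Bounds on compact sets, uniform in \<epsilon>\<close>

lemma multi_well_potentialD:
  assumes "multi_well_potential V"
  shows "Cm_on 2 UNIV V" "V y \<ge> 0" "continuous_on UNIV V"
    and "continuous_on UNIV (gradient V)"
proof -
  show C2: "Cm_on 2 UNIV V" using assms by (simp add: multi_well_potential_def smooth_on_def)
  have "(INF y. V y) \<le> V y"
    using assms by (intro cINF_lower) (auto simp: multi_well_potential_def)
  then show "V y \<ge> 0" using assms by (simp add: multi_well_potential_def)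
  show "continuous_on UNIV V" by (rule Cm_on_2D(4)[OF C2])
  show "continuous_on UNIV (gradient V)"
    unfolding gradient_def[abs_def] by (intro continuous_intros Cm_on_2D(5)[OF C2])
qed

lemma uniform_solution_bound:
  fixes V :: "real^'k \<Rightarrow> real" and \<Omega> K :: "(real^2) set" and M0 :: real
  assumes V: "multi_well_potential V" and \<Omega>: "open \<Omega>" and K: "compact K" "K \<subseteq> \<Omega>" and M0: "M0 \<ge> 0"
  shows "\<exists>M. \<forall>\<epsilon> u x. 0 < \<epsilon> \<longrightarrow> \<epsilon> \<le> 1 \<longrightarrow> AC_solution V \<Omega> \<epsilon> u \<longrightarrow>
      (\<integral>\<^sup>+x. ennreal (energy_density V \<epsilon> u x) * indicator \<Omega> x \<partial>lborel) \<le> ennreal M0 \<longrightarrow>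
      x \<in> K \<longrightarrow> norm (u x) \<le> M"
proof -
  note V' = multi_well_potentialD[OF V]
  obtain \<alpha> R0 where \<alpha>: "\<alpha> > 0" and R0: "R0 > 0"
    and coercive: "\<And>y. norm y > R0 \<Longrightarrow> y \<bullet> gradient V y \<ge> \<alpha> * (norm y)\<^sup>2"
    using V unfolding multi_well_potential_def by blast
  obtain \<rho> where \<rho>: "\<rho> > 0" "(\<Union>x\<in>K. cball x \<rho>) \<subseteq> \<Omega>"
    using compact_subset_open_imp_cball_epsilon_subset[OF K(1) \<Omega> K(2)] by blast
  define d where "d = \<rho> / 4"
  have d: "d > 0" using \<rho> by (simp add: d_def)
  define c where "c = \<alpha> / 4"
  have c: "c > 0" using \<alpha> by (simp add: c_def)
  \<comment> \<open>Enlarging \<open>R\<close> preserves growth and coercivity. The first entry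
    makes \<open>quadratic_growth\<close> available, the second makes c R^2 exceed the average
    energy on a good line, and its \<open>+ 1\<close> makes this strict.\<close>
  define R where "R = max (2 * R0) (sqrt ((M0 + 1) / d / (4 * d * c)) + 1)"
  have R: "R > 0" "R \<ge> 2 * R0" using R0 by (auto simp: R_def)
  have growth: "V y \<ge> c * (norm y)\<^sup>2" if "norm y > R" for y
    unfolding c_def
    using Cm_on_2D(1)[OF V'(1)] V'(2) \<alpha> R0 coercive that R
    by (intro quadratic_growth[where R=R0]) auto
  have pos: "y \<bullet> gradient V y > 0" if "norm y > R" for y
  proof -
    have "norm y > R0" "norm y > 0" using that R R0 by linarith+
    then have "\<alpha> * (norm y)\<^sup>2 > 0" using \<alpha> by simp
    then show ?thesis using coercive[OF \<open>norm y > R0\<close>] by linarith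
  qed
  have AR: "(M0 + 1) / d < 4 * d * (c * R\<^sup>2)"
  proof -
    define a where "a = (M0 + 1) / d / (4 * d * c)"
    have a: "a \<ge> 0" using M0 d c by (simp add: a_def)
    have "sqrt a < R" by (auto simp: R_def a_def)
    then have "(sqrt a)\<^sup>2 < R\<^sup>2" using a by (intro power_strict_mono) auto
    then have "a < R\<^sup>2" using a by simp
    then show ?thesis using d c by (simp add: a_def field_simps)
  qed
  define C where "C = R\<^sup>2 + 1 + (2 + 1 / c) * ((M0 + 1) / d)"
  show ?thesis
  proof (intro exI allI impI)
    fix \<epsilon> :: real and u :: "real^2 \<Rightarrow> real^'k" and x :: "real^2"
    assume as: "0 < \<epsilon>" "\<epsilon> \<le> 1" "AC_solution V \<Omega> \<epsilon> u"
      "(\<integral>\<^sup>+x. ennreal (energy_density V \<epsilon> u x) * indicator \<Omega> x \<partial>lborel) \<le> ennreal M0" "x \<in> K"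
    have "cball x (4 * d) \<subseteq> \<Omega>" using \<rho> as(5) by (auto simp: d_def)
    then have "(norm (u x))\<^sup>2 \<le> C"
      unfolding C_def
      by (intro solution_bound_at_centre[OF \<Omega> as(3,1,2) V'(3,2) c R(1) growth pos as(4) M0 d _ AR])
    then show "norm (u x) \<le> sqrt C" by (rule real_le_rsqrt)
  qed
qed

text \<open>On a cube of half side h of order \<epsilon>, where |u| is bounded and the Laplacian is
  of order 1/\<epsilon>^2, both terms M/h and h/\<epsilon>^2 of the interior estimate are of order
  1/\<epsilon>. The estimate is scalar, so it is applied to each component of u.\<close>

lemma uniform_gradient_bound:
  fixes V :: "real^'k \<Rightarrow> real" and \<Omega> K :: "(real^2) set" and M0 :: real
  assumes V: "multi_well_potential V" and \<Omega>: "open \<Omega>" and K: "compact K" "K \<subseteq> \<Omega>" and M0: "M0 \<ge> 0"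
  shows "\<exists>C\<ge>0. \<forall>\<epsilon> u x b. 0 < \<epsilon> \<longrightarrow> \<epsilon> \<le> 1 \<longrightarrow> AC_solution V \<Omega> \<epsilon> u \<longrightarrow>
      (\<integral>\<^sup>+x. ennreal (energy_density V \<epsilon> u x) * indicator \<Omega> x \<partial>lborel) \<le> ennreal M0 \<longrightarrow>
      x \<in> K \<longrightarrow> b \<in> Basis \<longrightarrow> norm (dirderiv u b x) \<le> C / \<epsilon>"
proof -
  note V' = multi_well_potentialD[OF V]
  obtain \<rho> where \<rho>: "\<rho> > 0" "(\<Union>x\<in>K. cball x \<rho>) \<subseteq> \<Omega>"
    using compact_subset_open_imp_cball_epsilon_subset[OF K(1) \<Omega> K(2)] by blast
  \<comment> \<open>The interior estimate at a point of \<open>K\<close> uses u on a cube around it,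
    so the sup bound is needed on a compact neighbourhood.\<close>
  define K' where "K' = {x + y |x y. x \<in> K \<and> y \<in> cball 0 \<rho>}"
  have K': "compact K'" unfolding K'_def by (intro compact_sums K compact_cball)
  have cK': "cball x \<rho> \<subseteq> K'" if "x \<in> K" for x
  proof
    fix z assume "z \<in> cball x \<rho>"
    then have "z = x + (z - x)" "z - x \<in> cball 0 \<rho>"
      by (auto simp: dist_norm norm_minus_commute)
    then show "z \<in> K'" using that unfolding K'_def by blast
  qed
  have "K' \<subseteq> \<Omega>"
  proof
    fix z assume "z \<in> K'"
    then obtain x y where "z = x + y" "x \<in> K" "norm y \<le> \<rho>" by (auto simp: K'_def)
    then have "z \<in> cball x \<rho>" by (simp add: dist_norm)
    then show "z \<in> \<Omega>" using \<rho>(2) \<open>x \<in> K\<close> by blast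
  qed
  with uniform_solution_bound[OF V \<Omega> K' _ M0] obtain M where
    M: "\<And>\<epsilon> u x. 0 < \<epsilon> \<Longrightarrow> \<epsilon> \<le> 1 \<Longrightarrow> AC_solution V \<Omega> \<epsilon> u \<Longrightarrow>
      (\<integral>\<^sup>+x. ennreal (energy_density V \<epsilon> u x) * indicator \<Omega> x \<partial>lborel) \<le> ennreal M0 \<Longrightarrow>
      x \<in> K' \<Longrightarrow> norm (u x) \<le> M" by blast
  have "bounded (gradient V ` cball 0 M)"
    using V'(4) by (meson compact_cball compact_continuous_image compact_imp_bounded continuous_on_subset subset_UNIV)
  then obtain N where N: "\<And>y. norm y \<le> M \<Longrightarrow> norm (gradient V y) \<le> N"
    unfolding bounded_iff by (metis image_eqI mem_cball_0)
  \<comment> \<open>Inserting h = \<epsilon> \<rho>/2 into 2M/h + N'h/(2 \<epsilon>^2) with N' = max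
    N 0 + 1 gives the bracket divided by \<epsilon>. The dimension factor comes from summing over
    the components.\<close>
  define C where "C = DIM(real^'k) * max 0 (4 * M / \<rho> + (max N 0 + 1) * \<rho> / 4)"
  show ?thesis
  proof (intro exI[of _ C] conjI allI impI)
    show "C \<ge> 0" by (simp add: C_def)
    fix \<epsilon> :: real and u :: "real^2 \<Rightarrow> real^'k" and x m :: "real^2"
    assume as: "0 < \<epsilon>" "\<epsilon> \<le> 1" "AC_solution V \<Omega> \<epsilon> u"
      "(\<integral>\<^sup>+x. ennreal (energy_density V \<epsilon> u x) * indicator \<Omega> x \<partial>lborel) \<le> ennreal M0" "x \<in> K" "m \<in> Basis"
    have u: "Cm_on 2 \<Omega> u" and eq: "\<And>x. x \<in> \<Omega> \<Longrightarrow> laplacian u x = (1 / \<epsilon>\<^sup>2) *\<^sub>R gradient V (u x)"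
      using as(3) by (auto simp: AC_solution_def)
    \<comment> \<open>In the plane the cube lies within distance 2h of \<open>x\<close>, and 2h =
      \<epsilon> \<rho> \<le> \<rho>.\<close>
    define h where "h = \<epsilon> * \<rho> / 2"
    have h: "h > 0" "2 * h \<le> \<rho>" using as \<rho> by (auto simp: h_def mult_left_le_one_le)
    define Q where "Q = cbox (x - h *\<^sub>R One) (x + h *\<^sub>R One)"
    have Q: "z \<in> K'" "z \<in> \<Omega>" if "z \<in> Q" for z
    proof -
      have "\<bar>(x - z) \<bullet> b\<bar> \<le> h" if "b \<in> Basis" for b
        using \<open>z \<in> Q\<close> that by (auto simp: Q_def mem_box inner_simps abs_le_iff)
      then have "norm (x - z) \<le> (\<Sum>b\<in>(Basis :: (real^2) set). h)"
        using norm_le_l1[of "x - z"] by (meson order_trans sum_mono)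
      then have "z \<in> cball x \<rho>" using h by (simp add: dist_norm)
      then show "z \<in> K'" "z \<in> \<Omega>" using cK'[OF as(5)] \<open>K' \<subseteq> \<Omega>\<close> by auto
    qed
    have comp: "\<bar>dirderiv u m x \<bullet> e\<bar> \<le> max 0 (4 * M / \<rho> + (max N 0 + 1) * \<rho> / 4) / \<epsilon>"
      if e: "e \<in> Basis" for e
    proof -
      define v where "v y = u y \<bullet> e" for y
      have dv: "v differentiable (at y)" "dirderiv v b y = dirderiv u b y \<bullet> e" if "y \<in> \<Omega>" for y b
        unfolding v_def using dirderiv_inner_const[OF Cm_on_2D(1)[OF u that]] by auto
      have ddv: "dirderiv v b differentiable (at y)"
        "dirderiv (dirderiv v b) b y = dirderiv (dirderiv u b) b y \<bullet> e" if "y \<in> \<Omega>" "b \<in> Basis" for y b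
      proof -
        have D: "(\<lambda>z. dirderiv u b z \<bullet> e) differentiable (at y)"
          "dirderiv (\<lambda>z. dirderiv u b z \<bullet> e) b y = dirderiv (dirderiv u b) b y \<bullet> e"
          using dirderiv_inner_const[OF Cm_on_2D(2)[OF u that(2,1)]] by auto
        show "dirderiv v b differentiable (at y)"
          "dirderiv (dirderiv v b) b y = dirderiv (dirderiv u b) b y \<bullet> e"
          using dirderiv_transform_open[OF \<Omega> that(1) dv(2)[symmetric] D(1)] D(2) by auto
      qed
      have lap: "laplacian v y = laplacian u y \<bullet> e" if "y \<in> \<Omega>" for y
        using ddv(2)[OF that] by (simp add: laplacian_def inner_sum_left)
      have ne: "norm e = 1" using e by simp
      have "\<bar>dirderiv v m x\<bar> \<le> DIM(real^2) * M / h + ((max N 0 + 1) / \<epsilon>\<^sup>2) * h / 2"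
      proof (rule interior_gradient_bound[OF as(6) h(1)])
        fix y assume "y \<in> cbox (x - h *\<^sub>R One) (x + h *\<^sub>R One)"
        then have y: "y \<in> K'" "y \<in> \<Omega>" using Q by (auto simp: Q_def)
        show "v differentiable (at y)" by (rule dv(1)[OF y(2)])
        show "dirderiv v b differentiable (at y)" if "b \<in> Basis" for b by (rule ddv(1)[OF y(2) that])
        have uM: "norm (u y) \<le> M" by (rule M[OF as(1-4) y(1)])
        show "\<bar>v y\<bar> \<le> M"
          using Cauchy_Schwarz_ineq2[of "u y" e] uM ne by (simp add: v_def)
        have "\<bar>gradient V (u y) \<bullet> e\<bar> \<le> N"
          using Cauchy_Schwarz_ineq2[of "gradient V (u y)" e] N[OF uM] ne by simp
        then have "\<bar>gradient V (u y) \<bullet> e\<bar> < max N 0 + 1" by linarith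
        then have "\<bar>gradient V (u y) \<bullet> e\<bar> / \<epsilon>\<^sup>2 < (max N 0 + 1) / \<epsilon>\<^sup>2"
          using as(1) by (intro divide_strict_right_mono) auto
        then show "\<bar>laplacian v y\<bar> < (max N 0 + 1) / \<epsilon>\<^sup>2"
          by (simp add: lap[OF y(2)] eq[OF y(2)] abs_mult)
      qed
      also have "\<dots> = (4 * M / \<rho> + (max N 0 + 1) * \<rho> / 4) / \<epsilon>"
        using as(1) \<rho>(1) by (simp add: h_def field_simps power2_eq_square)
      also have "\<dots> \<le> max 0 (4 * M / \<rho> + (max N 0 + 1) * \<rho> / 4) / \<epsilon>"
        using as(1) by (intro divide_right_mono) auto
      finally show ?thesis
        using dv(2) as(5) K(2) by auto
    qed
    have "norm (dirderiv u m x) \<le> (\<Sum>e\<in>Basis. \<bar>dirderiv u m x \<bullet> e\<bar>)" by (rule norm_le_l1)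
    also have "\<dots> \<le> (\<Sum>e\<in>(Basis :: (real^'k) set). max 0 (4 * M / \<rho> + (max N 0 + 1) * \<rho> / 4) / \<epsilon>)"
      by (intro sum_mono comp)
    also have "\<dots> = C / \<epsilon>" by (simp add: C_def)
    finally show "norm (dirderiv u m x) \<le> C / \<epsilon>" .
  qed
qed

section \<open>The Hessian of the potential\<close>

text \<open>The bilinear form in which D^2V enters the chain rule for grad V(u). The derivative
  falls on the component \<open>d\<close> of the gradient in direction \<open>c\<close>, so the link
  with the derivative of \<open>gradient V\<close> requires no exchange of second
  derivatives.\<close>

definition hessian_form :: "('a::euclidean_space \<Rightarrow> real) \<Rightarrow> 'a \<Rightarrow> 'a \<Rightarrow> 'a \<Rightarrow> real" where
  "hessian_form V y v w = (\<Sum>c\<in>Basis. \<Sum>d\<in>Basis. (v \<bullet> c) * (w \<bullet> d) * dirderiv (dirderiv V d) c y)"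

lemma hessian_form_eq_hessian:
  fixes V :: "real^'k \<Rightarrow> real"
  shows "hessian_form V y v v = v \<bullet> (hessian V y *v v)"
proof -
  have B: "(Basis :: (real^'k) set) = (\<lambda>i. axis i 1) ` UNIV"
    by (auto simp: Basis_vec_def)
  have inj: "inj (\<lambda>i::'k. axis i (1::real))" by (auto simp: inj_on_def axis_eq_axis)
  have "v \<bullet> (hessian V y *v v) = (\<Sum>i\<in>UNIV. \<Sum>j\<in>UNIV. v $ i * (hessian V y $ i $ j * v $ j))"
    by (simp add: inner_vec_def matrix_vector_mult_def sum_distrib_left)
  also have "\<dots> = hessian_form V y v v"
    unfolding hessian_form_def B
    by (simp add: sum.reindex[OF inj] inner_axis hessian_def algebra_simps)
  finally show ?thesis ..
qed

lemma hessian_form_scale: "hessian_form V y (r *\<^sub>R v) (r *\<^sub>R v) = r\<^sup>2 * hessian_form V y v v"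
  by (simp add: hessian_form_def sum_distrib_left power2_eq_square algebra_simps)

lemma continuous_on_hessian_form:
  fixes V :: "'a::euclidean_space \<Rightarrow> real"
  assumes V: "Cm_on 2 UNIV V" and f: "continuous_on S f" and g: "continuous_on S g" and h: "continuous_on S h"
  shows "continuous_on S (\<lambda>x. hessian_form V (f x) (g x) (h x))"
  unfolding hessian_form_def
  by (intro continuous_intros f g h continuous_on_compose2[OF Cm_on_2D(3)[OF V] f]) auto

lemma gradient_has_derivative:
  fixes V :: "'a::euclidean_space \<Rightarrow> real"
  assumes V: "Cm_on 2 UNIV V"
  obtains D where "(gradient V has_derivative D) (at y)" "\<And>v w. D v \<bullet> w = hessian_form V y v w"
proof -
  define F where "F d = frechet_derivative (dirderiv V d) (at y)" for d
  have F: "(dirderiv V d has_derivative F d) (at y)" if "d \<in> Basis" for d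
    unfolding F_def using Cm_on_2D(2)[OF V that] frechet_derivative_works by blast
  have Fv: "F d v = (\<Sum>c\<in>Basis. (v \<bullet> c) * dirderiv (dirderiv V d) c y)" if d: "d \<in> Basis" for d v
  proof -
    have "F d v = F d (\<Sum>c\<in>Basis. (v \<bullet> c) *\<^sub>R c)" by (simp add: euclidean_representation)
    also have "\<dots> = (\<Sum>c\<in>Basis. (v \<bullet> c) *\<^sub>R F d c)"
      using has_derivative_linear[OF F[OF d]] by (simp add: linear_sum linear_scale)
    finally show ?thesis by (simp add: F_def dirderiv_def)
  qed
  show ?thesis
  proof
    show "(gradient V has_derivative (\<lambda>v. \<Sum>d\<in>Basis. F d v *\<^sub>R d)) (at y)"
      unfolding gradient_def[abs_def] by (intro has_derivative_sum has_derivative_scaleR_left F)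
    show "(\<Sum>d\<in>Basis. F d v *\<^sub>R d) \<bullet> w = hessian_form V y v w" for v w
      unfolding hessian_form_def inner_sum_left
      by (subst sum.swap) (simp add: Fv sum_distrib_right sum_distrib_left inner_commute[of w] algebra_simps)
  qed
qed

text \<open>Where positivity of the Hessian fails, \<open>V\<close> is bounded below, so a large multiple of \<open>V\<close>
  compensates.\<close>

lemma hessian_form_coercive:
  fixes V :: "'a::euclidean_space \<Rightarrow> real"
  assumes V: "Cm_on 2 UNIV V" and V0: "\<And>y. V y \<ge> 0"
    and posdef: "\<And>y v. V y = 0 \<Longrightarrow> v \<noteq> 0 \<Longrightarrow> hessian_form V y v v > 0"
  shows "\<exists>c>0. \<exists>k\<ge>0. \<forall>y v. norm y \<le> M \<longrightarrow> hessian_form V y v v \<ge> (c - k * V y) * (norm v)\<^sup>2"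
proof -
  define S where "S = cball (0::'a) M \<times> sphere (0::'a) 1"
  have S: "compact S" unfolding S_def by (intro compact_Times compact_cball compact_sphere)
  define H where "H p = hessian_form V (fst p) (snd p) (snd p)" for p
  have H: "continuous_on S H"
    unfolding H_def by (intro continuous_on_hessian_form[OF V] continuous_intros)
  have Vc: "continuous_on S (\<lambda>p. V (fst p))"
    by (intro continuous_on_compose2[OF Cm_on_2D(4)[OF V]] continuous_intros) auto
  \<comment> \<open>One integer provides both constants, c = 1/(n+1) and k = n, so that failure for
    all n produces a single sequence in the compact set \<open>S\<close>. Unit vectors suffice by
    homogeneity.\<close>
  have "\<exists>n. \<forall>p\<in>S. H p \<ge> inverse (real (Suc n)) - real n * V (fst p)"
  proof (rule ccontr)
    assume "\<not> ?thesis"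
    then have "\<forall>n. \<exists>p\<in>S. H p < inverse (real (Suc n)) - real n * V (fst p)" by (auto simp: not_le)
    then obtain p where p: "\<And>n. p n \<in> S" "\<And>n. H (p n) < inverse (real (Suc n)) - real n * V (fst (p n))"
      by metis
    obtain l r where l: "l \<in> S" and r: "strict_mono (r :: nat \<Rightarrow> nat)" and lim: "(p \<circ> r) \<longlonglongrightarrow> l"
      using S p(1) unfolding compact_def by metis
    have prS: "\<forall>\<^sub>F n in sequentially. (p \<circ> r) n \<in> S" using p(1) by simp
    have Hl: "(\<lambda>n. H (p (r n))) \<longlonglongrightarrow> H l"
      using continuous_on_tendsto_compose[OF H lim l prS] by simp
    have Vl: "(\<lambda>n. V (fst (p (r n)))) \<longlonglongrightarrow> V (fst l)"
      using continuous_on_tendsto_compose[OF Vc lim l prS] by simp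
    have inv: "(\<lambda>n. inverse (real (Suc (r n)))) \<longlonglongrightarrow> 0"
      using LIMSEQ_subseq_LIMSEQ[OF LIMSEQ_inverse_real_of_nat r] by (simp add: o_def)
    have "H l \<le> 0"
    proof (rule LIMSEQ_le[OF Hl inv])
      have "H (p (r n)) \<le> inverse (real (Suc (r n)))" for n
      proof -
        have "real (r n) * V (fst (p (r n))) \<ge> 0" using V0 by simp
        then show ?thesis using p(2)[of "r n"] by linarith
      qed
      then show "\<exists>N. \<forall>n\<ge>N. H (p (r n)) \<le> inverse (real (Suc (r n)))" by blast
    qed
    \<comment> \<open>Dividing the failed inequality by its integer bounds V by (1 - H)/r(n), which
      tends to 0. The limit is thus a well, where H \<le> 0 contradicts positive
      definiteness.\<close>
    moreover have "V (fst l) = 0"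
    proof -
      have "V (fst (p (r n))) \<le> (1 - H (p (r n))) * inverse (real (r n))" if n: "n \<ge> 1" for n
      proof -
        have rn: "real (r n) > 0" using seq_suble[OF r, of n] n by simp
        have "inverse (real (Suc (r n))) \<le> 1" by (simp add: field_simps)
        then have "real (r n) * V (fst (p (r n))) \<le> 1 - H (p (r n))" using p(2)[of "r n"] by linarith
        then show ?thesis using rn by (simp add: field_simps)
      qed
      moreover have "(\<lambda>n. (1 - H (p (r n))) * inverse (real (r n))) \<longlonglongrightarrow> (1 - H l) * 0"
        using LIMSEQ_subseq_LIMSEQ[OF tendsto_inverse_0_at_top[OF filterlim_real_sequentially] r]
        by (intro tendsto_mult tendsto_diff tendsto_const Hl) (simp add: o_def)
      ultimately have "V (fst l) \<le> (1 - H l) * 0"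
        by (intro LIMSEQ_le[OF Vl]) auto
      then show ?thesis using V0[of "fst l"] by simp
    qed
    moreover have "snd l \<noteq> 0" using l by (auto simp: S_def)
    ultimately show False using posdef[of "fst l" "snd l"] by (simp add: H_def)
  qed
  then obtain n where n: "\<And>p. p \<in> S \<Longrightarrow> H p \<ge> inverse (real (Suc n)) - real n * V (fst p)" by blast
  show ?thesis
  proof (intro exI conjI allI impI)
    show "inverse (real (Suc n)) > 0" "real n \<ge> 0" by auto
    fix y v :: 'a assume y: "norm y \<le> M"
    show "hessian_form V y v v \<ge> (inverse (real (Suc n)) - real n * V y) * (norm v)\<^sup>2"
    proof (cases "v = 0")
      case True
      then show ?thesis by (simp add: hessian_form_def)
    next
      case False
      define w where "w = (1 / norm v) *\<^sub>R v"
      have w: "norm w = 1" "v = norm v *\<^sub>R w" using False by (simp_all add: w_def)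
      have "(inverse (real (Suc n)) - real n * V y) \<le> hessian_form V y w w"
        using n[of "(y, w)"] y w by (simp add: S_def H_def)
      then have "(inverse (real (Suc n)) - real n * V y) * (norm v)\<^sup>2 \<le> hessian_form V y w w * (norm v)\<^sup>2"
        by (intro mult_right_mono) auto
      also have "\<dots> = hessian_form V y v v"
        by (subst (2) w(2), subst (3) w(2), subst hessian_form_scale) simp
      finally show ?thesis .
    qed
  qed
qed

section \<open>Localised energy identities\<close>

lemma has_vector_derivative_line_at_0:
  assumes "(f has_derivative D) (at x)"
  shows "((\<lambda>s. f (x + s *\<^sub>R b)) has_vector_derivative D b) (at 0)"
proof -
  have "((\<lambda>s. x + s *\<^sub>R b) has_derivative (\<lambda>s. s *\<^sub>R b)) (at 0)"
    by (auto intro!: derivative_eq_intros)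
  from has_derivative_compose[OF this, of f D] assms show ?thesis
    unfolding has_vector_derivative_def
    using linear_scale[OF has_derivative_linear[OF assms]] by simp
qed

lemma has_real_derivative_inner:
  fixes p q :: "real \<Rightarrow> 'a::real_inner"
  assumes "(p has_vector_derivative p') (at s)" "(q has_vector_derivative q') (at s)"
  shows "((\<lambda>s. p s \<bullet> q s) has_real_derivative (p s \<bullet> q' + p' \<bullet> q s)) (at s)"
  using bounded_bilinear.has_vector_derivative[OF bounded_bilinear_inner assms]
  by (simp add: has_real_derivative_iff_has_vector_derivative)

text \<open>\<open>N\<close> is a compact set carrying the cutoff \<eta> and its gradient
  \<open>G\<close>. It keeps all integrands inside \<Omega>, the only place where u is known to be
  regular.\<close>

locale localised_solution =
  fixes V :: "real^'k \<Rightarrow> real" and \<Omega> N :: "(real^2) set" and \<epsilon> :: real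
    and u :: "real^2 \<Rightarrow> real^'k" and \<eta> :: "real^2 \<Rightarrow> real" and G :: "real^2 \<Rightarrow> real^2"
  assumes V: "Cm_on 2 UNIV V" and V_nonneg: "\<And>y. V y \<ge> 0"
    and open_\<Omega>: "open \<Omega>" and eps: "\<epsilon> > 0" and solution: "AC_solution V \<Omega> \<epsilon> u"
    and N: "compact N" "N \<subseteq> \<Omega>"
    and \<eta>: "\<And>x. (\<eta> has_derivative (\<lambda>v. G x \<bullet> v)) (at x)" and contG: "continuous_on UNIV G"
    and \<eta>_nonneg: "\<And>x. \<eta> x \<ge> 0" and \<eta>_0: "\<And>x. x \<notin> N \<Longrightarrow> \<eta> x = 0" and G_0: "\<And>x. x \<notin> N \<Longrightarrow> G x = 0"
begin

lemma u: "Cm_on 2 \<Omega> u"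
  using solution by (simp add: AC_solution_def)

lemma equation: "x \<in> \<Omega> \<Longrightarrow> laplacian u x = (1 / \<epsilon>\<^sup>2) *\<^sub>R gradient V (u x)"
  using solution by (auto simp: AC_solution_def)

lemma cont:
  "continuous_on \<Omega> \<eta>" "continuous_on \<Omega> G" "continuous_on \<Omega> (\<lambda>x. V (u x))"
  "continuous_on \<Omega> (\<lambda>x. gradient V (u x))"
proof -
  show "continuous_on \<Omega> \<eta>"
    by (intro continuous_at_imp_continuous_on ballI has_derivative_continuous[OF \<eta>])
  show "continuous_on \<Omega> G" using contG continuous_on_subset by blast
  show "continuous_on \<Omega> (\<lambda>x. V (u x))"
    by (intro continuous_on_compose2[OF Cm_on_2D(4)[OF V] Cm_on_2D(4)[OF u]]) auto
  have "continuous_on UNIV (gradient V)"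
    unfolding gradient_def[abs_def] by (intro continuous_intros Cm_on_2D(5)[OF V])
  then show "continuous_on \<Omega> (\<lambda>x. gradient V (u x))"
    by (rule continuous_on_compose2[OF _ Cm_on_2D(4)[OF u]]) auto
qed

lemma integrable_local:
  fixes f :: "real^2 \<Rightarrow> real"
  assumes "continuous_on \<Omega> f" "\<And>x. x \<notin> N \<Longrightarrow> f x = 0"
  shows "integrable lborel f"
  using integrable_continuous_compact_support[OF N(1) continuous_on_UNIV_extend_zero[OF open_\<Omega> N assms] assms(2)] .

lemma line_derivatives:
  assumes x: "x \<in> \<Omega>"
  shows "((\<lambda>s. \<eta> (x + s *\<^sub>R b)) has_real_derivative G x \<bullet> b) (at 0)"
    and "((\<lambda>s. (x + s *\<^sub>R b) \<bullet> e) has_real_derivative b \<bullet> e) (at 0)"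
    and "((\<lambda>s. V (u (x + s *\<^sub>R b))) has_real_derivative gradient V (u x) \<bullet> dirderiv u b x) (at 0)"
    and "c \<in> Basis \<Longrightarrow>
      ((\<lambda>s. dirderiv u c (x + s *\<^sub>R b)) has_vector_derivative dirderiv (dirderiv u c) b x) (at 0)"
proof -
  show "((\<lambda>s. \<eta> (x + s *\<^sub>R b)) has_real_derivative G x \<bullet> b) (at 0)"
    using has_vector_derivative_line_at_0[OF \<eta>]
    by (simp add: has_real_derivative_iff_has_vector_derivative)
  show "((\<lambda>s. (x + s *\<^sub>R b) \<bullet> e) has_real_derivative b \<bullet> e) (at 0)"
    by (auto intro!: derivative_eq_intros simp: inner_add_left)
  have "(u has_derivative frechet_derivative u (at x)) (at x)"
    using Cm_on_2D(1)[OF u x] frechet_derivative_works by blast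
  moreover have "(V has_derivative (\<lambda>h. h \<bullet> gradient V (u x))) (at (u x))"
    using GDERIV_gradient[OF Cm_on_2D(1)[OF V]] by (simp add: gderiv_def)
  ultimately have "((\<lambda>x. V (u x)) has_derivative (\<lambda>v. frechet_derivative u (at x) v \<bullet> gradient V (u x))) (at x)"
    by (rule has_derivative_compose)
  from has_vector_derivative_line_at_0[OF this, of b]
  show "((\<lambda>s. V (u (x + s *\<^sub>R b))) has_real_derivative gradient V (u x) \<bullet> dirderiv u b x) (at 0)"
    by (simp add: has_real_derivative_iff_has_vector_derivative dirderiv_def inner_commute)
  show "((\<lambda>s. dirderiv u c (x + s *\<^sub>R b)) has_vector_derivative dirderiv (dirderiv u c) b x) (at 0)"
    if "c \<in> Basis"
    using has_vector_derivative_along_line[of "dirderiv u c" x 0 b] Cm_on_2D(2)[OF u that x] by simp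
qed

text \<open>The stress-energy tensor tested with the vector field \<open>\<eta>(x) (x \<bullet> e1) e1\<close>.\<close>

lemma pohozaev_identity:
  assumes B: "Basis = {e1, e2}" "e1 \<noteq> e2"
  defines "p1 \<equiv> dirderiv u e1" and "p2 \<equiv> dirderiv u e2"
  defines "D \<equiv> \<lambda>x. \<epsilon> / 2 * (p2 x \<bullet> p2 x - p1 x \<bullet> p1 x) + (1 / \<epsilon>) * V (u x)"
  defines "P \<equiv> \<lambda>x. \<eta> x * D x + (G x \<bullet> e1) * (x \<bullet> e1) * D x - \<epsilon> * ((G x \<bullet> e2) * (x \<bullet> e1) * (p1 x \<bullet> p2 x))"
  shows "integrable lborel P" "integral\<^sup>L lborel P = 0"
proof -
  have b: "e1 \<in> Basis" "e2 \<in> Basis" by (simp_all add: B)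
  have ee: "e1 \<bullet> e1 = 1" "e2 \<bullet> e1 = 0" using b B(2) by (simp_all add: inner_Basis)
  define p11 p21 p12 p22 where "p11 = dirderiv p1 e1" and "p21 = dirderiv p2 e1"
    and "p12 = dirderiv p1 e2" and "p22 = dirderiv p2 e2"
  note p_defs = p11_def p21_def p12_def p22_def p1_def p2_def
  have cp: "continuous_on \<Omega> p1" "continuous_on \<Omega> p2" "continuous_on \<Omega> p11" "continuous_on \<Omega> p21"
    "continuous_on \<Omega> p12" "continuous_on \<Omega> p22"
    unfolding p_defs by (intro Cm_on_2D(3,5)[OF u] b)+
  have cD: "continuous_on \<Omega> D" unfolding D_def by (intro continuous_intros cp cont)
  \<comment> \<open>With \<open>f2\<close> below, this is \<eta>(x) (x . e1) times the first row of
    e I - \<epsilon> (grad u)^T grad u, since D = e - \<epsilon> |p1|^2. The functions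
    \<open>g1\<close> and \<open>g2\<close> are the two terms of the divergence of that
    field.\<close>
  define f1 where "f1 x = \<eta> x * (x \<bullet> e1) * D x" for x
  define g1 where "g1 x = ((G x \<bullet> e1) * (x \<bullet> e1) + \<eta> x) * D x
      + \<eta> x * (x \<bullet> e1) * (\<epsilon> * (p2 x \<bullet> p21 x - p1 x \<bullet> p11 x) + (1 / \<epsilon>) * (gradient V (u x) \<bullet> p1 x))" for x
  define f2 where "f2 x = - \<epsilon> * (\<eta> x * (x \<bullet> e1) * (p1 x \<bullet> p2 x))" for x
  define g2 where "g2 x = - \<epsilon> * ((G x \<bullet> e2) * (x \<bullet> e1) * (p1 x \<bullet> p2 x)
      + \<eta> x * (x \<bullet> e1) * (p1 x \<bullet> p22 x + p12 x \<bullet> p2 x))" for x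
  have cont_fg: "continuous_on \<Omega> f1" "continuous_on \<Omega> g1" "continuous_on \<Omega> f2" "continuous_on \<Omega> g2"
    unfolding f1_def g1_def f2_def g2_def by (intro continuous_intros cp cD cont)+
  have zero: "f1 x = 0" "g1 x = 0" "f2 x = 0" "g2 x = 0" if "x \<notin> N" for x
    using \<eta>_0[OF that] G_0[OF that] by (simp_all add: f1_def g1_def f2_def g2_def)
  have d1: "((\<lambda>s. f1 (x + s *\<^sub>R e1)) has_real_derivative g1 x) (at 0)" if x: "x \<in> \<Omega>" for x
  proof -
    note L = line_derivatives[OF x, where b=e1]
    have q1: "((\<lambda>s. p1 (x + s *\<^sub>R e1) \<bullet> p1 (x + s *\<^sub>R e1)) has_real_derivative 2 * (p1 x \<bullet> p11 x)) (at 0)"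
      and q2: "((\<lambda>s. p2 (x + s *\<^sub>R e1) \<bullet> p2 (x + s *\<^sub>R e1)) has_real_derivative 2 * (p2 x \<bullet> p21 x)) (at 0)"
      using has_real_derivative_inner[OF L(4)[OF b(1)] L(4)[OF b(1)]]
        has_real_derivative_inner[OF L(4)[OF b(2)] L(4)[OF b(2)]]
      by (simp_all add: p_defs inner_commute)
    have qD: "((\<lambda>s. D (x + s *\<^sub>R e1)) has_real_derivative
        \<epsilon> * (p2 x \<bullet> p21 x - p1 x \<bullet> p11 x) + (1 / \<epsilon>) * (gradient V (u x) \<bullet> p1 x)) (at 0)"
      unfolding D_def
      by (rule derivative_eq_intros q1 q2 L(3) refl | simp add: p1_def algebra_simps)+
    have "((\<lambda>s. \<eta> (x + s *\<^sub>R e1) * ((x + s *\<^sub>R e1) \<bullet> e1) * D (x + s *\<^sub>R e1)) has_real_derivative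
       ((G x \<bullet> e1) * (x \<bullet> e1) + 1 * \<eta> x) * D x
      + (\<epsilon> * (p2 x \<bullet> p21 x - p1 x \<bullet> p11 x) + (1 / \<epsilon>) * (gradient V (u x) \<bullet> p1 x)) * (\<eta> x * (x \<bullet> e1))) (at 0)"
      using DERIV_mult[OF DERIV_mult[OF L(1) L(2)[of e1]] qD] by (simp add: ee)
    then show ?thesis unfolding f1_def g1_def by (simp add: mult.commute)
  qed
  have d2: "((\<lambda>s. f2 (x + s *\<^sub>R e2)) has_real_derivative g2 x) (at 0)" if x: "x \<in> \<Omega>" for x
  proof -
    note L = line_derivatives[OF x, where b=e2]
    have q: "((\<lambda>s. p1 (x + s *\<^sub>R e2) \<bullet> p2 (x + s *\<^sub>R e2)) has_real_derivative
        (p1 x \<bullet> p22 x + p12 x \<bullet> p2 x)) (at 0)"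
      using has_real_derivative_inner[OF L(4)[OF b(1)] L(4)[OF b(2)]] by (simp add: p_defs)
    have "((\<lambda>s. - \<epsilon> * (\<eta> (x + s *\<^sub>R e2) * ((x + s *\<^sub>R e2) \<bullet> e1) * (p1 (x + s *\<^sub>R e2) \<bullet> p2 (x + s *\<^sub>R e2))))
       has_real_derivative - \<epsilon> * (((G x \<bullet> e2) * (x \<bullet> e1) + 0 * \<eta> x) * (p1 x \<bullet> p2 x)
        + (p1 x \<bullet> p22 x + p12 x \<bullet> p2 x) * (\<eta> x * (x \<bullet> e1)))) (at 0)"
      using DERIV_cmult[OF DERIV_mult[OF DERIV_mult[OF L(1) L(2)[of e1]] q], of "- \<epsilon>"] by (simp add: ee)
    then show ?thesis unfolding f2_def g2_def by (simp add: mult.commute)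
  qed
  have int: "integrable lborel g1" "integrable lborel g2"
    using integrable_local cont_fg zero by auto
  have i1: "integral\<^sup>L lborel g1 = 0"
    by (rule integral_derivative_zero_local[OF open_\<Omega> N zero(1,2) cont_fg(1,2) d1])
  have i2: "integral\<^sup>L lborel g2 = 0"
    by (rule integral_derivative_zero_local[OF open_\<Omega> N zero(3,4) cont_fg(3,4) d2])
  have P: "P = (\<lambda>x. g1 x + g2 x)"
  proof
    fix x
    show "P x = g1 x + g2 x"
    proof (cases "x \<in> \<Omega>")
      case False
      then have "x \<notin> N" using N by auto
      then show ?thesis using \<eta>_0 G_0 by (simp add: P_def g1_def g2_def)
    next
      case True
      \<comment> \<open>Equality of mixed derivatives together with the equation makes the tensor
        row divergence-free, so only derivatives of \<eta>(x) (x . e1) survive in g1 + g2.\<close>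
      have sym: "p12 x = p21 x"
        unfolding p_defs by (rule dirderiv_commute[OF open_\<Omega> True]) (intro Cm_on_2D[OF u] b; assumption)+
      have "p11 x + p22 x = (1 / \<epsilon>\<^sup>2) *\<^sub>R gradient V (u x)"
        using equation[OF True] B(2) by (simp add: laplacian_def p_defs B(1))
      then have "\<epsilon> * (p1 x \<bullet> (p11 x + p22 x)) = (1 / \<epsilon>) * (gradient V (u x) \<bullet> p1 x)"
        using eps by (simp add: power2_eq_square inner_commute)
      then have key: "\<epsilon> * (p1 x \<bullet> p11 x) + \<epsilon> * (p1 x \<bullet> p22 x) = (1 / \<epsilon>) * (gradient V (u x) \<bullet> p1 x)"
        by (simp add: inner_add_right distrib_left)
      have "g1 x + g2 x = P x + \<eta> x * (x \<bullet> e1) * ((1 / \<epsilon>) * (gradient V (u x) \<bullet> p1 x)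
          - (\<epsilon> * (p1 x \<bullet> p11 x) + \<epsilon> * (p1 x \<bullet> p22 x)))"
        unfolding g1_def g2_def P_def sym by (simp add: inner_commute[of "p21 x"] algebra_simps)
      then show ?thesis using key by simp
    qed
  qed
  show "integrable lborel P" "integral\<^sup>L lborel P = 0"
    unfolding P using int i1 i2 by simp_all
qed

text \<open>The equation tested with \<open>\<eta> \<nabla>V(u)\<close>.\<close>

lemma hessian_identity:
  defines "Q \<equiv> \<lambda>x. (\<Sum>b\<in>Basis. \<epsilon> * ((G x \<bullet> b) * (gradient V (u x) \<bullet> dirderiv u b x))
      + \<epsilon> * (\<eta> x * hessian_form V (u x) (dirderiv u b x) (dirderiv u b x)))
      + (1 / \<epsilon>) * (\<eta> x * (gradient V (u x) \<bullet> gradient V (u x)))"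
  shows "integrable lborel Q" "integral\<^sup>L lborel Q = 0"
proof -
  define W where "W x = gradient V (u x)" for x
  define h where "h b x = hessian_form V (u x) (dirderiv u b x) (dirderiv u b x)" for b x
  \<comment> \<open>The components of the field \<epsilon> \<eta> grad V(u) . grad u. Its divergence
    contains \<epsilon> \<eta> grad V(u) . laplacian u, which the equation turns into the
    nonnegative term \<eta> |grad V(u)|^2/\<epsilon>.\<close>
  define f where "f b x = \<epsilon> * (\<eta> x * (W x \<bullet> dirderiv u b x))" for b x
  define g where "g b x = \<epsilon> * ((G x \<bullet> b) * (W x \<bullet> dirderiv u b x)
      + \<eta> x * (W x \<bullet> dirderiv (dirderiv u b) b x + h b x))" for b x
  have cf: "continuous_on \<Omega> (f b)" and cg: "continuous_on \<Omega> (g b)" if "b \<in> Basis" for b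
    unfolding f_def[abs_def] g_def[abs_def] W_def h_def
    by (intro continuous_intros cont Cm_on_2D(3,4,5)[OF u] continuous_on_hessian_form[OF V] that)+
  have zero: "f b x = 0" "g b x = 0" if "x \<notin> N" for b x
    using \<eta>_0[OF that] G_0[OF that] by (simp_all add: f_def g_def)
  have d: "((\<lambda>s. f b (x + s *\<^sub>R b)) has_real_derivative g b x) (at 0)" if x: "x \<in> \<Omega>" and b: "b \<in> Basis" for x b
  proof -
    note L = line_derivatives[OF x, where b=b]
    obtain DV where DV: "(gradient V has_derivative DV) (at (u x))"
      "\<And>v w. DV v \<bullet> w = hessian_form V (u x) v w"
      using gradient_has_derivative[OF V] by blast
    have "(u has_derivative frechet_derivative u (at x)) (at x)"
      using Cm_on_2D(1)[OF u x] frechet_derivative_works by blast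
    from has_vector_derivative_line_at_0[OF has_derivative_compose[OF this DV(1)], of b]
    have "((\<lambda>s. W (x + s *\<^sub>R b)) has_vector_derivative DV (dirderiv u b x)) (at 0)"
      by (simp add: W_def dirderiv_def)
    from has_real_derivative_inner[OF this L(4)[OF b]]
    have q: "((\<lambda>s. W (x + s *\<^sub>R b) \<bullet> dirderiv u b (x + s *\<^sub>R b)) has_real_derivative
        (W x \<bullet> dirderiv (dirderiv u b) b x + h b x)) (at 0)"
      by (simp add: DV(2) h_def)
    show ?thesis
      unfolding f_def g_def using DERIV_cmult[OF DERIV_mult[OF L(1) q], of \<epsilon>] by (simp add: mult.commute)
  qed
  have int: "integrable lborel (g b)" if "b \<in> Basis" for b
    using integrable_local cg[OF that] zero by auto
  have i: "integral\<^sup>L lborel (g b) = 0" if b: "b \<in> Basis" for b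
    by (rule integral_derivative_zero_local[OF open_\<Omega> N zero cf[OF b] cg[OF b] d[OF _ b]])
  have Q: "Q = (\<lambda>x. \<Sum>b\<in>Basis. g b x)"
  proof
    fix x
    show "Q x = (\<Sum>b\<in>Basis. g b x)"
    proof (cases "x \<in> \<Omega>")
      case False
      then have "x \<notin> N" using N by auto
      then show ?thesis using \<eta>_0 G_0 by (simp add: Q_def g_def)
    next
      case True
      have "\<epsilon> * (\<eta> x * (W x \<bullet> laplacian u x)) = (1 / \<epsilon>) * (\<eta> x * (W x \<bullet> W x))"
        using equation[OF True] eps by (simp add: W_def power2_eq_square)
      moreover have "(\<Sum>b\<in>Basis. g b x) = (\<Sum>b\<in>Basis. \<epsilon> * ((G x \<bullet> b) * (W x \<bullet> dirderiv u b x))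
          + \<epsilon> * (\<eta> x * h b x)) + \<epsilon> * (\<eta> x * (W x \<bullet> laplacian u x))"
        by (simp add: g_def laplacian_def inner_sum_right sum_distrib_left sum.distrib algebra_simps)
      ultimately show ?thesis by (simp add: Q_def W_def h_def)
    qed
  qed
  show "integrable lborel Q" "integral\<^sup>L lborel Q = 0"
    unfolding Q using int i by simp_all
qed

text \<open>Before integration, \<eta> E is dominated pointwise by a combination of the integrands
  of the identities, which integrate to 0, plus terms supported on \<open>C\<close>. In
  \<open>hess\<close> the gradient bound of order 1/\<epsilon> has already been spent, whence the
  factor V/\<epsilon>^2.\<close>

lemma localised_energy_estimate:
  fixes C :: "(real^2) set" and c k L \<beta> \<rho> :: real
  assumes C: "compact C" "C \<subseteq> N" and G_C: "\<And>x. x \<notin> C \<Longrightarrow> G x = 0"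
    and c: "c > 0" and k: "k \<ge> 0"
    and hess: "\<And>x b. x \<in> N \<Longrightarrow> b \<in> Basis \<Longrightarrow>
      hessian_form V (u x) (dirderiv u b x) (dirderiv u b x) \<ge> c * (norm (dirderiv u b x))\<^sup>2 - k * V (u x) / \<epsilon>\<^sup>2"
    and L: "\<And>x. x \<in> N \<Longrightarrow> norm (gradient V (u x)) \<le> L"
    and \<beta>: "\<And>x. norm (G x) \<le> \<beta>" and \<rho>: "\<And>x. x \<in> N \<Longrightarrow> norm x \<le> \<rho>"
  defines "E \<equiv> energy_density V \<epsilon> u"
  shows "integral\<^sup>L lborel (\<lambda>x. \<eta> x * E x) \<le>
    \<beta> * L / (2 * c) * (\<epsilon> * measure lborel C + integral\<^sup>L lborel (\<lambda>x. indicator C x * E x))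
    + (k / c + 1) * (2 * (\<rho> * \<beta>)) * integral\<^sup>L lborel (\<lambda>x. indicator C x * E x)"
proof -
  define e1 e2 :: "real^2" where "e1 = axis 1 1" and "e2 = axis 2 1"
  have B: "Basis = {e1, e2}" "e1 \<noteq> e2" "Basis = {e2, e1}" "e2 \<noteq> e1"
    using Basis_real_2 by (auto simp: e1_def e2_def)
  define p1 p2 where "p1 = dirderiv u e1" and "p2 = dirderiv u e2"
  define Vu where "Vu x = (1 / \<epsilon>) * V (u x)" for x
  define D where "D x = \<epsilon> / 2 * (p2 x \<bullet> p2 x - p1 x \<bullet> p1 x)" for x
  define P1 where "P1 x = \<eta> x * (D x + Vu x) + (G x \<bullet> e1) * (x \<bullet> e1) * (D x + Vu x)
      - \<epsilon> * ((G x \<bullet> e2) * (x \<bullet> e1) * (p1 x \<bullet> p2 x))" for x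
  \<comment> \<open>Exchanging the basis vectors changes the sign of \<open>D\<close>, so the
    gradient part cancels in P1 + P2 apart from the terms with \<open>G\<close>. This is where
    dimension two enters.\<close>
  define P2 where "P2 x = \<eta> x * (Vu x - D x) + (G x \<bullet> e2) * (x \<bullet> e2) * (Vu x - D x)
      - \<epsilon> * ((G x \<bullet> e1) * (x \<bullet> e2) * (p1 x \<bullet> p2 x))" for x
  define Q where "Q x = (\<Sum>b\<in>Basis. \<epsilon> * ((G x \<bullet> b) * (gradient V (u x) \<bullet> dirderiv u b x))
      + \<epsilon> * (\<eta> x * hessian_form V (u x) (dirderiv u b x) (dirderiv u b x)))
      + (1 / \<epsilon>) * (\<eta> x * (gradient V (u x) \<bullet> gradient V (u x)))" for x
  have P1: "integrable lborel P1" "integral\<^sup>L lborel P1 = 0"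
    using pohozaev_identity[OF B(1,2)] by (simp_all add: P1_def[abs_def] D_def Vu_def p1_def p2_def)
  have P2_eq: "P2 = (\<lambda>x. \<eta> x * (\<epsilon> / 2 * (p1 x \<bullet> p1 x - p2 x \<bullet> p2 x) + (1 / \<epsilon>) * V (u x))
      + (G x \<bullet> e2) * (x \<bullet> e2) * (\<epsilon> / 2 * (p1 x \<bullet> p1 x - p2 x \<bullet> p2 x) + (1 / \<epsilon>) * V (u x))
      - \<epsilon> * ((G x \<bullet> e1) * (x \<bullet> e2) * (p2 x \<bullet> p1 x)))"
    by (simp add: fun_eq_iff P2_def D_def Vu_def inner_commute algebra_simps)
  have P2: "integrable lborel P2" "integral\<^sup>L lborel P2 = 0"
    unfolding P2_eq using pohozaev_identity[OF B(3,4)] by (simp_all add: p1_def p2_def)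
  have Q: "integrable lborel Q" "integral\<^sup>L lborel Q = 0"
    using hessian_identity by (simp_all add: Q_def[abs_def])
  have E: "E x = \<epsilon> / 2 * (p1 x \<bullet> p1 x + p2 x \<bullet> p2 x) + Vu x" for x
    using B(2) by (simp add: E_def energy_density_def grad_norm_sq_def B(1) p1_def p2_def Vu_def power2_norm_eq_inner)
  have Vu0: "Vu x \<ge> 0" for x using V_nonneg eps by (simp add: Vu_def)
  have E0: "E x \<ge> 0" for x using Vu0[of x] eps by (simp add: E)
  have cE: "continuous_on \<Omega> E"
    unfolding E_def by (rule continuous_on_energy_density[OF u Cm_on_2D(4)[OF V]])
  have \<beta>0: "\<beta> \<ge> 0" using \<beta>[of 0] norm_ge_zero order_trans by blast
  have int_C: "integrable lborel (\<lambda>x. indicator C x * E x)"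
    using borel_integrable_compact[OF C(1), of E] cE C(2) N(2) continuous_on_subset[of \<Omega> E C] by auto
  have fin_C: "emeasure lborel C < \<infinity>"
    by (rule emeasure_compact_finite[OF C(1)])
  have int_1: "integrable lborel (indicator C :: _ \<Rightarrow> real)"
    using C(1) fin_C by (intro integrable_real_indicator) (auto simp: compact_imp_closed)
  have int_\<eta>: "integrable lborel (\<lambda>x. \<eta> x * E x)"
    by (rule integrable_local) (auto intro!: continuous_intros cont cE simp: \<eta>_0)
  \<comment> \<open>Four terms contain \<open>G\<close>, and each is at most \<rho> \<beta> E on
    \<open>C\<close>: \<beta> bounds the cutoff gradient, \<rho> the position vector, and the energy
    density each tensor entry.\<close>
  have A: "2 * (\<eta> x * Vu x) \<le> P1 x + P2 x + 4 * (\<rho> * \<beta>) * (indicator C x * E x)" for x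
  proof (cases "x \<in> C")
    case False
    then show ?thesis using G_C[of x] by (simp add: P1_def P2_def algebra_simps)
  next
    case True
    then have x: "x \<in> N" using C by auto
    have bound: "\<bar>(G x \<bullet> e) * (x \<bullet> e') * y\<bar> \<le> \<rho> * \<beta> * E x"
      if "e \<in> Basis" "e' \<in> Basis" "\<bar>y\<bar> \<le> E x" for e e' y
    proof -
      have "\<bar>G x \<bullet> e\<bar> \<le> \<beta>" "\<bar>x \<bullet> e'\<bar> \<le> \<rho>"
        using Basis_le_norm[OF that(1), of "G x"] Basis_le_norm[OF that(2), of x] \<beta>[of x] \<rho>[OF x] by auto
      then have "\<bar>G x \<bullet> e\<bar> * \<bar>x \<bullet> e'\<bar> * \<bar>y\<bar> \<le> \<beta> * \<rho> * E x"
        using that(3) \<beta>0 by (intro mult_mono) auto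
      then show ?thesis by (simp add: abs_mult mult.commute mult.left_commute)
    qed
    have sq: "p1 x \<bullet> p1 x \<ge> 0" "p2 x \<bullet> p2 x \<ge> 0" by simp_all
    have D1: "\<bar>D x + Vu x\<bar> \<le> E x" "\<bar>Vu x - D x\<bar> \<le> E x"
    proof -
      have "D x = \<epsilon> / 2 * (p2 x \<bullet> p2 x) - \<epsilon> / 2 * (p1 x \<bullet> p1 x)"
        "E x = \<epsilon> / 2 * (p1 x \<bullet> p1 x) + \<epsilon> / 2 * (p2 x \<bullet> p2 x) + Vu x"
        by (simp_all add: D_def E algebra_simps)
      moreover have "\<epsilon> / 2 * (p1 x \<bullet> p1 x) \<ge> 0" "\<epsilon> / 2 * (p2 x \<bullet> p2 x) \<ge> 0" using sq eps by auto
      ultimately show "\<bar>D x + Vu x\<bar> \<le> E x" "\<bar>Vu x - D x\<bar> \<le> E x"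
        using Vu0[of x] by (simp_all add: abs_le_iff)
    qed
    have D2: "\<bar>\<epsilon> * (p1 x \<bullet> p2 x)\<bar> \<le> E x"
    proof -
      have "\<bar>p1 x \<bullet> p2 x\<bar> \<le> norm (p1 x) * norm (p2 x)" by (rule Cauchy_Schwarz_ineq2)
      also have "\<dots> \<le> (p1 x \<bullet> p1 x + p2 x \<bullet> p2 x) / 2"
        using sum_squares_bound[of "norm (p1 x)" "norm (p2 x)"] by (simp add: power2_norm_eq_inner)
      finally have "\<epsilon> * \<bar>p1 x \<bullet> p2 x\<bar> \<le> \<epsilon> * ((p1 x \<bullet> p1 x + p2 x \<bullet> p2 x) / 2)"
        using eps by (intro mult_left_mono) auto
      also have "\<dots> = E x - Vu x" by (simp add: E)
      finally show ?thesis using Vu0[of x] eps by (simp add: abs_mult)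
    qed
    have b: "e1 \<in> Basis" "e2 \<in> Basis" by (simp_all add: B(1))
    have t1: "\<bar>(G x \<bullet> e1) * (x \<bullet> e1) * (D x + Vu x)\<bar> \<le> \<rho> * \<beta> * E x"
      and t2: "\<bar>(G x \<bullet> e2) * (x \<bullet> e1) * (\<epsilon> * (p1 x \<bullet> p2 x))\<bar> \<le> \<rho> * \<beta> * E x"
      and t3: "\<bar>(G x \<bullet> e2) * (x \<bullet> e2) * (Vu x - D x)\<bar> \<le> \<rho> * \<beta> * E x"
      and t4: "\<bar>(G x \<bullet> e1) * (x \<bullet> e2) * (\<epsilon> * (p1 x \<bullet> p2 x))\<bar> \<le> \<rho> * \<beta> * E x"
      by (intro bound b D1 D2)+
    have "P1 x + P2 x = 2 * (\<eta> x * Vu x) + (G x \<bullet> e1) * (x \<bullet> e1) * (D x + Vu x)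
        - (G x \<bullet> e2) * (x \<bullet> e1) * (\<epsilon> * (p1 x \<bullet> p2 x)) + (G x \<bullet> e2) * (x \<bullet> e2) * (Vu x - D x)
        - (G x \<bullet> e1) * (x \<bullet> e2) * (\<epsilon> * (p1 x \<bullet> p2 x))"
      by (simp add: P1_def P2_def algebra_simps)
    moreover have "4 * (\<rho> * \<beta>) * (indicator C x * E x) = 4 * (\<rho> * \<beta> * E x)" using True by simp
    ultimately show ?thesis using t1 t2 t3 t4 unfolding abs_le_iff by (smt (verit))
  qed
  \<comment> \<open>The lower Hessian bound is used once per basis vector, giving 2k. The term with
    |grad V(u)|^2 is nonnegative and is dropped.\<close>
  have Bq: "c * (\<epsilon> * (\<eta> x * (p1 x \<bullet> p1 x + p2 x \<bullet> p2 x))) \<le>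
      Q x + \<beta> * L * (indicator C x * (\<epsilon> + E x)) + 2 * k * (\<eta> x * Vu x)" for x
  proof (cases "x \<in> N")
    case False
    then have "x \<notin> C" using C by auto
    then show ?thesis using \<eta>_0[OF False] G_0[OF False] by (simp add: Q_def)
  next
    case x: True
    have b: "e1 \<in> Basis" "e2 \<in> Basis" by (simp_all add: B(1))
    have L0: "L \<ge> 0" using L[OF x] norm_ge_zero order_trans by blast
    have h: "\<epsilon> * (\<eta> x * hessian_form V (u x) (dirderiv u e x) (dirderiv u e x)) \<ge>
        c * (\<epsilon> * (\<eta> x * (dirderiv u e x \<bullet> dirderiv u e x))) - k * (\<eta> x * Vu x)" if e: "e \<in> Basis" for e
    proof -
      have "\<epsilon> * \<eta> x * (c * (dirderiv u e x \<bullet> dirderiv u e x) - k * V (u x) / \<epsilon>\<^sup>2)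
          \<le> \<epsilon> * \<eta> x * hessian_form V (u x) (dirderiv u e x) (dirderiv u e x)"
        using hess[OF x e] eps \<eta>_nonneg[of x] by (intro mult_left_mono) (auto simp: power2_norm_eq_inner)
      moreover have "\<epsilon> * \<eta> x * (c * (dirderiv u e x \<bullet> dirderiv u e x) - k * V (u x) / \<epsilon>\<^sup>2)
          = c * (\<epsilon> * (\<eta> x * (dirderiv u e x \<bullet> dirderiv u e x))) - k * (\<eta> x * Vu x)"
        using eps by (simp add: Vu_def field_simps power2_eq_square)
      ultimately show ?thesis by (simp add: mult.assoc)
    qed
    \<comment> \<open>By Young, |p| \<le> (1 + |p|^2)/2. The constant 1 produces the contribution
      \<epsilon> times the area of \<open>C\<close>, which disappears in the limit.\<close>
    have g: "- (\<epsilon> * ((G x \<bullet> e) * (gradient V (u x) \<bullet> dirderiv u e x))) \<le>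
        \<beta> * L * (indicator C x * (\<epsilon> * (1 + dirderiv u e x \<bullet> dirderiv u e x) / 2))" if e: "e \<in> Basis" for e
    proof (cases "x \<in> C")
      case False
      then show ?thesis using G_C by simp
    next
      case True
      have "\<bar>gradient V (u x) \<bullet> dirderiv u e x\<bar> \<le> L * norm (dirderiv u e x)"
        using Cauchy_Schwarz_ineq2[of "gradient V (u x)" "dirderiv u e x"] L[OF x]
        by (meson mult_right_mono norm_ge_zero order_trans)
      also have "\<dots> \<le> L * ((1 + dirderiv u e x \<bullet> dirderiv u e x) / 2)"
        using sum_squares_bound[of 1 "norm (dirderiv u e x)"] L0
        by (intro mult_left_mono) (auto simp: power2_norm_eq_inner)
      finally have "\<bar>G x \<bullet> e\<bar> * \<bar>gradient V (u x) \<bullet> dirderiv u e x\<bar> \<le>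
          \<beta> * (L * ((1 + dirderiv u e x \<bullet> dirderiv u e x) / 2))"
        using Basis_le_norm[OF e, of "G x"] \<beta>[of x] \<beta>0 by (intro mult_mono) auto
      then have "- ((G x \<bullet> e) * (gradient V (u x) \<bullet> dirderiv u e x)) \<le>
          \<beta> * (L * ((1 + dirderiv u e x \<bullet> dirderiv u e x) / 2))"
        by (simp add: abs_mult[symmetric] abs_le_iff)
      then have "\<epsilon> * - ((G x \<bullet> e) * (gradient V (u x) \<bullet> dirderiv u e x)) \<le>
          \<epsilon> * (\<beta> * (L * ((1 + dirderiv u e x \<bullet> dirderiv u e x) / 2)))"
        using eps by (intro mult_left_mono) auto
      then show ?thesis using True by (simp add: algebra_simps)
    qed
    have sumB: "(\<Sum>b\<in>Basis. F b) = F e1 + F e2" for F :: "real^2 \<Rightarrow> real"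
      using B(2) by (simp add: B(1))
    have "(1 / \<epsilon>) * (\<eta> x * (gradient V (u x) \<bullet> gradient V (u x))) \<ge> 0"
      using eps \<eta>_nonneg by simp
    moreover have "\<beta> * L * (indicator C x * (\<epsilon> * (1 + p1 x \<bullet> p1 x) / 2))
        + \<beta> * L * (indicator C x * (\<epsilon> * (1 + p2 x \<bullet> p2 x) / 2)) \<le> \<beta> * L * (indicator C x * (\<epsilon> + E x))"
    proof -
      have "\<epsilon> * (1 + p1 x \<bullet> p1 x) / 2 + \<epsilon> * (1 + p2 x \<bullet> p2 x) / 2 \<le> \<epsilon> + E x"
        using Vu0[of x] by (simp add: E algebra_simps add_divide_distrib)
      then have "\<beta> * L * indicator C x * (\<epsilon> * (1 + p1 x \<bullet> p1 x) / 2 + \<epsilon> * (1 + p2 x \<bullet> p2 x) / 2)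
          \<le> \<beta> * L * indicator C x * (\<epsilon> + E x)"
        using \<beta>0 L0 by (intro mult_left_mono) auto
      then show ?thesis by (simp add: algebra_simps)
    qed
    moreover have "c * (\<epsilon> * (\<eta> x * (p1 x \<bullet> p1 x + p2 x \<bullet> p2 x))) =
        c * (\<epsilon> * (\<eta> x * (p1 x \<bullet> p1 x))) + c * (\<epsilon> * (\<eta> x * (p2 x \<bullet> p2 x)))"
      by (simp add: algebra_simps)
    ultimately show ?thesis
      using h[OF b(1)] h[OF b(2)] g[OF b(1)] g[OF b(2)]
      unfolding Q_def sumB p1_def p2_def by linarith
  qed
  \<comment> \<open>The factor 1/(2c) normalises the gradient part to that of the energy. The
    remaining potential has coefficient k/c + 1, which \<open>A\<close> absorbs with half that
    weight since its left side carries a 2.\<close>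
  define RHS where "RHS x = (1 / (2 * c)) * Q x + \<beta> * L / (2 * c) * (\<epsilon> * indicator C x + indicator C x * E x)
      + ((k / c + 1) / 2) * (P1 x + P2 x + 4 * (\<rho> * \<beta>) * (indicator C x * E x))" for x
  have "\<eta> x * E x \<le> RHS x" for x
  proof -
    have "\<eta> x * E x = (1 / (2 * c)) * (c * (\<epsilon> * (\<eta> x * (p1 x \<bullet> p1 x + p2 x \<bullet> p2 x)))) + \<eta> x * Vu x"
      using c by (simp add: E field_simps)
    also have "\<dots> \<le> (1 / (2 * c)) * (Q x + \<beta> * L * (indicator C x * (\<epsilon> + E x)) + 2 * k * (\<eta> x * Vu x)) + \<eta> x * Vu x"
      using Bq[of x] c by (intro add_right_mono mult_left_mono) auto
    also have "\<dots> = (1 / (2 * c)) * Q x + \<beta> * L / (2 * c) * (\<epsilon> * indicator C x + indicator C x * E x)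
        + ((k / c + 1) / 2) * (2 * (\<eta> x * Vu x))"
      using c by (simp add: field_simps)
    also have "\<dots> \<le> RHS x"
      unfolding RHS_def using A[of x] c k by (intro add_left_mono mult_left_mono) auto
    finally show ?thesis .
  qed
  moreover have "integrable lborel RHS"
    unfolding RHS_def[abs_def]
    by (intro Bochner_Integration.integrable_add integrable_mult_right Q(1) int_1 int_C P1(1) P2(1))
  ultimately have "integral\<^sup>L lborel (\<lambda>x. \<eta> x * E x) \<le> integral\<^sup>L lborel RHS"
    by (intro integral_mono int_\<eta>)
  also have "\<dots> = \<beta> * L / (2 * c) * (\<epsilon> * measure lborel C + integral\<^sup>L lborel (\<lambda>x. indicator C x * E x))
    + (k / c + 1) * (2 * (\<rho> * \<beta>)) * integral\<^sup>L lborel (\<lambda>x. indicator C x * E x)"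
  proof -
    have "integral\<^sup>L lborel (\<lambda>x. a * Q x + b * (\<epsilon> * indicator C x + J x) + d * (P1 x + P2 x + e * J x))
        = b * (\<epsilon> * measure lborel C + integral\<^sup>L lborel J) + d * (e * integral\<^sup>L lborel J)"
      if "integrable lborel J" for a b d e and J :: "real^2 \<Rightarrow> real"
      using Q P1 P2 int_1 that by simp
    note eq = this[OF int_C, of "1 / (2 * c)" "\<beta> * L / (2 * c)" "(k / c + 1) / 2" "4 * (\<rho> * \<beta>)"]
    show ?thesis
      unfolding RHS_def[abs_def] eq by (simp add: algebra_simps)
  qed
  finally show ?thesis .
qed

end

section \<open>Convergence of the energy measures\<close>

lemma emeasure_energy_measure:
  fixes V :: "real^'k \<Rightarrow> real"
  assumes \<Omega>: "open \<Omega>" and e: "continuous_on \<Omega> (energy_density V \<epsilon> u)"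
  shows "emeasure (energy_measure V \<Omega> \<epsilon> u) \<Omega> =
    (\<integral>\<^sup>+x. ennreal (energy_density V \<epsilon> u x) * indicator \<Omega> x \<partial>lborel)"
proof -
  have m: "energy_density V \<epsilon> u \<in> borel_measurable (restrict_space lborel \<Omega>)"
    using borel_measurable_continuous_on_restrict[OF e]
    by (simp add: measurable_def space_restrict_space sets_restrict_space)
  have s: "\<Omega> \<in> sets (restrict_space lborel \<Omega>)"
    using \<Omega> by (auto simp: sets_restrict_space)
  have "emeasure (energy_measure V \<Omega> \<epsilon> u) \<Omega> =
      (\<integral>\<^sup>+x. ennreal (energy_density V \<epsilon> u x) * indicator \<Omega> x \<partial>restrict_space lborel \<Omega>)"
    unfolding energy_measure_def using m s by (intro emeasure_density) auto
  also have "\<dots> = (\<integral>\<^sup>+x. ennreal (energy_density V \<epsilon> u x) * indicator \<Omega> x * indicator \<Omega> x \<partial>lborel)"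
    using \<Omega> by (intro nn_integral_restrict_space) auto
  also have "\<dots> = (\<integral>\<^sup>+x. ennreal (energy_density V \<epsilon> u x) * indicator \<Omega> x \<partial>lborel)"
    by (intro nn_integral_cong) (auto simp: indicator_def)
  finally show ?thesis .
qed

lemma integral_energy_measure:
  fixes V :: "real^'k \<Rightarrow> real" and \<phi> :: "real^2 \<Rightarrow> real"
  assumes \<Omega>: "open \<Omega>" and e: "continuous_on \<Omega> (energy_density V \<epsilon> u)"
    and e0: "\<And>x. energy_density V \<epsilon> u x \<ge> 0"
    and \<phi>: "continuous_on UNIV \<phi>" "\<And>x. x \<notin> \<Omega> \<Longrightarrow> \<phi> x = 0"
  shows "(LINT x|energy_measure V \<Omega> \<epsilon> u. \<phi> x) = integral\<^sup>L lborel (\<lambda>x. \<phi> x * energy_density V \<epsilon> u x)"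
proof -
  have m: "energy_density V \<epsilon> u \<in> borel_measurable (restrict_space lborel \<Omega>)"
    using borel_measurable_continuous_on_restrict[OF e]
    by (simp add: measurable_def space_restrict_space sets_restrict_space)
  have m\<phi>: "\<phi> \<in> borel_measurable (restrict_space lborel \<Omega>)"
    using \<phi>(1) by (intro measurable_restrict_space1) (simp add: borel_measurable_continuous_onI)
  have "(LINT x|energy_measure V \<Omega> \<epsilon> u. \<phi> x) =
      (LINT x|restrict_space lborel \<Omega>. energy_density V \<epsilon> u x *\<^sub>R \<phi> x)"
    unfolding energy_measure_def using e0 by (intro integral_density m m\<phi>) auto
  also have "\<dots> = (LINT x|lborel. indicator \<Omega> x *\<^sub>R (energy_density V \<epsilon> u x *\<^sub>R \<phi> x))"
    using \<Omega> by (intro integral_restrict_space) auto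
  also have "\<dots> = integral\<^sup>L lborel (\<lambda>x. \<phi> x * energy_density V \<epsilon> u x)"
    using \<phi>(2) by (intro Bochner_Integration.integral_cong) (auto simp: indicator_def)
  finally show ?thesis .
qed

lemma radon_integrable_compact_support:
  fixes \<phi> :: "'a::euclidean_space \<Rightarrow> real"
  assumes \<nu>: "radon_measure_on \<Omega> \<nu>" and \<Omega>: "open \<Omega>" and K: "compact K" "K \<subseteq> \<Omega>"
    and \<phi>: "continuous_on UNIV \<phi>" "\<And>x. x \<notin> K \<Longrightarrow> \<phi> x = 0"
  shows "integrable \<nu> \<phi>" and "integrable \<nu> (indicator K :: 'a \<Rightarrow> real)"
proof -
  have K_set: "K \<in> sets \<nu>"
    using \<nu> K \<Omega> by (auto simp: radon_measure_on_def sets_restrict_space compact_imp_closed intro!: image_eqI[of _ _ K])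
  have K_fin: "emeasure \<nu> K < \<infinity>" using \<nu> K by (simp add: radon_measure_on_def)
  show K_int: "integrable \<nu> (indicator K :: 'a \<Rightarrow> real)"
    using K_set K_fin by (rule integrable_real_indicator)
  have m: "\<phi> \<in> borel_measurable \<nu>"
  proof -
    have "\<phi> \<in> borel_measurable (restrict_space borel \<Omega>)"
      using \<phi>(1) by (intro measurable_restrict_space1) (simp add: borel_measurable_continuous_onI)
    then show ?thesis
      using \<nu> by (subst measurable_cong_sets[of \<nu> "restrict_space borel \<Omega>" borel borel]) (auto simp: radon_measure_on_def)
  qed
  have "bounded (\<phi> ` K)"
    using K(1) \<phi>(1) by (meson compact_continuous_image compact_imp_bounded continuous_on_subset subset_UNIV)
  then obtain B where "\<And>x. x \<in> K \<Longrightarrow> \<bar>\<phi> x\<bar> \<le> B"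
    unfolding bounded_iff by (metis image_eqI real_norm_def)
  then show "integrable \<nu> \<phi>"
    using \<phi>(2) by (intro Bochner_Integration.integrable_bound[OF integrable_mult_right[OF K_int, of B] m])
      (auto intro!: AE_I2 simp: indicator_def; force)
qed

text \<open>Upper semicontinuity on compact sets, via tent functions shrinking to the indicator of \<open>C\<close>.\<close>

lemma exists_test_function_small_integral:
  fixes C :: "'a::euclidean_space set"
  assumes \<nu>: "radon_measure_on \<Omega> \<nu>" and \<Omega>: "open \<Omega>" and C: "compact C" "C \<subseteq> \<Omega>"
    and null: "emeasure \<nu> C = 0" and \<gamma>: "\<gamma> > 0"
  shows "\<exists>\<phi> :: 'a \<Rightarrow> real. continuous_on UNIV \<phi> \<and> compact (closure {x. \<phi> x \<noteq> 0}) \<and>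
    closure {x. \<phi> x \<noteq> 0} \<subseteq> \<Omega> \<and> (\<forall>x. 0 \<le> \<phi> x) \<and> (\<forall>x\<in>C. \<phi> x = 1) \<and> (LINT x|\<nu>. \<phi> x) < \<gamma>"
proof (cases "C = {}")
  case True
  then show ?thesis using \<gamma> by (intro exI[of _ "\<lambda>_. 0"]) auto
next
  case False
  obtain r where r: "r > 0" "(\<Union>x\<in>C. cball x r) \<subseteq> \<Omega>"
    using compact_subset_open_imp_cball_epsilon_subset[OF C(1) \<Omega> C(2)] by blast
  define K where "K = {x. infdist x C \<le> r}"
  have K: "compact K" unfolding K_def by (rule compact_infdist_le[OF False C(1) r(1)])
  have "K \<subseteq> \<Omega>"
  proof
    fix x assume "x \<in> K"
    moreover obtain y where "y \<in> C" "infdist x C = dist x y"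
      using infdist_attains_inf[OF compact_imp_closed[OF C(1)] False] by blast
    ultimately have "x \<in> cball y r" by (simp add: K_def dist_commute)
    then show "x \<in> \<Omega>" using r \<open>y \<in> C\<close> by blast
  qed
  \<comment> \<open>\<open>Suc n\<close> is at least 1, so all tents vanish outside the same compact
    set \<open>K\<close>, whose indicator is an integrable majorant for a Radon measure.\<close>
  define \<phi> where "\<phi> n x = max 0 (1 - real (Suc n) * (infdist x C / r))" for n x
  have cont: "continuous_on UNIV (\<phi> n)" for n
    unfolding \<phi>_def using r by (intro continuous_intros) auto
  have zero: "\<phi> n x = 0" if "x \<notin> K" for n x
  proof -
    have "1 \<le> infdist x C / r" using that r by (simp add: K_def)
    then have "1 * 1 \<le> real (Suc n) * (infdist x C / r)" by (intro mult_mono) auto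
    then have "1 - real (Suc n) * (infdist x C / r) \<le> 0" by linarith
    then show ?thesis unfolding \<phi>_def by (rule max_absorb1)
  qed
  then have sub: "{x. \<phi> n x \<noteq> 0} \<subseteq> K" for n by blast
  have C1: "\<phi> n x = 1" if "x \<in> C" for n x using that by (simp add: \<phi>_def)
  note int = radon_integrable_compact_support[OF \<nu> \<Omega> K \<open>K \<subseteq> \<Omega>\<close>]
  have C_set: "C \<in> sets \<nu>"
    using \<nu> C \<Omega> by (auto simp: radon_measure_on_def sets_restrict_space compact_imp_closed intro!: image_eqI[of _ _ C])
  have "(\<lambda>n. LINT x|\<nu>. \<phi> n x) \<longlonglongrightarrow> (LINT x|\<nu>. indicator C x)"
  proof (rule integral_dominated_convergence[where w="indicator K"])
    show "integrable \<nu> (indicator K :: 'a \<Rightarrow> real)" by (rule int(2)[OF cont zero])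
    show "(indicator C :: 'a \<Rightarrow> real) \<in> borel_measurable \<nu>" using C_set by simp
    show "\<phi> n \<in> borel_measurable \<nu>" for n using int(1)[OF cont zero] by blast
    show "AE x in \<nu>. (\<lambda>n. \<phi> n x) \<longlonglongrightarrow> indicator C x"
    proof (rule AE_I2)
      fix x
      show "(\<lambda>n. \<phi> n x) \<longlonglongrightarrow> indicator C x"
      proof (cases "x \<in> C")
        case True
        then show ?thesis using C1 by simp
      next
        case False
        then have pos: "infdist x C / r > 0"
          using C(1) \<open>C \<noteq> {}\<close> r by (metis compact_imp_closed divide_pos_pos in_closed_iff_infdist_zero infdist_nonneg less_le)
        obtain n0 where n0: "1 < real n0 * (infdist x C / r)"
          using reals_Archimedean3[OF pos] by blast
        have "\<phi> n x = 0" if "n \<ge> n0" for n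
        proof -
          have "real n0 * (infdist x C / r) \<le> real (Suc n) * (infdist x C / r)"
            using that pos by (intro mult_right_mono) auto
          then show ?thesis using n0 by (simp add: \<phi>_def)
        qed
        then have "\<forall>\<^sub>F n in sequentially. \<phi> n x = 0" by (auto simp: eventually_sequentially)
        then have "(\<lambda>n. \<phi> n x) \<longlonglongrightarrow> 0" by (rule tendsto_eventually)
        then show ?thesis using False by simp
      qed
    qed
    show "AE x in \<nu>. norm (\<phi> n x) \<le> indicator K x" for n
    proof (rule AE_I2)
      fix x
      have "\<phi> n x \<le> 1" "\<phi> n x \<ge> 0" using r infdist_nonneg[of x C] by (auto simp: \<phi>_def)
      then show "norm (\<phi> n x) \<le> indicator K x" using zero[of x n] by (cases "x \<in> K") auto
    qed
  qed
  moreover have "(LINT x|\<nu>. indicator C x) = (0::real)"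
    using null C_set by (simp add: measure_def)
  ultimately have "\<forall>\<^sub>F n in sequentially. (LINT x|\<nu>. \<phi> n x) < \<gamma>"
    using \<gamma> by (simp add: order_tendsto_iff)
  then obtain n where n: "(LINT x|\<nu>. \<phi> n x) < \<gamma>" by (auto simp: eventually_sequentially)
  have cl: "closure {x. \<phi> n x \<noteq> 0} \<subseteq> K"
    using sub K by (intro closure_minimal) (auto simp: compact_imp_closed)
  then have "compact (closure {x. \<phi> n x \<noteq> 0})"
    using K by (meson bounded_subset closed_closure compact_eq_bounded_closed)
  then show ?thesis
    using cont cl \<open>K \<subseteq> \<Omega>\<close> C1 n by (intro exI[of _ "\<phi> n"]) (auto simp: \<phi>_def)
qed

theorem theorem3:
  fixes V :: "real^'k \<Rightarrow> real"
    and \<Omega> U :: "(real^2) set"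
    and M\<^sub>0 \<delta> :: real
    and \<epsilon> :: "nat \<Rightarrow> real"
    and u :: "nat \<Rightarrow> real^2 \<Rightarrow> real^'k"
    and \<nu> :: "(real^2) measure"
  assumes potential: "multi_well_potential V"
    and domain: "smooth_bounded_domain \<Omega>"
    and M0_pos: "M\<^sub>0 > 0"
    and eps_range: "\<And>n. 0 < \<epsilon> n \<and> \<epsilon> n \<le> 1"
    and eps_decreasing: "decseq \<epsilon>"
    and eps_limit: "\<epsilon> \<longlonglongrightarrow> 0"
    and solution: "\<And>n. AC_solution V \<Omega> (\<epsilon> n) (u n)"
    and energy_bound: "\<And>n. emeasure (energy_measure V \<Omega> (\<epsilon> n) (u n)) \<Omega> \<le> ennreal M\<^sub>0"
    and limit_radon: "radon_measure_on \<Omega> \<nu>"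
    and convergence:
      "converges_as_measures_on \<Omega> (\<lambda>n. energy_measure V \<Omega> (\<epsilon> n) (u n)) \<nu>"
    and U_open: "open U"
    and U_closure: "closure U \<subseteq> \<Omega>"
    and delta_pos: "\<delta> > 0"
    and collar_null: "emeasure \<nu> (outer_collar_in \<Omega> \<delta> U) = 0"
  shows "emeasure \<nu> (closure U) = 0"
proof (cases "U = {}")
  case True
  then show ?thesis by simp
next
  case False
  have \<Omega>: "open \<Omega>" "bounded \<Omega>" using domain by (auto simp: smooth_bounded_domain_def)
  note PV = multi_well_potentialD[OF potential]
  have eps: "0 < \<epsilon> n" "\<epsilon> n \<le> 1" for n using eps_range by auto
  define E where "E n = energy_density V (\<epsilon> n) (u n)" for n
  have u: "Cm_on 2 \<Omega> (u n)" for n using solution[of n] by (simp add: AC_solution_def)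
  have cE: "continuous_on \<Omega> (E n)" for n
    unfolding E_def by (rule continuous_on_energy_density[OF u PV(3)])
  have E0: "E n x \<ge> 0" for n x
    using eps(1)[of n] PV(2) by (simp add: E_def energy_density_def grad_norm_sq_def sum_nonneg)
  have energy: "(\<integral>\<^sup>+x. ennreal (energy_density V (\<epsilon> n) (u n) x) * indicator \<Omega> x \<partial>lborel) \<le> ennreal M\<^sub>0" for n
    using energy_bound[of n] emeasure_energy_measure[OF \<Omega>(1) cE[unfolded E_def, of n]] by simp
  have test: "(\<lambda>n. integral\<^sup>L lborel (\<lambda>x. \<phi> x * E n x)) \<longlonglongrightarrow> (LINT x|\<nu>. \<phi> x)"
    if \<phi>: "continuous_on UNIV \<phi>" "compact (closure {x. \<phi> x \<noteq> 0})" "closure {x. \<phi> x \<noteq> 0} \<subseteq> \<Omega>"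
    for \<phi> :: "real^2 \<Rightarrow> real"
  proof -
    have "\<phi> x = 0" if "x \<notin> \<Omega>" for x using \<phi>(3) closure_subset[of "{x. \<phi> x \<noteq> 0}"] that by auto
    then have "(LINT x|energy_measure V \<Omega> (\<epsilon> n) (u n). \<phi> x) = integral\<^sup>L lborel (\<lambda>x. \<phi> x * E n x)" for n
      unfolding E_def
      by (intro integral_energy_measure \<Omega> cE[unfolded E_def] E0[unfolded E_def] \<phi>)
    then show ?thesis
      using convergence \<phi> unfolding converges_as_measures_on_def by fastforce
  qed
  have clU: "compact (closure U)"
    using \<Omega>(2) U_closure by (meson bounded_subset closed_closure compact_eq_bounded_closed)
  obtain r0 where r0: "r0 > 0" "(\<Union>x\<in>closure U. cball x r0) \<subseteq> \<Omega>"
    using compact_subset_open_imp_cball_epsilon_subset[OF clU \<Omega>(1) U_closure] by blast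
  \<comment> \<open>The bound by \<delta> places the transition region in the collar, the bound by
    \<open>r0\<close> keeps it inside \<Omega>.\<close>
  define r where "r = min \<delta> r0"
  have r: "r > 0" "r \<le> \<delta>" "r \<le> r0" using delta_pos r0 by (auto simp: r_def)
  have clU_ne: "closure U \<noteq> {}" using False by simp
  define N where "N = {x. infdist x (closure U) \<le> r}"
  have N: "compact N" unfolding N_def by (rule compact_infdist_le[OF clU_ne clU r(1)])
  have N\<Omega>: "N \<subseteq> \<Omega>"
  proof
    fix x assume "x \<in> N"
    moreover obtain y where "y \<in> closure U" "infdist x (closure U) = dist x y"
      using infdist_attains_inf[OF closed_closure clU_ne] by blast
    ultimately have "x \<in> cball y r0" using r by (simp add: N_def dist_commute)
    then show "x \<in> \<Omega>" using r0 \<open>y \<in> closure U\<close> by blast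
  qed
  \<comment> \<open>The set contains the frontier of \<open>U\<close>. Since \<open>U\<close> is
    open, it is compact, so vanishing limit mass forces the energies on it to tend to 0.\<close>
  define C where "C = N - U"
  have C: "compact C" "C \<subseteq> N" using N U_open by (auto simp: C_def intro: compact_diff)
  have C_null: "emeasure \<nu> C = 0"
  proof (rule emeasure_eq_0[OF _ collar_null])
    \<comment> \<open>\<open>N\<close> measures distance to the closure, the collar to
      \<open>U\<close> itself.\<close>
    have "infdist x U \<le> infdist x (closure U)" for x
    proof -
      obtain y where "y \<in> closure U" "infdist x (closure U) = dist x y"
        using infdist_attains_inf[OF closed_closure clU_ne] by blast
      then show ?thesis
        using infdist_triangle[of x U y] by (simp add: in_closure_iff_infdist_zero[OF False])
    qed
    then have "C \<subseteq> {x\<in>\<Omega>. infdist x U \<le> \<delta>} - U"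
      using r N\<Omega> unfolding C_def N_def by (smt (verit) DiffE DiffI mem_Collect_eq subset_iff)
    then show "C \<subseteq> outer_collar_in \<Omega> \<delta> U"
      by (simp add: outer_collar_in_def closed_nbhd_in_def)
    have "closed {x. infdist x U \<le> \<delta>}"
      by (intro closed_Collect_le continuous_intros)
    then have "{x. infdist x U \<le> \<delta>} - U \<in> sets borel" using U_open by auto
    moreover have "outer_collar_in \<Omega> \<delta> U = \<Omega> \<inter> ({x. infdist x U \<le> \<delta>} - U)"
      by (auto simp: outer_collar_in_def closed_nbhd_in_def)
    ultimately show "outer_collar_in \<Omega> \<delta> U \<in> sets \<nu>"
      using limit_radon by (auto simp: radon_measure_on_def sets_restrict_space)
  qed
  \<comment> \<open>The indicator of \<open>C\<close> is not a test function. It is dominated by one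
    whose limit integral is as small as desired.\<close>
  have lim_C: "(\<lambda>n. integral\<^sup>L lborel (\<lambda>x. indicator C x * E n x)) \<longlonglongrightarrow> 0"
  proof (rule order_tendstoI)
    fix a :: real assume "a < 0"
    moreover have "0 \<le> integral\<^sup>L lborel (\<lambda>x. indicator C x * E n x)" for n
      using E0 by (intro Bochner_Integration.integral_nonneg) (auto simp: indicator_def)
    ultimately show "\<forall>\<^sub>F n in sequentially. a < integral\<^sup>L lborel (\<lambda>x. indicator C x * E n x)"
      by (intro always_eventually allI) (meson less_le_trans)
  next
    fix a :: real assume "0 < a"
    from exists_test_function_small_integral[OF limit_radon \<Omega>(1) C(1) _ C_null this] C(2) N\<Omega>
    obtain \<phi> :: "real^2 \<Rightarrow> real" where \<phi>: "continuous_on UNIV \<phi>" "compact (closure {x. \<phi> x \<noteq> 0})"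
      "closure {x. \<phi> x \<noteq> 0} \<subseteq> \<Omega>" "\<And>x. 0 \<le> \<phi> x" "\<And>x. x \<in> C \<Longrightarrow> \<phi> x = 1" "(LINT x|\<nu>. \<phi> x) < a"
      by blast
    have ev: "\<forall>\<^sub>F n in sequentially. integral\<^sup>L lborel (\<lambda>x. \<phi> x * E n x) < a"
      using test[OF \<phi>(1-3)] \<phi>(6) by (rule order_tendstoD)
    have "integral\<^sup>L lborel (\<lambda>x. indicator C x * E n x) \<le> integral\<^sup>L lborel (\<lambda>x. \<phi> x * E n x)" for n
    proof (rule integral_mono)
      show "integrable lborel (\<lambda>x. indicator C x * E n x)"
        using borel_integrable_compact[OF C(1), of "E n"] cE[of n] C(2) N\<Omega> continuous_on_subset[of \<Omega> "E n" C]
        by auto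
      have z: "\<phi> x * E n x = 0" if "x \<notin> closure {x. \<phi> x \<noteq> 0}" for x
        using that closure_subset[of "{x. \<phi> x \<noteq> 0}"] by auto
      have "continuous_on \<Omega> (\<lambda>x. \<phi> x * E n x)"
        using \<phi>(1) by (intro continuous_intros cE) (auto elim: continuous_on_subset)
      from continuous_on_UNIV_extend_zero[OF \<Omega>(1) \<phi>(2,3) this z]
      show "integrable lborel (\<lambda>x. \<phi> x * E n x)"
        by (rule integrable_continuous_compact_support[OF \<phi>(2) _ z])
      show "indicator C x * E n x \<le> \<phi> x * E n x" for x
        using \<phi>(4,5) E0 by (auto simp: indicator_def)
    qed
    with ev show "\<forall>\<^sub>F n in sequentially. integral\<^sup>L lborel (\<lambda>x. indicator C x * E n x) < a"
      by (auto elim!: eventually_mono intro: le_less_trans)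
  qed
  obtain \<eta> G where \<eta>: "\<And>x. (\<eta> has_derivative (\<lambda>v. G x \<bullet> v)) (at x)" and G: "continuous_on UNIV G"
    and \<eta>0: "\<And>x. 0 \<le> \<eta> x" and \<eta>1: "\<And>x. x \<in> closure U \<Longrightarrow> \<eta> x = 1"
    and \<eta>far: "\<And>x. \<eta> x \<noteq> 0 \<Longrightarrow> \<exists>y\<in>closure U. dist x y < r"
    using exists_cutoff[OF clU r(1)] by metis
  have \<eta>N: "\<eta> x = 0" if "x \<notin> N" for x
  proof (rule ccontr)
    assume "\<eta> x \<noteq> 0"
    then obtain y where "y \<in> closure U" "dist x y < r" using \<eta>far by blast
    then have "infdist x (closure U) \<le> r" by (meson infdist_le2 less_imp_le)
    then show False using that by (simp add: N_def)
  qed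
  \<comment> \<open>Applied on \<open>U\<close>, where \<eta> = 1, and off \<open>N\<close>, where
    \<eta> = 0; together this confines \<open>G\<close> to \<open>C\<close>.\<close>
  have G_const: "G x = 0" if S: "open S" "x \<in> S" "\<And>y. y \<in> S \<Longrightarrow> \<eta> y = a" for x S a
  proof -
    have "(\<eta> has_derivative (\<lambda>v. 0)) (at x)"
      using has_derivative_transform_within_open[OF has_derivative_const[of a] S(1,2)] S(3) by metis
    then have "(\<lambda>v. G x \<bullet> v) = (\<lambda>v. 0)" using \<eta> has_derivative_unique by blast
    then have "G x \<bullet> G x = 0" by meson
    then show ?thesis by simp
  qed
  have G_N: "G x = 0" if "x \<notin> N" for x
    by (rule G_const[of "- N" x 0]) (use that N \<eta>N in \<open>auto simp: compact_imp_closed open_Compl\<close>)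
  have G_C: "G x = 0" if "x \<notin> C" for x
  proof (cases "x \<in> U")
    case True
    then show ?thesis using G_const[OF U_open True, of 1] \<eta>1 closure_subset by blast
  next
    case False
    then show ?thesis using G_N that by (auto simp: C_def)
  qed
  obtain \<beta> where \<beta>: "\<And>x. norm (G x) \<le> \<beta>"
  proof -
    have "bounded (G ` N)"
      using N G by (meson compact_continuous_image compact_imp_bounded continuous_on_subset subset_UNIV)
    then obtain B where B: "\<And>x. x \<in> N \<Longrightarrow> norm (G x) \<le> B"
      unfolding bounded_iff by (metis image_eqI)
    have "norm (G x) \<le> max B 0" for x
      using B[of x] G_N[of x] by (cases "x \<in> N") auto
    then show ?thesis using that by blast
  qed
  obtain \<rho> where \<rho>: "\<And>x. x \<in> N \<Longrightarrow> norm x \<le> \<rho>"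
    using compact_imp_bounded[OF N] unfolding bounded_iff by blast
  obtain M where M: "\<And>n x. x \<in> N \<Longrightarrow> norm (u n x) \<le> M"
    using uniform_solution_bound[OF potential \<Omega>(1) N N\<Omega> less_imp_le[OF M0_pos]] eps solution energy by metis
  obtain Cg where Cg: "Cg \<ge> 0"
    and grad: "\<And>\<epsilon> u x b. 0 < \<epsilon> \<Longrightarrow> \<epsilon> \<le> 1 \<Longrightarrow> AC_solution V \<Omega> \<epsilon> u \<Longrightarrow>
      (\<integral>\<^sup>+x. ennreal (energy_density V \<epsilon> u x) * indicator \<Omega> x \<partial>lborel) \<le> ennreal M\<^sub>0 \<Longrightarrow>
      x \<in> N \<Longrightarrow> b \<in> Basis \<Longrightarrow> norm (dirderiv u b x) \<le> Cg / \<epsilon>"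
    using uniform_gradient_bound[OF potential \<Omega>(1) N N\<Omega> less_imp_le[OF M0_pos]] by blast
  have "bounded (gradient V ` cball 0 M)"
    using PV(4) by (meson compact_cball compact_continuous_image compact_imp_bounded continuous_on_subset subset_UNIV)
  then obtain L where L: "\<And>y. norm y \<le> M \<Longrightarrow> norm (gradient V y) \<le> L"
    unfolding bounded_iff by (metis image_eqI mem_cball_0)
  have posdef: "hessian_form V y v v > 0" if "V y = 0" "v \<noteq> 0" for y v
    using potential that by (simp add: multi_well_potential_def hessian_form_eq_hessian)
  obtain c k where c: "c > 0" and k: "k \<ge> 0"
    and hess: "\<And>y v. norm y \<le> M \<Longrightarrow> hessian_form V y v v \<ge> (c - k * V y) * (norm v)\<^sup>2"
    using hessian_form_coercive[OF PV(1,2) posdef, of M] by blast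
  define Z where "Z n = integral\<^sup>L lborel (\<lambda>x. indicator C x * E n x)" for n
  \<comment> \<open>Absorbs the gradient bound: k V |p|^2 is at most k Cg^2 V/\<epsilon>^2.\<close>
  define k' where "k' = k * Cg\<^sup>2"
  have estimate: "integral\<^sup>L lborel (\<lambda>x. \<eta> x * E n x) \<le> \<beta> * L / (2 * c) * (\<epsilon> n * measure lborel C + Z n)
      + (k' / c + 1) * (2 * (\<rho> * \<beta>)) * Z n" for n
  proof -
    note grad_n = grad[OF eps solution energy, of _ _ n]
    interpret localised_solution V \<Omega> N "\<epsilon> n" "u n" \<eta> G
      by unfold_locales (use PV \<Omega> eps solution N N\<Omega> \<eta> G \<eta>0 \<eta>N G_N in auto)
    show ?thesis
      unfolding Z_def E_def
    proof (rule localised_energy_estimate[OF C G_C c])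
      show "k' \<ge> 0" using k by (simp add: k'_def)
      fix x assume x: "x \<in> N"
      show "norm (gradient V (u n x)) \<le> L" by (rule L[OF M[OF x]])
      fix b :: "real^2" assume b: "b \<in> Basis"
      define p where "p = norm (dirderiv (u n) b x)"
      have "p\<^sup>2 \<le> (Cg / \<epsilon> n)\<^sup>2" using grad_n[OF x b] by (intro power_mono) (auto simp: p_def)
      then have "k * V (u n x) * p\<^sup>2 \<le> k * V (u n x) * (Cg / \<epsilon> n)\<^sup>2"
        using k PV(2)[of "u n x"] by (intro mult_left_mono) auto
      then have "c * p\<^sup>2 - k' * V (u n x) / (\<epsilon> n)\<^sup>2 \<le> (c - k * V (u n x)) * p\<^sup>2"
        by (simp add: k'_def power_divide algebra_simps)
      also have "\<dots> \<le> hessian_form V (u n x) (dirderiv (u n) b x) (dirderiv (u n) b x)"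
        unfolding p_def by (rule hess[OF M[OF x]])
      finally show "c * (norm (dirderiv (u n) b x))\<^sup>2 - k' * V (u n x) / (\<epsilon> n)\<^sup>2 \<le>
          hessian_form V (u n x) (dirderiv (u n) b x) (dirderiv (u n) b x)"
        by (simp add: p_def)
    qed (use \<beta> \<rho> in auto)
  qed
  have cont_\<eta>: "continuous_on UNIV \<eta>"
    by (intro continuous_at_imp_continuous_on ballI has_derivative_continuous[OF \<eta>])
  have supp: "closure {x. \<eta> x \<noteq> 0} \<subseteq> N"
    using \<eta>N N by (intro closure_minimal) (auto simp: compact_imp_closed)
  then have "compact (closure {x. \<eta> x \<noteq> 0})"
    using N by (meson bounded_subset closed_closure compact_eq_bounded_closed)
  then have "(\<lambda>n. integral\<^sup>L lborel (\<lambda>x. \<eta> x * E n x)) \<longlonglongrightarrow> (LINT x|\<nu>. \<eta> x)"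
    using supp N\<Omega> by (intro test cont_\<eta>) auto
  \<comment> \<open>All the constants were obtained for every index at once, so only \<epsilon> and
    \<open>Z\<close> vary, and both tend to 0.\<close>
  moreover have "(\<lambda>n. \<beta> * L / (2 * c) * (\<epsilon> n * measure lborel C + Z n) + (k' / c + 1) * (2 * (\<rho> * \<beta>)) * Z n)
      \<longlonglongrightarrow> \<beta> * L / (2 * c) * (0 * measure lborel C + 0) + (k' / c + 1) * (2 * (\<rho> * \<beta>)) * 0"
    using lim_C unfolding Z_def by (intro tendsto_intros eps_limit)
  ultimately have "(LINT x|\<nu>. \<eta> x) \<le> \<beta> * L / (2 * c) * (0 * measure lborel C + 0) + (k' / c + 1) * (2 * (\<rho> * \<beta>)) * 0"
    using estimate by (intro LIMSEQ_le) auto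
  then have \<eta>_le: "(LINT x|\<nu>. \<eta> x) \<le> 0" by simp
  have clU_set: "closure U \<in> sets \<nu>"
    using limit_radon U_closure \<Omega> by (auto simp: radon_measure_on_def sets_restrict_space intro!: image_eqI[of _ _ "closure U"])
  have int_\<eta>: "integrable \<nu> \<eta>"
    by (rule radon_integrable_compact_support(1)[OF limit_radon \<Omega>(1) N N\<Omega> cont_\<eta> \<eta>N])
  \<comment> \<open>\<open>measure\<close> takes the value 0 on sets of infinite mass, so finiteness
    is required to return to \<open>emeasure\<close> at the end.\<close>
  have fin: "emeasure \<nu> (closure U) < \<infinity>"
    using limit_radon clU U_closure by (simp add: radon_measure_on_def)
  have "measure \<nu> (closure U) = (LINT x|\<nu>. indicator (closure U) x)"
    using clU_set fin by simp
  also have "\<dots> \<le> (LINT x|\<nu>. \<eta> x)"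
    using clU_set fin \<eta>0 \<eta>1 int_\<eta> by (intro integral_mono integrable_real_indicator) (auto simp: indicator_def)
  finally have "measure \<nu> (closure U) = 0"
    using \<eta>_le measure_nonneg[of \<nu> "closure U"] by linarith
  then show ?thesis
    using fin by (simp add: emeasure_eq_ennreal_measure)
qed

end
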